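(* Let $m>2$, let $D$ and $Q$ be the dihedral group and the generalized quaternion group of order $2^m$, respectively, let $E$ be a finite elementary abelian $2$-group and $F$ a finite field of characteristic two. Then \[ |V_*(FG)|=n\cdot |F|^{\frac{1}{2}(|G|+|G_T|)-1}, \] where $n=1$ if $G=D\times E$ and $n=4$ if $G=Q\times E$.
   Context: For a finite $2$-group $G$ and a finite field $F$ of characteristic two, $FG$ is the group algebra, and $*$ is the classical involution of $FG$, i.e. the $F$-linear extension of $g\mapsto g^{-1}$ ($g\in G$). $V(FG)$ is the group of normalized units of $FG$ (units whose coefficients sum to $1$). $V_*(FG)=\{u\in V(FG) : u^*=u^{-1}\}$. $G_T=\{g\in G : g^2=1\}$ (so $1\in G_T$). *)

theory Defs
  imports "HOL-Algebra.Algebra"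
begin

definition has_characteristic :: "('f, 'x) ring_scheme \<Rightarrow> nat \<Rightarrow> bool" where
  "has_characteristic F p \<longleftrightarrow>
     (\<forall>k::nat. [k] \<cdot>\<^bsub>F\<^esub> \<one>\<^bsub>F\<^esub> = \<zero>\<^bsub>F\<^esub> \<longleftrightarrow> p dvd k)"

text \<open>The trivial group is an elementary abelian 2-group.\<close>

definition elementary_abelian_2_group :: "('g, 'x) monoid_scheme \<Rightarrow> bool" where
  "elementary_abelian_2_group E \<longleftrightarrow>
     comm_group E \<and> (\<forall>x\<in>carrier E. x [^]\<^bsub>E\<^esub> (2::nat) = \<one>\<^bsub>E\<^esub>)"

text \<open>
  The dihedral and the generalized quaternion group of order \<open>2 ^ m\<close>, up to isomorphism:
  groups generated by two elements satisfying the defining relations of the usual presentations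
  \<open>\<langle>a, b | a ^ (2 ^ (m - 1)) = 1, b ^ 2 = 1, b\<inverse> a b = a\<inverse>\<rangle>\<close> and
  \<open>\<langle>a, b | a ^ (2 ^ (m - 1)) = 1, b ^ 2 = a ^ (2 ^ (m - 2)), b\<inverse> a b = a\<inverse>\<rangle>\<close>.
  The presented groups have order exactly \<open>2 ^ m\<close> (for \<open>m \<ge> 2\<close>), so prescribing the order
  excludes their proper quotients.
\<close>

definition dihedral_2_group :: "nat \<Rightarrow> ('g, 'x) monoid_scheme \<Rightarrow> bool" where
  "dihedral_2_group m D \<longleftrightarrow>
     group D \<and> order D = 2 ^ m \<and>
     (\<exists>a\<in>carrier D. \<exists>b\<in>carrier D.
        generate D {a, b} = carrier D \<and>
        a [^]\<^bsub>D\<^esub> ((2::nat) ^ (m - 1)) = \<one>\<^bsub>D\<^esub> \<and>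
        b [^]\<^bsub>D\<^esub> (2::nat) = \<one>\<^bsub>D\<^esub> \<and>
        inv\<^bsub>D\<^esub> b \<otimes>\<^bsub>D\<^esub> a \<otimes>\<^bsub>D\<^esub> b = inv\<^bsub>D\<^esub> a)"

definition generalized_quaternion_group :: "nat \<Rightarrow> ('g, 'x) monoid_scheme \<Rightarrow> bool" where
  "generalized_quaternion_group m Q \<longleftrightarrow>
     group Q \<and> order Q = 2 ^ m \<and>
     (\<exists>a\<in>carrier Q. \<exists>b\<in>carrier Q.
        generate Q {a, b} = carrier Q \<and>
        a [^]\<^bsub>Q\<^esub> ((2::nat) ^ (m - 1)) = \<one>\<^bsub>Q\<^esub> \<and>
        b [^]\<^bsub>Q\<^esub> (2::nat) = a [^]\<^bsub>Q\<^esub> ((2::nat) ^ (m - 2)) \<and>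
        inv\<^bsub>Q\<^esub> b \<otimes>\<^bsub>Q\<^esub> a \<otimes>\<^bsub>Q\<^esub> b = inv\<^bsub>Q\<^esub> a)"

text \<open>
  The group algebra of a finite group \<open>G\<close>: an element \<open>\<Sum>g. u g \<cdot> g\<close> is its coefficient function,
  undefined outside the carrier of \<open>G\<close> so that distinct functions are distinct elements.
  For infinite \<open>G\<close> this is not the group algebra (no finite-support condition is imposed).
\<close>

definition group_algebra :: "('f, 'x) ring_scheme \<Rightarrow> ('g, 'y) monoid_scheme \<Rightarrow> ('g \<Rightarrow> 'f) ring" where
  "group_algebra F G =
     \<lparr>carrier = carrier G \<rightarrow>\<^sub>E carrier F,
      monoid.mult = (\<lambda>u v. \<lambda>x\<in>carrier G.
                \<Oplus>\<^bsub>F\<^esub>y\<in>carrier G. u y \<otimes>\<^bsub>F\<^esub> v (inv\<^bsub>G\<^esub> y \<otimes>\<^bsub>G\<^esub> x)),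
      one = (\<lambda>x\<in>carrier G. if x = \<one>\<^bsub>G\<^esub> then \<one>\<^bsub>F\<^esub> else \<zero>\<^bsub>F\<^esub>),
      ring.zero = (\<lambda>x\<in>carrier G. \<zero>\<^bsub>F\<^esub>),
      ring.add = (\<lambda>u v. \<lambda>x\<in>carrier G. u x \<oplus>\<^bsub>F\<^esub> v x)\<rparr>"

text \<open>
  The linear extension of \<open>g \<mapsto> g\<inverse>\<close> sends \<open>\<Sum>g. u g \<cdot> g\<close> to \<open>\<Sum>g. u g \<cdot> g\<inverse>\<close>, whose coefficient
  at \<open>x\<close> is \<open>u (x\<inverse>)\<close>.
\<close>

definition classical_involution :: "('g, 'y) monoid_scheme \<Rightarrow> ('g \<Rightarrow> 'f) \<Rightarrow> ('g \<Rightarrow> 'f)" where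
  "classical_involution G u = (\<lambda>x\<in>carrier G. u (inv\<^bsub>G\<^esub> x))"

definition normalized_units :: "('f, 'x) ring_scheme \<Rightarrow> ('g, 'y) monoid_scheme \<Rightarrow> ('g \<Rightarrow> 'f) set" where
  "normalized_units F G =
     {u \<in> Units (group_algebra F G). (\<Oplus>\<^bsub>F\<^esub>x\<in>carrier G. u x) = \<one>\<^bsub>F\<^esub>}"

definition unitary_normalized_units :: "('f, 'x) ring_scheme \<Rightarrow> ('g, 'y) monoid_scheme \<Rightarrow> ('g \<Rightarrow> 'f) set" where
  "unitary_normalized_units F G =
     {u \<in> normalized_units F G. classical_involution G u = inv\<^bsub>group_algebra F G\<^esub> u}"

definition involutions_with_one :: "('g, 'y) monoid_scheme \<Rightarrow> 'g set" where
  "involutions_with_one G = {g \<in> carrier G. g [^]\<^bsub>G\<^esub> (2::nat) = \<one>\<^bsub>G\<^esub>}"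

end

theory Submission
  imports Defs
begin

text \<open>
  \<open>G\<close> has an abelian subgroup \<open>A = \<langle>a\<rangle> \<times> E\<close> of index two which \<open>b\<close> inverts, and \<open>b\<^sup>2\<close> is \<open>1\<close> or the
  involution \<open>z\<close> of \<open>\<langle>a\<rangle>\<close>. Writing \<open>u = x + y b\<close> with \<open>x, y \<in> FA\<close>, the element \<open>u\<close> is unitary iff
  \<open>x x\<^sup>* + y y\<^sup>* = 1\<close> and, if \<open>b\<^sup>2 = z\<close>, also \<open>x y (1 + z) = 0\<close>.

  In the dihedral case put \<open>s = x + y\<close>, a unit of augmentation one, and \<open>w = x s\<^sup>*\<close>: the
  equation becomes \<open>w + w\<^sup>* = 1 + s s\<^sup>*\<close>, whose solutions form a coset of the symmetric elements.

  In the quaternion case one of \<open>x, y\<close> is a unit, so the other is annihilated by \<open>1 + z\<close>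
  and has norm zero; hence \<open>|V\<^sub>*(FG)|\<close> is twice \<open>|V\<^sub>*(FA)|\<close> times the size of the annihilator.
  The group \<open>V\<^sub>*(FA)\<close> is the kernel of the norm \<open>x \<mapsto> x x\<^sup>*\<close> on the normalized units. With \<open>t = 1 + a\<close>
  and \<open>\<mu>(w)\<close> the sum of the coefficients of \<open>w\<close> at elements involving an odd power of \<open>a\<close>, the
  image of the norm consists of the \<open>1 + w + w\<^sup>*\<close> such that \<open>\<mu>(w)\<close> has the form \<open>c + c\<^sup>2\<close>.
  The second factor two stems from this Artin-Schreier condition. Surjectivity onto this set
  is successive approximation along the powers of \<open>t\<close>, based on \<open>t t\<^sup>* = t + t\<^sup>*\<close>.
\<close>

text \<open>All cardinalities come from comparing fibres of the augmentation, of
  \<open>\<mu>\<close>, of the trace \<open>w + star w\<close> and of the norm, so no generators of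
  unit groups are needed. The obstacle is that the norm does not reach every
  \<open>1 + w + star w\<close>. Write an element of augmentation one as r + \<beta> t + t^2 y,
  where r and \<beta> are combinations of elements g with g^2 = 1. Then r^2 = 1, and the first-order
  part of the norm is (r \<beta> + \<beta>^2)(t + star t); the augmentation of this coefficient is c
  + c^2, where c is that of \<beta>. The derivation \<open>\<mu>\<close> kills multiples of t^2,
  because \<open>aug t\<close> is zero, and so reads off exactly this value. It also vanishes on
  symmetric elements, so the condition on \<open>\<mu> w\<close> depends on the trace alone. Terms
  divisible by t^2 meet no obstruction, and the approximation starts with them. In the quaternion
  case the other factor two records which of x and y is the unit. The exponents count orbits on A:
  under inversion for symmetric elements, under multiplication by z for the annihilator.\<close>

section \<open>Counting and summing over the orbits of an involution\<close>

text \<open>Take \<open>H\<close> maximal among the subsets disjoint from their image: a moved point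
  outside \<open>H\<close> and its image could still be added to \<open>H\<close>.\<close>

lemma involution_transversal:
  assumes "finite A" "\<And>x. x \<in> A \<Longrightarrow> f x \<in> A" "\<And>x. x \<in> A \<Longrightarrow> f (f x) = x"
  obtains H where "H \<subseteq> A" "H \<inter> f ` H = {}" "A = {x \<in> A. f x = x} \<union> (H \<union> f ` H)"
proof -
  let ?P = "{H. H \<subseteq> A \<and> H \<inter> f ` H = {}}"
  have "finite ?P" "?P \<noteq> {}"
    using assms(1) by auto
  then obtain H where H: "H \<in> ?P" and max: "\<And>K. K \<in> ?P \<Longrightarrow> H \<subseteq> K \<Longrightarrow> H = K"
    by (metis (no_types, lifting) finite_has_maximal)
  have "x \<in> H \<union> f ` H" if x: "x \<in> A" "f x \<noteq> x" for x
  proof (rule ccontr)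
    assume n: "x \<notin> H \<union> f ` H"
    have "f x \<notin> H"
      using n x assms(3) by (metis Un_iff image_eqI)
    then have "insert x H \<in> ?P"
      using n x H by auto
    from max[OF this] n show False by blast
  qed
  then have "A = {x \<in> A. f x = x} \<union> (H \<union> f ` H)"
    using H assms(2) by auto
  with H that show thesis by blast
qed

text \<open>An invariant function is given freely by its values on the fixed points and on a
  transversal \<open>H\<close> of the two-element orbits. This leaves one value per orbit, and the
  number of orbits is half the sum of the number of points and the number of fixed points.\<close>

lemma card_functions_invariant:
  assumes "finite A" "\<And>x. x \<in> A \<Longrightarrow> f x \<in> A" "\<And>x. x \<in> A \<Longrightarrow> f (f x) = x"
  shows "even (card A + card {x \<in> A. f x = x})"
    and "card {u \<in> A \<rightarrow>\<^sub>E C. \<forall>x\<in>A. u (f x) = u x} = card C ^ ((card A + card {x \<in> A. f x = x}) div 2)"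
proof -
  obtain H where H: "H \<subseteq> A" "H \<inter> f ` H = {}" "A = {x \<in> A. f x = x} \<union> (H \<union> f ` H)"
    by (rule involution_transversal[OF assms(1-3)])
  let ?X = "{x \<in> A. f x = x}"
  have fin: "finite H" "finite ?X"
    using H(1) assms(1) by (auto intro: finite_subset)
  have inj: "inj_on f H"
    using H(1) assms(3) by (intro inj_on_inverseI[where g = f]) auto
  have X_disj: "x \<notin> ?X" if "x \<in> H \<union> f ` H" for x
  proof
    assume x: "x \<in> ?X"
    have "x \<in> H"
      using that
    proof
      assume "x \<in> f ` H"
      then obtain y where y: "y \<in> H" "x = f y" by blast
      then have "f x = y" using H(1) assms(3) by blast
      with x y show ?thesis by simp
    qed
    moreover from this have "f x \<in> f ` H" by (rule imageI)
    moreover have "f x = x" using x by blast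
    ultimately show False using H(2) by (simp only: disjoint_iff)
  qed
  from X_disj have disj: "?X \<inter> H = {}" "?X \<inter> (H \<union> f ` H) = {}"
    by blast+
  have "card A = card (?X \<union> (H \<union> f ` H))"
    using H(3) by (rule arg_cong)
  also have "\<dots> = card ?X + card (H \<union> f ` H)"
    using card_Un_disjoint[of ?X "H \<union> f ` H"] disj fin by simp
  also have "card (H \<union> f ` H) = 2 * card H"
    using card_Un_disjoint[of H "f ` H"] fin H(2) card_image[OF inj] by simp
  finally have cA: "card A = card ?X + 2 * card H" .
  then show "even (card A + card ?X)" by simp
  let ?S = "{u \<in> A \<rightarrow>\<^sub>E C. \<forall>x\<in>A. u (f x) = u x}"
  let ?g = "\<lambda>v. \<lambda>x\<in>A. if x \<in> ?X \<union> H then v x else v (f x)"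
  have fH: "f x \<in> H" if "x \<in> A" "x \<notin> ?X \<union> H" for x
  proof -
    have "x \<in> f ` H" using H(3) that by blast
    then obtain y where y: "y \<in> H" "x = f y" by blast
    then have "f x = y" using H(1) assms(3) by blast
    with y show ?thesis by simp
  qed
  have fH': "f x \<notin> ?X \<union> H" if "x \<in> H" for x
    using X_disj[of "f x"] H(2) that by blast
  have "bij_betw (\<lambda>u. restrict u (?X \<union> H)) ?S (?X \<union> H \<rightarrow>\<^sub>E C)"
  proof (rule bij_betw_byWitness[where f' = ?g])
    show "\<forall>u\<in>?S. ?g (restrict u (?X \<union> H)) = u"
    proof
      fix u assume u: "u \<in> ?S"
      show "?g (restrict u (?X \<union> H)) = u"
      proof (rule extensionalityI[where A = A])
        fix x assume x: "x \<in> A"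
        then have "u (f x) = u x" using u by blast
        then show "?g (restrict u (?X \<union> H)) x = u x"
          using x fH[OF x] by auto
      qed (use u in \<open>auto simp: PiE_iff\<close>)
    qed
    show "\<forall>v\<in>?X \<union> H \<rightarrow>\<^sub>E C. restrict (?g v) (?X \<union> H) = v"
    proof
      fix v assume v: "v \<in> ?X \<union> H \<rightarrow>\<^sub>E C"
      show "restrict (?g v) (?X \<union> H) = v"
        by (rule extensionalityI[where A = "?X \<union> H"]) (use v H(1) in \<open>auto simp: PiE_iff\<close>)
    qed
    show "(\<lambda>u. restrict u (?X \<union> H)) ` ?S \<subseteq> ?X \<union> H \<rightarrow>\<^sub>E C"
      using H(1) by (intro image_subsetI, simp only: restrict_PiE_iff) (auto dest: PiE_mem)
    show "?g ` (?X \<union> H \<rightarrow>\<^sub>E C) \<subseteq> ?S"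
    proof
      fix u assume "u \<in> ?g ` (?X \<union> H \<rightarrow>\<^sub>E C)"
      then obtain v where v: "v \<in> ?X \<union> H \<rightarrow>\<^sub>E C" and u: "u = ?g v" by blast
      have "u \<in> A \<rightarrow>\<^sub>E C"
        unfolding u restrict_PiE_iff using PiE_mem[OF v] fH by auto
      moreover have "u (f x) = u x" if x: "x \<in> A" for x
      proof -
        consider "x \<in> ?X" | "x \<in> H" | "x \<notin> ?X \<union> H" by blast
        then show ?thesis
        proof cases
          case 2
          then show ?thesis using x fH'[OF 2] assms(2,3) by (auto simp: u)
        next
          case 3
          then show ?thesis using x fH[OF x 3] assms(2,3) by (auto simp: u)
        qed auto
      qed
      ultimately show "u \<in> ?S" by blast
    qed
  qed
  then have "card ?S = card (?X \<union> H \<rightarrow>\<^sub>E C)"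
    by (rule bij_betw_same_card)
  also have "\<dots> = card C ^ card (?X \<union> H)"
    using fin by (simp add: card_PiE)
  also have "card (?X \<union> H) = (card A + card ?X) div 2"
    using card_Un_disjoint[OF fin(2,1) disj(1)] cA by simp
  finally show "card ?S = card C ^ ((card A + card ?X) div 2)" .
qed

text \<open>Stands in for the index formula of a homomorphism. It lets the norm be counted on
  elements of augmentation one without making them into a group.\<close>

lemma card_eq_card_image_times_fibre:
  assumes "finite S" "\<And>x. x \<in> S \<Longrightarrow> card {y \<in> S. f y = f x} = c"
  shows "card S = card (f ` S) * c"
proof -
  have "card S = (\<Sum>y\<in>f ` S. card {x \<in> S. f x = y})"
    using assms(1) sum.image_gen[of S "\<lambda>_. 1::nat" f] by simp
  also have "\<dots> = (\<Sum>y\<in>f ` S. c)"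
    using assms(2) by (intro sum.cong) auto
  finally show ?thesis by simp
qed

context abelian_monoid
begin

lemma finsum_swap:
  assumes "finite A" "finite B" "\<And>i j. i \<in> A \<Longrightarrow> j \<in> B \<Longrightarrow> f i j \<in> carrier G"
  shows "(\<Oplus>i\<in>A. \<Oplus>j\<in>B. f i j) = (\<Oplus>j\<in>B. \<Oplus>i\<in>A. f i j)"
  using assms(1,3)
proof (induction A rule: finite_induct)
  case empty
  then show ?case by (simp add: finsum_zero)
next
  case (insert a A)
  have "(\<Oplus>i\<in>insert a A. \<Oplus>j\<in>B. f i j) = (\<Oplus>j\<in>B. f a j) \<oplus> (\<Oplus>i\<in>A. \<Oplus>j\<in>B. f i j)"
    using insert by (intro finsum_insert) (auto intro!: finsum_closed)
  also have "\<dots> = (\<Oplus>j\<in>B. f a j) \<oplus> (\<Oplus>j\<in>B. \<Oplus>i\<in>A. f i j)"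
    using insert by simp
  also have "\<dots> = (\<Oplus>j\<in>B. f a j \<oplus> (\<Oplus>i\<in>A. f i j))"
    using insert by (intro finsum_addf[symmetric]) (auto intro!: finsum_closed)
  also have "\<dots> = (\<Oplus>j\<in>B. \<Oplus>i\<in>insert a A. f i j)"
    using insert by (intro finsum_cong' finsum_insert[symmetric]) (auto intro!: finsum_closed)
  finally show ?case .
qed

lemma finsum_bij_betw:
  assumes "bij_betw h A B" "f \<in> B \<rightarrow> carrier G"
  shows "(\<Oplus>x\<in>B. f x) = (\<Oplus>x\<in>A. f (h x))"
  using finsum_reindex[of f h A] assms by (simp add: bij_betw_def)

text \<open>A two-element orbit contributes the same summand twice, hence zero.\<close>

lemma finsum_invariant_char2:
  assumes "finite A" "\<And>x. x \<in> A \<Longrightarrow> s x \<in> A" "\<And>x. x \<in> A \<Longrightarrow> s (s x) = x"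
    and f: "f \<in> A \<rightarrow> carrier G" "\<And>x. x \<in> A \<Longrightarrow> f (s x) = f x"
    and char2: "\<And>x. x \<in> carrier G \<Longrightarrow> x \<oplus> x = \<zero>"
  shows "(\<Oplus>x\<in>A. f x) = (\<Oplus>x\<in>{x \<in> A. s x = x}. f x)"
proof -
  let ?X = "{x \<in> A. s x = x}"
  obtain H where H: "H \<subseteq> A" "H \<inter> s ` H = {}" "A = ?X \<union> (H \<union> s ` H)"
    by (rule involution_transversal[OF assms(1-3)])
  have fin: "finite H" "finite ?X"
    using H(1) assms(1) by (auto intro: finite_subset)
  have inj: "inj_on s H"
    using H(1) assms(3) by (intro inj_on_inverseI[where g = s]) auto
  have "x \<notin> ?X" if "x \<in> H \<union> s ` H" for x
  proof
    assume x: "x \<in> ?X"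
    have "x \<in> H"
      using that
    proof
      assume "x \<in> s ` H"
      then obtain y where y: "y \<in> H" "x = s y" by blast
      then have "s x = y" using H(1) assms(3) by blast
      with x y show ?thesis by simp
    qed
    moreover from this have "s x \<in> s ` H" by (rule imageI)
    moreover have "s x = x" using x by blast
    ultimately show False using H(2) by (simp only: disjoint_iff)
  qed
  then have disj: "?X \<inter> (H \<union> s ` H) = {}"
    by blast
  have c: "f \<in> ?X \<rightarrow> carrier G" "f \<in> H \<rightarrow> carrier G" "f \<in> s ` H \<rightarrow> carrier G"
    using f(1) H(1) assms(2) by auto
  have "(\<Oplus>x\<in>s ` H. f x) = (\<Oplus>x\<in>H. f (s x))"
    using finsum_reindex[OF c(3) inj] .
  also have "\<dots> = (\<Oplus>x\<in>H. f x)"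
    using H(1) f(2) c by (intro finsum_cong') auto
  finally have "(\<Oplus>x\<in>H \<union> s ` H. f x) = \<zero>"
    using fin H(2) c char2[OF finsum_closed[OF c(2)]] by (subst finsum_Un_disjoint) auto
  moreover have "(\<Oplus>x\<in>A. f x) = (\<Oplus>x\<in>?X. f x) \<oplus> (\<Oplus>x\<in>H \<union> s ` H. f x)"
    by (subst H(3), rule finsum_Un_disjoint) (use fin disj c in auto)
  ultimately show ?thesis
    using c by (simp add: finsum_closed)
qed

end

section \<open>Group algebras of finite groups\<close>

locale finite_group_algebra = F?: field F + G: group G
  for F (structure) and G +
  assumes finite_carrier: "finite (carrier G)"
begin

abbreviation FG where "FG \<equiv> group_algebra F G"

abbreviation aug where "aug u \<equiv> (\<Oplus>x\<in>carrier G. u x)"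

abbreviation star where "star \<equiv> classical_involution G"

lemma carrier_FG: "carrier FG = carrier G \<rightarrow>\<^sub>E carrier F"
  by (simp add: group_algebra_def)

lemma FG_coeff [simp]: "u \<in> carrier FG \<Longrightarrow> x \<in> carrier G \<Longrightarrow> u x \<in> carrier F"
  by (auto simp: carrier_FG)

lemma FG_eqI:
  assumes "u \<in> carrier FG" "v \<in> carrier FG" "\<And>x. x \<in> carrier G \<Longrightarrow> u x = v x"
  shows "u = v"
  using assms by (auto simp: carrier_FG intro: PiE_ext)

lemma add_FG [simp]: "x \<in> carrier G \<Longrightarrow> (u \<oplus>\<^bsub>FG\<^esub> v) x = u x \<oplus> v x"
  by (simp add: group_algebra_def)

lemma zero_FG [simp]: "x \<in> carrier G \<Longrightarrow> \<zero>\<^bsub>FG\<^esub> x = \<zero>"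
  by (simp add: group_algebra_def)

lemma one_FG: "x \<in> carrier G \<Longrightarrow> \<one>\<^bsub>FG\<^esub> x = (if x = \<one>\<^bsub>G\<^esub> then \<one> else \<zero>)"
  by (simp add: group_algebra_def)

lemma mult_FG:
  "x \<in> carrier G \<Longrightarrow> (u \<otimes>\<^bsub>FG\<^esub> v) x = (\<Oplus>y\<in>carrier G. u y \<otimes> v (inv\<^bsub>G\<^esub> y \<otimes>\<^bsub>G\<^esub> x))"
  by (simp add: group_algebra_def)

lemma star_FG [simp]: "x \<in> carrier G \<Longrightarrow> star u x = u (inv\<^bsub>G\<^esub> x)"
  by (simp add: classical_involution_def)

lemma add_closed_FG [simp]: "u \<in> carrier FG \<Longrightarrow> v \<in> carrier FG \<Longrightarrow> u \<oplus>\<^bsub>FG\<^esub> v \<in> carrier FG"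
  by (auto simp: group_algebra_def)

lemma zero_closed_FG [simp]: "\<zero>\<^bsub>FG\<^esub> \<in> carrier FG"
  by (auto simp: group_algebra_def)

lemma one_closed_FG [simp]: "\<one>\<^bsub>FG\<^esub> \<in> carrier FG"
  by (auto simp: group_algebra_def)

lemma mult_closed_FG [simp]:
  assumes "u \<in> carrier FG" "v \<in> carrier FG"
  shows "u \<otimes>\<^bsub>FG\<^esub> v \<in> carrier FG"
  using assms by (auto simp: group_algebra_def intro!: finsum_closed)

lemma star_closed [simp]: "u \<in> carrier FG \<Longrightarrow> star u \<in> carrier FG"
  by (auto simp: group_algebra_def classical_involution_def)

lemma aug_closed [simp]: "u \<in> carrier FG \<Longrightarrow> aug u \<in> carrier F"
  by (auto intro!: finsum_closed)

lemma finsum_delta: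
  assumes "g \<in> carrier G" "c \<in> carrier G \<rightarrow> carrier F"
  shows "(\<Oplus>x\<in>carrier G. if x = g then c x else \<zero>) = c g"
  using finsum_singleton[OF assms(1) finite_carrier assms(2)]
  by (simp add: eq_commute)

lemma bij_betw_translate:
  assumes "g \<in> carrier G"
  shows "bij_betw (\<lambda>x. g \<otimes>\<^bsub>G\<^esub> x) (carrier G) (carrier G)"
  by (rule bij_betw_byWitness[where f' = "\<lambda>x. inv\<^bsub>G\<^esub> g \<otimes>\<^bsub>G\<^esub> x"])
    (use assms in \<open>auto simp: G.m_assoc[symmetric]\<close>)

lemma bij_betw_inv: "bij_betw (\<lambda>x. inv\<^bsub>G\<^esub> x) (carrier G) (carrier G)"
  by (rule bij_betw_byWitness[where f' = "\<lambda>x. inv\<^bsub>G\<^esub> x"]) auto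

lemma FG_monoid: "monoid FG"
proof (rule monoidI)
  fix u v w assume c: "u \<in> carrier FG" "v \<in> carrier FG" "w \<in> carrier FG"
  show "u \<otimes>\<^bsub>FG\<^esub> v \<otimes>\<^bsub>FG\<^esub> w = u \<otimes>\<^bsub>FG\<^esub> (v \<otimes>\<^bsub>FG\<^esub> w)"
  proof (rule FG_eqI)
    fix x assume x: "x \<in> carrier G"
    have "(u \<otimes>\<^bsub>FG\<^esub> v \<otimes>\<^bsub>FG\<^esub> w) x
        = (\<Oplus>y\<in>carrier G. (\<Oplus>s\<in>carrier G. u s \<otimes> v (inv\<^bsub>G\<^esub> s \<otimes>\<^bsub>G\<^esub> y)) \<otimes> w (inv\<^bsub>G\<^esub> y \<otimes>\<^bsub>G\<^esub> x))"
      using x c by (auto simp: mult_FG intro!: finsum_cong' finsum_closed)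
    also have "\<dots> = (\<Oplus>y\<in>carrier G. \<Oplus>s\<in>carrier G. u s \<otimes> v (inv\<^bsub>G\<^esub> s \<otimes>\<^bsub>G\<^esub> y) \<otimes> w (inv\<^bsub>G\<^esub> y \<otimes>\<^bsub>G\<^esub> x))"
      using x c finite_carrier by (intro finsum_cong' finsum_ldistr) (auto intro!: finsum_closed)
    also have "\<dots> = (\<Oplus>s\<in>carrier G. \<Oplus>y\<in>carrier G. u s \<otimes> v (inv\<^bsub>G\<^esub> s \<otimes>\<^bsub>G\<^esub> y) \<otimes> w (inv\<^bsub>G\<^esub> y \<otimes>\<^bsub>G\<^esub> x))"
      using x c finite_carrier by (intro finsum_swap) auto
    also have "\<dots> = (\<Oplus>s\<in>carrier G. u s \<otimes> (v \<otimes>\<^bsub>FG\<^esub> w) (inv\<^bsub>G\<^esub> s \<otimes>\<^bsub>G\<^esub> x))"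
    proof (rule finsum_cong'[OF refl])
      fix s assume s: "s \<in> carrier G"
      have "(\<Oplus>y\<in>carrier G. u s \<otimes> v (inv\<^bsub>G\<^esub> s \<otimes>\<^bsub>G\<^esub> y) \<otimes> w (inv\<^bsub>G\<^esub> y \<otimes>\<^bsub>G\<^esub> x))
        = (\<Oplus>y\<in>carrier G. u s \<otimes> v (inv\<^bsub>G\<^esub> s \<otimes>\<^bsub>G\<^esub> (s \<otimes>\<^bsub>G\<^esub> y)) \<otimes> w (inv\<^bsub>G\<^esub> (s \<otimes>\<^bsub>G\<^esub> y) \<otimes>\<^bsub>G\<^esub> x))"
        using x c s by (intro finsum_bij_betw bij_betw_translate) auto
      also have "\<dots> = (\<Oplus>y\<in>carrier G. u s \<otimes> (v y \<otimes> w (inv\<^bsub>G\<^esub> y \<otimes>\<^bsub>G\<^esub> (inv\<^bsub>G\<^esub> s \<otimes>\<^bsub>G\<^esub> x))))"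
        using x c s
        by (intro finsum_cong') (auto simp: G.m_assoc[symmetric] G.inv_mult_group F.m_assoc)
      also have "\<dots> = u s \<otimes> (v \<otimes>\<^bsub>FG\<^esub> w) (inv\<^bsub>G\<^esub> s \<otimes>\<^bsub>G\<^esub> x)"
        using x c s finite_carrier by (subst mult_FG) (auto intro!: finsum_rdistr[symmetric])
      finally show "(\<Oplus>y\<in>carrier G. u s \<otimes> v (inv\<^bsub>G\<^esub> s \<otimes>\<^bsub>G\<^esub> y) \<otimes> w (inv\<^bsub>G\<^esub> y \<otimes>\<^bsub>G\<^esub> x))
        = u s \<otimes> (v \<otimes>\<^bsub>FG\<^esub> w) (inv\<^bsub>G\<^esub> s \<otimes>\<^bsub>G\<^esub> x)" .
    qed (use x c in auto)
    also have "\<dots> = (u \<otimes>\<^bsub>FG\<^esub> (v \<otimes>\<^bsub>FG\<^esub> w)) x"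
      using x by (simp add: mult_FG)
    finally show "(u \<otimes>\<^bsub>FG\<^esub> v \<otimes>\<^bsub>FG\<^esub> w) x = (u \<otimes>\<^bsub>FG\<^esub> (v \<otimes>\<^bsub>FG\<^esub> w)) x" .
  qed (use c in auto)
next
  fix u assume c: "u \<in> carrier FG"
  show "\<one>\<^bsub>FG\<^esub> \<otimes>\<^bsub>FG\<^esub> u = u"
  proof (rule FG_eqI)
    fix x assume x: "x \<in> carrier G"
    have "(\<one>\<^bsub>FG\<^esub> \<otimes>\<^bsub>FG\<^esub> u) x = (\<Oplus>y\<in>carrier G. if y = \<one>\<^bsub>G\<^esub> then u (inv\<^bsub>G\<^esub> y \<otimes>\<^bsub>G\<^esub> x) else \<zero>)"
      using x c by (auto simp: mult_FG one_FG intro!: finsum_cong')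
    also have "\<dots> = u x"
      using x c by (subst finsum_delta) auto
    finally show "(\<one>\<^bsub>FG\<^esub> \<otimes>\<^bsub>FG\<^esub> u) x = u x" .
  qed (use c in auto)
  show "u \<otimes>\<^bsub>FG\<^esub> \<one>\<^bsub>FG\<^esub> = u"
  proof (rule FG_eqI)
    fix x assume x: "x \<in> carrier G"
    have "inv\<^bsub>G\<^esub> y \<otimes>\<^bsub>G\<^esub> x = \<one>\<^bsub>G\<^esub> \<longleftrightarrow> y = x" if "y \<in> carrier G" for y
      using that x by (metis G.inv_closed G.inv_equality G.inv_inv G.l_inv)
    then have "(u \<otimes>\<^bsub>FG\<^esub> \<one>\<^bsub>FG\<^esub>) x = (\<Oplus>y\<in>carrier G. if y = x then u y else \<zero>)"
      using x c by (auto simp: mult_FG one_FG intro!: finsum_cong')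
    also have "\<dots> = u x"
      using x c by (subst finsum_delta) auto
    finally show "(u \<otimes>\<^bsub>FG\<^esub> \<one>\<^bsub>FG\<^esub>) x = u x" .
  qed (use c in auto)
qed auto

lemma FG_ring: "ring FG"
proof (rule ringI)
  show "abelian_group FG"
  proof (rule abelian_groupI)
    fix u assume "u \<in> carrier FG"
    then show "\<exists>v\<in>carrier FG. v \<oplus>\<^bsub>FG\<^esub> u = \<zero>\<^bsub>FG\<^esub>"
      by (intro bexI[of _ "\<lambda>x\<in>carrier G. \<ominus> u x"] FG_eqI)
        (auto simp: carrier_FG F.l_neg intro!: add_closed_FG[unfolded carrier_FG] zero_closed_FG[unfolded carrier_FG])
  qed (auto intro!: FG_eqI simp: F.a_ac)
  show "monoid FG" by (rule FG_monoid)
  fix u v w assume c: "u \<in> carrier FG" "v \<in> carrier FG" "w \<in> carrier FG"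
  show "(u \<oplus>\<^bsub>FG\<^esub> v) \<otimes>\<^bsub>FG\<^esub> w = u \<otimes>\<^bsub>FG\<^esub> w \<oplus>\<^bsub>FG\<^esub> v \<otimes>\<^bsub>FG\<^esub> w"
    by (rule FG_eqI, simp_all add: c mult_FG, subst finsum_addf[symmetric])
      (auto intro!: finsum_cong' simp: c F.l_distr simp del: F.add.finprod_multf)
  show "w \<otimes>\<^bsub>FG\<^esub> (u \<oplus>\<^bsub>FG\<^esub> v) = w \<otimes>\<^bsub>FG\<^esub> u \<oplus>\<^bsub>FG\<^esub> w \<otimes>\<^bsub>FG\<^esub> v"
    by (rule FG_eqI, simp_all add: c mult_FG, subst finsum_addf[symmetric])
      (auto intro!: finsum_cong' simp: c F.r_distr simp del: F.add.finprod_multf)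
qed

lemma FG_cring:
  assumes "comm_group G"
  shows "cring FG"
proof -
  interpret G: comm_group G by fact
  have "u \<otimes>\<^bsub>FG\<^esub> v = v \<otimes>\<^bsub>FG\<^esub> u" if c: "u \<in> carrier FG" "v \<in> carrier FG" for u v
  proof (rule FG_eqI)
    fix x assume x: "x \<in> carrier G"
    have b: "bij_betw (\<lambda>y. x \<otimes>\<^bsub>G\<^esub> inv\<^bsub>G\<^esub> y) (carrier G) (carrier G)"
      using bij_betw_trans[OF bij_betw_inv bij_betw_translate[OF x]] by (simp add: comp_def)
    have "(u \<otimes>\<^bsub>FG\<^esub> v) x = (\<Oplus>y\<in>carrier G. u (x \<otimes>\<^bsub>G\<^esub> inv\<^bsub>G\<^esub> y) \<otimes> v (inv\<^bsub>G\<^esub> (x \<otimes>\<^bsub>G\<^esub> inv\<^bsub>G\<^esub> y) \<otimes>\<^bsub>G\<^esub> x))"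
      using x c by (subst mult_FG) (auto intro!: finsum_bij_betw[OF b])
    also have "\<dots> = (v \<otimes>\<^bsub>FG\<^esub> u) x"
    proof (subst mult_FG[OF x], rule finsum_cong'[OF refl])
      fix y assume y: "y \<in> carrier G"
      have "inv\<^bsub>G\<^esub> (x \<otimes>\<^bsub>G\<^esub> inv\<^bsub>G\<^esub> y) \<otimes>\<^bsub>G\<^esub> x = y"
        using x y by (simp add: G.inv_mult_group G.m_assoc)
      then show "u (x \<otimes>\<^bsub>G\<^esub> inv\<^bsub>G\<^esub> y) \<otimes> v (inv\<^bsub>G\<^esub> (x \<otimes>\<^bsub>G\<^esub> inv\<^bsub>G\<^esub> y) \<otimes>\<^bsub>G\<^esub> x) = v y \<otimes> u (inv\<^bsub>G\<^esub> y \<otimes>\<^bsub>G\<^esub> x)"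
        using x y c by (simp add: F.m_comm G.m_comm)
    qed (use x c in auto)
    finally show "(u \<otimes>\<^bsub>FG\<^esub> v) x = (v \<otimes>\<^bsub>FG\<^esub> u) x" .
  qed (use c in auto)
  then show ?thesis
    using FG_ring FG_monoid
    by (simp add: cring_def comm_monoid_def comm_monoid_axioms_def)
qed

lemma star_add: "star (u \<oplus>\<^bsub>FG\<^esub> v) = star u \<oplus>\<^bsub>FG\<^esub> star v"
  by (auto simp: classical_involution_def group_algebra_def)

lemma star_star: "u \<in> carrier FG \<Longrightarrow> star (star u) = u"
  by (rule FG_eqI) auto

lemma star_mult:
  assumes c: "u \<in> carrier FG" "v \<in> carrier FG"
  shows "star (u \<otimes>\<^bsub>FG\<^esub> v) = star v \<otimes>\<^bsub>FG\<^esub> star u"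
proof (rule FG_eqI)
  fix x assume x: "x \<in> carrier G"
  have b: "bij_betw (\<lambda>y. inv\<^bsub>G\<^esub> x \<otimes>\<^bsub>G\<^esub> y) (carrier G) (carrier G)"
    using x by (intro bij_betw_translate) auto
  have "star (u \<otimes>\<^bsub>FG\<^esub> v) x
      = (\<Oplus>y\<in>carrier G. u (inv\<^bsub>G\<^esub> x \<otimes>\<^bsub>G\<^esub> y) \<otimes> v (inv\<^bsub>G\<^esub> (inv\<^bsub>G\<^esub> x \<otimes>\<^bsub>G\<^esub> y) \<otimes>\<^bsub>G\<^esub> inv\<^bsub>G\<^esub> x))"
    using x c by (simp add: mult_FG) (auto intro!: finsum_bij_betw[OF b])
  also have "\<dots> = (star v \<otimes>\<^bsub>FG\<^esub> star u) x"
    using x c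
    by (subst mult_FG) (auto intro!: finsum_cong' simp: G.inv_mult_group G.m_assoc F.m_comm)
  finally show "star (u \<otimes>\<^bsub>FG\<^esub> v) x = (star v \<otimes>\<^bsub>FG\<^esub> star u) x" .
qed (use c in auto)

lemma aug_add:
  "u \<in> carrier FG \<Longrightarrow> v \<in> carrier FG \<Longrightarrow> aug (u \<oplus>\<^bsub>FG\<^esub> v) = aug u \<oplus> aug v"
  by (subst finsum_addf[symmetric]) (auto intro!: finsum_cong' simp del: F.add.finprod_multf)

text \<open>Evaluates a linear functional, given by weights \<open>k\<close> on the group elements,
  at a product. The constant weight one yields multiplicativity of the augmentation; an additive
  weight yields the derivation \<open>\<mu>\<close>.\<close>

lemma sum_mult_FG:
  assumes c: "u \<in> carrier FG" "v \<in> carrier FG" "\<And>x. x \<in> carrier G \<Longrightarrow> k x \<in> carrier F"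
  shows "(\<Oplus>x\<in>carrier G. (u \<otimes>\<^bsub>FG\<^esub> v) x \<otimes> k x)
      = (\<Oplus>x\<in>carrier G. \<Oplus>y\<in>carrier G. u x \<otimes> v y \<otimes> k (x \<otimes>\<^bsub>G\<^esub> y))"
proof -
  have "(\<Oplus>x\<in>carrier G. (u \<otimes>\<^bsub>FG\<^esub> v) x \<otimes> k x)
      = (\<Oplus>x\<in>carrier G. \<Oplus>y\<in>carrier G. u y \<otimes> v (inv\<^bsub>G\<^esub> y \<otimes>\<^bsub>G\<^esub> x) \<otimes> k x)"
    using c finite_carrier
    by (intro finsum_cong') (auto intro!: finsum_closed finsum_ldistr simp: mult_FG)
  also have "\<dots> = (\<Oplus>y\<in>carrier G. \<Oplus>x\<in>carrier G. u y \<otimes> v (inv\<^bsub>G\<^esub> y \<otimes>\<^bsub>G\<^esub> x) \<otimes> k x)"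
    using c finite_carrier by (intro finsum_swap) auto
  also have "\<dots> = (\<Oplus>y\<in>carrier G. \<Oplus>x\<in>carrier G. u y \<otimes> v x \<otimes> k (y \<otimes>\<^bsub>G\<^esub> x))"
  proof (rule finsum_cong'[OF refl])
    fix y assume y: "y \<in> carrier G"
    have "(\<Oplus>x\<in>carrier G. u y \<otimes> v (inv\<^bsub>G\<^esub> y \<otimes>\<^bsub>G\<^esub> x) \<otimes> k x)
        = (\<Oplus>x\<in>carrier G. u y \<otimes> v (inv\<^bsub>G\<^esub> y \<otimes>\<^bsub>G\<^esub> (y \<otimes>\<^bsub>G\<^esub> x)) \<otimes> k (y \<otimes>\<^bsub>G\<^esub> x))"
      using c y by (intro finsum_bij_betw bij_betw_translate) auto
    also have "\<dots> = (\<Oplus>x\<in>carrier G. u y \<otimes> v x \<otimes> k (y \<otimes>\<^bsub>G\<^esub> x))"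
      using c y by (intro finsum_cong') (auto simp: G.m_assoc[symmetric])
    finally show "(\<Oplus>x\<in>carrier G. u y \<otimes> v (inv\<^bsub>G\<^esub> y \<otimes>\<^bsub>G\<^esub> x) \<otimes> k x)
        = (\<Oplus>x\<in>carrier G. u y \<otimes> v x \<otimes> k (y \<otimes>\<^bsub>G\<^esub> x))" .
  qed (use c in \<open>auto intro!: finsum_closed\<close>)
  finally show ?thesis .
qed

lemma aug_mult:
  assumes c: "u \<in> carrier FG" "v \<in> carrier FG"
  shows "aug (u \<otimes>\<^bsub>FG\<^esub> v) = aug u \<otimes> aug v"
proof -
  have "aug (u \<otimes>\<^bsub>FG\<^esub> v) = (\<Oplus>x\<in>carrier G. (u \<otimes>\<^bsub>FG\<^esub> v) x \<otimes> \<one>)"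
    using c by (intro finsum_cong') auto
  also have "\<dots> = (\<Oplus>x\<in>carrier G. \<Oplus>y\<in>carrier G. u x \<otimes> v y \<otimes> \<one>)"
    using c by (rule sum_mult_FG) auto
  also have "\<dots> = (\<Oplus>x\<in>carrier G. \<Oplus>y\<in>carrier G. u x \<otimes> v y)"
    using c by (intro finsum_cong') (auto intro!: finsum_closed finsum_cong')
  also have "\<dots> = (\<Oplus>x\<in>carrier G. u x \<otimes> aug v)"
    using c finite_carrier
    by (intro finsum_cong') (auto intro!: finsum_closed finsum_rdistr[symmetric])
  also have "\<dots> = aug u \<otimes> aug v"
    using c finite_carrier by (intro finsum_ldistr[symmetric]) auto
  finally show ?thesis .
qed

lemma aug_star: "u \<in> carrier FG \<Longrightarrow> aug (star u) = aug u"
  by (subst (2) finsum_bij_betw[OF bij_betw_inv]) (auto intro!: finsum_cong')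

section \<open>Monomials and induction over the group algebra\<close>

definition single :: "'a \<Rightarrow> 'c \<Rightarrow> 'c \<Rightarrow> 'a" where
  "single c g = (\<lambda>x\<in>carrier G. if x = g then c else \<zero>)"

lemma single_closed [simp]: "c \<in> carrier F \<Longrightarrow> single c g \<in> carrier FG"
  by (auto simp: single_def carrier_FG)

lemma single_apply [simp]: "x \<in> carrier G \<Longrightarrow> single c g x = (if x = g then c else \<zero>)"
  by (simp add: single_def)

lemma single_mult:
  assumes "c \<in> carrier F" "d \<in> carrier F" "g \<in> carrier G" "h \<in> carrier G"
  shows "single c g \<otimes>\<^bsub>FG\<^esub> single d h = single (c \<otimes> d) (g \<otimes>\<^bsub>G\<^esub> h)"
proof (rule FG_eqI)
  fix x assume x: "x \<in> carrier G"
  have "inv\<^bsub>G\<^esub> g \<otimes>\<^bsub>G\<^esub> x = h \<longleftrightarrow> x = g \<otimes>\<^bsub>G\<^esub> h"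
    using x assms G.inv_solve_left' by auto
  then have "(single c g \<otimes>\<^bsub>FG\<^esub> single d h) x
      = (\<Oplus>y\<in>carrier G. if y = g then if x = g \<otimes>\<^bsub>G\<^esub> h then c \<otimes> d else \<zero> else \<zero>)"
    unfolding mult_FG[OF x] using x assms by (intro finsum_cong') auto
  also have "\<dots> = single (c \<otimes> d) (g \<otimes>\<^bsub>G\<^esub> h) x"
    using x assms by (subst finsum_delta) auto
  finally show "(single c g \<otimes>\<^bsub>FG\<^esub> single d h) x = single (c \<otimes> d) (g \<otimes>\<^bsub>G\<^esub> h) x" .
qed (use assms in auto)

lemma single_add:
  "c \<in> carrier F \<Longrightarrow> d \<in> carrier F \<Longrightarrow> single c g \<oplus>\<^bsub>FG\<^esub> single d g = single (c \<oplus> d) g"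
  by (rule FG_eqI) auto

lemma star_single: 
  assumes "c \<in> carrier F" "g \<in> carrier G"
  shows "star (single c g) = single c (inv\<^bsub>G\<^esub> g)"
  using assms by (intro FG_eqI) (auto simp: G.inv_equality)

lemma aug_single: "c \<in> carrier F \<Longrightarrow> g \<in> carrier G \<Longrightarrow> aug (single c g) = c"
  using finsum_delta[of g "\<lambda>_. c"]
  by (subst finsum_cong'[of _ _ "\<lambda>x. if x = g then c else \<zero>"]) auto

lemma one_FG_single: "\<one>\<^bsub>FG\<^esub> = single \<one> \<one>\<^bsub>G\<^esub>"
  by (rule FG_eqI) (auto simp: one_FG)

text \<open>Monomials span the group algebra; the proof removes one point of the support at a
  time.\<close>

lemma FG_induct [consumes 1, case_names add single]:
  assumes "u \<in> carrier FG"
    and add: "\<And>u v. u \<in> carrier FG \<Longrightarrow> v \<in> carrier FG \<Longrightarrow> P u \<Longrightarrow> P v \<Longrightarrow> P (u \<oplus>\<^bsub>FG\<^esub> v)"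
    and single: "\<And>c g. c \<in> carrier F \<Longrightarrow> g \<in> carrier G \<Longrightarrow> P (single c g)"
  shows "P u"
proof -
  have "P u" if "finite S" "S \<subseteq> carrier G" "u \<in> carrier FG" "\<And>x. x \<in> carrier G - S \<Longrightarrow> u x = \<zero>" for S u
    using that
  proof (induction S arbitrary: u rule: finite_induct)
    case empty
    \<comment> \<open>Zero is itself a monomial with coefficient zero, so the induction rule needs
      no separate case for it.\<close>
    then have "u = single \<zero> \<one>\<^bsub>G\<^esub>"
      by (intro FG_eqI) auto
    then show ?case using single[of \<zero> "\<one>\<^bsub>G\<^esub>"] by simp
  next
    case (insert g S)
    define v where "v = (\<lambda>x\<in>carrier G. if x = g then \<zero> else u x)"
    have v_apply: "v x = (if x = g then \<zero> else u x)" if "x \<in> carrier G" for x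
      using that by (simp add: v_def)
    have v: "v \<in> carrier FG"
      unfolding v_def carrier_FG restrict_PiE_iff using insert.prems by simp
    have "u = single (u g) g \<oplus>\<^bsub>FG\<^esub> v"
      using insert.prems v by (intro FG_eqI) (auto simp: v_apply)
    moreover have "P v"
      using insert.prems insert.hyps v by (intro insert.IH) (auto simp: v_apply)
    ultimately show ?case
      using add[of "single (u g) g" v] single[of "u g" g] insert.prems v by auto
  qed
  from this[of "carrier G" u] show ?thesis
    using assms(1) finite_carrier by auto
qed

text \<open>Normalisation is automatic in characteristic two, since \<open>aug u\<close> squares to one.\<close>

lemma unitary_normalized_units_eq:
  assumes fin: "finite (carrier F)" and char2: "\<one> \<oplus> \<one> = \<zero>"
  shows "unitary_normalized_units F G = {u \<in> carrier FG. u \<otimes>\<^bsub>FG\<^esub> star u = \<one>\<^bsub>FG\<^esub>}"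
proof -
  interpret R: ring FG by (rule FG_ring)
  have finFG: "finite (carrier FG)"
    using fin finite_carrier by (auto simp: carrier_FG intro: finite_PiE)
  have "u \<in> unitary_normalized_units F G" if u: "u \<in> carrier FG" "u \<otimes>\<^bsub>FG\<^esub> star u = \<one>\<^bsub>FG\<^esub>" for u
  proof -
    \<comment> \<open>The right inverse \<open>star u\<close> makes right multiplication by
      \<open>u\<close> injective. On a finite ring it is then surjective, which yields a left
      inverse, and this must equal \<open>star u\<close>.\<close>
    have "inj_on (\<lambda>v. v \<otimes>\<^bsub>FG\<^esub> u) (carrier FG)"
    proof (rule inj_onI)
      fix v w assume vw: "v \<in> carrier FG" "w \<in> carrier FG" "v \<otimes>\<^bsub>FG\<^esub> u = w \<otimes>\<^bsub>FG\<^esub> u"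
      then show "v = w" using u by (metis R.m_assoc R.r_one star_closed)
    qed
    then have "(\<lambda>v. v \<otimes>\<^bsub>FG\<^esub> u) ` carrier FG = carrier FG"
      using u finFG by (intro endo_inj_surj) auto
    then obtain v where v: "v \<in> carrier FG" "v \<otimes>\<^bsub>FG\<^esub> u = \<one>\<^bsub>FG\<^esub>"
      by (metis (no_types, lifting) R.one_closed imageE)
    have "v = star u"
      using u v by (metis R.l_one R.m_assoc R.r_one star_closed)
    then have l: "star u \<otimes>\<^bsub>FG\<^esub> u = \<one>\<^bsub>FG\<^esub>" using v by simp
    have U: "u \<in> Units FG"
      using u l by (auto simp: Units_def)
    have "aug u \<otimes> aug u = \<one>"
      using aug_mult[of u "star u"] u aug_star[of u] aug_single[of \<one> "\<one>\<^bsub>G\<^esub>"] by (simp add: one_FG_single)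
    moreover have "\<ominus> \<one> = \<one>"
      using char2 by (intro F.minus_equality) auto
    ultimately have "aug u = \<one>"
      using u square_eq_one[of "aug u"] by auto
    then show ?thesis
      using u l U R.inv_unique'[of u "star u"]
      by (auto simp: unitary_normalized_units_def normalized_units_def)
  qed
  moreover have "u \<in> carrier FG \<and> u \<otimes>\<^bsub>FG\<^esub> star u = \<one>\<^bsub>FG\<^esub>" if "u \<in> unitary_normalized_units F G" for u
    using that R.Units_r_inv R.Units_closed
    by (simp add: unitary_normalized_units_def normalized_units_def)
  ultimately show ?thesis by blast
qed

end

section \<open>Norms in commutative rings of characteristic two\<close>

locale cring_char2 = cring R for R (structure) +
  assumes char2: "\<one> \<oplus> \<one> = \<zero>"
begin

lemma add_self [simp]: "x \<in> carrier R \<Longrightarrow> x \<oplus> x = \<zero>"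
  using char2 l_distr[of \<one> \<one> x] by simp

lemma add_self_left [simp]:
  "x \<in> carrier R \<Longrightarrow> y \<in> carrier R \<Longrightarrow> x \<oplus> (x \<oplus> y) = y"
  by (simp add: a_assoc[symmetric])

lemma add_eq_zero_iff:
  "x \<in> carrier R \<Longrightarrow> y \<in> carrier R \<Longrightarrow> x \<oplus> y = \<zero> \<longleftrightarrow> x = y"
  by (metis add_self add_self_left r_zero)

lemmas char2_simps = l_distr r_distr a_ac m_ac

lemma freshmans_dream:
  assumes "x \<in> carrier R" "y \<in> carrier R"
  shows "(x \<oplus> y) [^] (2 ^ n :: nat) = x [^] (2 ^ n :: nat) \<oplus> y [^] (2 ^ n :: nat)"
proof (induction n)
  case (Suc n)
  have sq: "z [^] (2 ^ Suc n :: nat) = z [^] (2 ^ n :: nat) \<otimes> z [^] (2 ^ n :: nat)" if "z \<in> carrier R" for z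
    using that by (simp add: nat_pow_mult mult_2)
  show ?case
    using assms by (simp add: sq Suc.IH del: power_Suc) (simp add: char2_simps)
qed (use assms in simp)

text \<open>The power of 1 + w with exponent 2^e is 1 + w^(2^e) = 1, so the preceding power is the
  inverse.\<close>

lemma one_plus_nilpotent_unit:
  assumes "w \<in> carrier R" "w [^] (2 ^ e :: nat) = \<zero>"
  obtains i where "i \<in> carrier R" "(\<one> \<oplus> w) \<otimes> i = \<one>"
proof
  have "(\<one> \<oplus> w) [^] (2 ^ e :: nat) = \<one>"
    using assms by (simp add: freshmans_dream)
  moreover have "(2::nat) ^ e = 1 + (2 ^ e - 1)"
    by simp
  ultimately show "(\<one> \<oplus> w) \<otimes> (\<one> \<oplus> w) [^] (2 ^ e - 1 :: nat) = \<one>"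
    using assms(1) nat_pow_mult[of "\<one> \<oplus> w" 1 "2 ^ e - 1"] by simp
qed (use assms in simp)

text \<open>In characteristic two a translation is its own inverse. This and its multiplicative
  counterpart \<open>card_scale\<close> identify fibres of additive and of multiplicative maps with
  the fibre over the neutral element.\<close>

lemma card_translate:
  assumes "d \<in> carrier R" "\<And>y. y \<in> carrier R \<Longrightarrow> P (y \<oplus> d) \<longleftrightarrow> Q y"
  shows "card {y \<in> carrier R. P y} = card {y \<in> carrier R. Q y}"
proof -
  have "bij_betw (\<lambda>y. y \<oplus> d) {y \<in> carrier R. Q y} {y \<in> carrier R. P y}"
  proof (rule bij_betw_byWitness[where f' = "\<lambda>y. y \<oplus> d"])
    have "Q (y \<oplus> d)" if "y \<in> carrier R" "P y" for y
      using assms(2)[of "y \<oplus> d"] that assms(1) by (simp add: a_assoc)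
    then show "(\<lambda>y. y \<oplus> d) ` {y \<in> carrier R. P y} \<subseteq> {y \<in> carrier R. Q y}"
      using assms(1) by auto
  qed (use assms in \<open>auto simp: a_assoc\<close>)
  then show ?thesis by (simp add: bij_betw_same_card)
qed

lemma card_scale:
  assumes "d \<in> carrier R" "i \<in> carrier R" "d \<otimes> i = \<one>"
    "\<And>y. y \<in> carrier R \<Longrightarrow> P (y \<otimes> d) \<longleftrightarrow> Q y"
  shows "card {y \<in> carrier R. P y} = card {y \<in> carrier R. Q y}"
proof -
  have e: "y \<otimes> d \<otimes> i = y" "y \<otimes> i \<otimes> d = y" if "y \<in> carrier R" for y
    using assms(1-3) that by (simp_all add: m_assoc m_comm[of i d])
  have "bij_betw (\<lambda>y. y \<otimes> d) {y \<in> carrier R. Q y} {y \<in> carrier R. P y}"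
  proof (rule bij_betw_byWitness[where f' = "\<lambda>y. y \<otimes> i"])
    have "Q (y \<otimes> i)" if "y \<in> carrier R" "P y" for y
      using assms(4)[of "y \<otimes> i"] that assms(1,2) by (simp add: e)
    then show "(\<lambda>y. y \<otimes> i) ` {y \<in> carrier R. P y} \<subseteq> {y \<in> carrier R. Q y}"
      using assms(2) by auto
  qed (use assms e in auto)
  then show ?thesis by (simp add: bij_betw_same_card)
qed

end

locale star_cring_char2 = cring_char2 R for R (structure) +
  fixes star
  assumes star_closed [simp, intro]: "x \<in> carrier R \<Longrightarrow> star x \<in> carrier R"
    and star_add [simp]: "x \<in> carrier R \<Longrightarrow> y \<in> carrier R \<Longrightarrow> star (x \<oplus> y) = star x \<oplus> star y"
    and star_mult [simp]: "x \<in> carrier R \<Longrightarrow> y \<in> carrier R \<Longrightarrow> star (x \<otimes> y) = star x \<otimes> star y"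
    and star_star [simp]: "x \<in> carrier R \<Longrightarrow> star (star x) = x"
begin

lemma star_one [simp]: "star \<one> = \<one>"
  by (metis l_one one_closed star_closed star_mult star_star r_one)

lemma norm_mult:
  "x \<in> carrier R \<Longrightarrow> y \<in> carrier R
    \<Longrightarrow> (x \<otimes> y) \<otimes> star (x \<otimes> y) = (x \<otimes> star x) \<otimes> (y \<otimes> star y)"
  by (simp add: m_ac)

text \<open>
  Dividing by the norm of \<open>\<one> \<oplus> w\<close> replaces \<open>w\<close> by a multiple of a higher power of \<open>t\<close>.
\<close>

lemma trace_in_norms:
  fixes k n :: nat
  assumes t: "t \<in> carrier R" "t \<otimes> star t = t \<oplus> star t" "t [^] (2 ^ e :: nat) = \<zero>"
    and "u \<in> carrier R" "2 ^ e \<le> k + n"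
  shows "\<exists>x\<in>carrier R. x \<otimes> star x
           = \<one> \<oplus> (t [^] k \<otimes> (t \<otimes> t) \<otimes> u \<oplus> star (t [^] k \<otimes> (t \<otimes> t) \<otimes> u))"
  using assms(4,5)
\<comment> \<open>\<open>n\<close> bounds how far \<open>k\<close> is from the exponent 2^e at which
  the powers of t vanish; \<open>u\<close> is general because each pass changes the
  cofactor.\<close>
proof (induction n arbitrary: k u)
  case 0
  then have "t [^] k = \<zero>"
    using t nat_pow_mult[of t "2 ^ e" "k - 2 ^ e"] by simp
  moreover have "star \<zero> = \<zero>"
    by (metis add_self star_add star_closed zero_closed)
  ultimately show ?case
    using 0 t by (intro bexI[of _ \<one>]) auto
next
  case (Suc n)
  define T where "T = t [^] k"
  define s where "s = star t"
  define S where "S = star T"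
  define v where "v = star u"
  define w where "w = T \<otimes> (t \<otimes> t) \<otimes> u"
  have c [simp]: "T \<in> carrier R" "s \<in> carrier R" "S \<in> carrier R" "v \<in> carrier R" "w \<in> carrier R"
      "t \<in> carrier R" "u \<in> carrier R"
    using t Suc.prems by (auto simp: T_def s_def S_def v_def w_def)
  have st [simp]: "star T = S" "star t = s" "star u = v" "star s = t" "star S = T" "star v = u"
    using t Suc.prems by (auto simp: T_def s_def S_def v_def)
  have ts: "t \<otimes> s = t \<oplus> s"
    using t(2) by simp
  \<comment> \<open>Since t s = t + s, the conjugate s is a multiple of t. This is what lets a
    factor s be traded for a further power of t.\<close>
  have s: "s = t \<otimes> (\<one> \<oplus> s)"
    by (simp add: r_distr ts)
  have "t [^] (2 ^ e :: nat) = \<zero> \<Longrightarrow> w [^] (2 ^ e :: nat) = \<zero>"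
    by (simp add: w_def nat_pow_distrib)
  then obtain i where i: "i \<in> carrier R" "(\<one> \<oplus> w) \<otimes> i = \<one>"
    using one_plus_nilpotent_unit[of w e] t by auto
  \<comment> \<open>\<open>I\<close> inverts the norm \<open>P\<close> of 1 + w. If y has norm 1 + w
    (star w) I, then (1 + w) y has norm P + w (star w), which is 1 + w + star w. So it remains to
    find such a y.\<close>
  define I where "I = i \<otimes> star i"
  define P where "P = (\<one> \<oplus> w) \<otimes> star (\<one> \<oplus> w)"
  have [simp]: "I \<in> carrier R" "P \<in> carrier R" "star I = I"
    using i by (auto simp: I_def P_def m_comm)
  have PI: "P \<otimes> I = \<one>"
    using norm_mult[of "\<one> \<oplus> w" i] i by (simp add: I_def P_def)
  define A where "A = T \<otimes> S \<otimes> (u \<otimes> v) \<otimes> I"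
  have [simp]: "A \<in> carrier R" "star A = A"
    by (auto simp: A_def m_ac)
  define x where "x = A \<otimes> (t \<otimes> t \<otimes> s)"
  have [simp]: "x \<in> carrier R" by (simp add: x_def)
  \<comment> \<open>As \<open>A\<close> is symmetric, replacing one factor t s by t + s turns this
    symmetric element into the trace of A t^2 s.\<close>
  have "w \<otimes> star w \<otimes> I = A \<otimes> (t \<otimes> s) \<otimes> (t \<otimes> s)"
    by (simp add: w_def A_def m_ac)
  also have "\<dots> = A \<otimes> (t \<otimes> s) \<otimes> (t \<oplus> s)"
    by (simp only: ts)
  also have "\<dots> = x \<oplus> star x"
    by (simp add: x_def char2_simps)
  finally have x: "w \<otimes> star w \<otimes> I = x \<oplus> star x" .
  \<comment> \<open>Writing s as t (1 + s) exposes t^3, and \<open>A\<close> contains t^k: the trace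
    of x is an instance of the claim for \<open>Suc k\<close>.\<close>
  have "x = A \<otimes> (t \<otimes> t \<otimes> (t \<otimes> (\<one> \<oplus> s)))"
    unfolding x_def by (subst s) (rule refl)
  also have "\<dots> = t [^] Suc k \<otimes> (t \<otimes> t) \<otimes> (S \<otimes> (u \<otimes> v) \<otimes> I \<otimes> (\<one> \<oplus> s))"
    unfolding nat_pow_Suc T_def[symmetric] A_def by (simp add: m_ac)
  finally have "\<exists>y\<in>carrier R. y \<otimes> star y = \<one> \<oplus> (x \<oplus> star x)"
    using Suc.IH[of "S \<otimes> (u \<otimes> v) \<otimes> I \<otimes> (\<one> \<oplus> s)" "Suc k"] Suc.prems by simp
  then obtain y where y: "y \<in> carrier R" "y \<otimes> star y = \<one> \<oplus> (x \<oplus> star x)" by blast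
  have "((\<one> \<oplus> w) \<otimes> y) \<otimes> star ((\<one> \<oplus> w) \<otimes> y) = P \<otimes> (\<one> \<oplus> w \<otimes> star w \<otimes> I)"
    using y norm_mult[of "\<one> \<oplus> w" y] x by (simp add: P_def)
  also have "\<dots> = P \<oplus> w \<otimes> star w \<otimes> (P \<otimes> I)"
    by (simp add: char2_simps)
  also have "\<dots> = \<one> \<oplus> (w \<oplus> star w)"
    unfolding PI by (simp add: P_def char2_simps)
  finally show ?case
    using y unfolding w_def T_def by (intro bexI[of _ "(\<one> \<oplus> w) \<otimes> y"]) (auto simp: w_def T_def)
qed

end

section \<open>Artin-Schreier elements and the image of the norm\<close>

text \<open>The map b + b^2 is additive with kernel {0, 1}, so each of its fibres is a pair b, b +
  1.\<close>

lemma card_artin_schreier_image: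
  assumes "field F" "finite (carrier F)" "\<one>\<^bsub>F\<^esub> \<oplus>\<^bsub>F\<^esub> \<one>\<^bsub>F\<^esub> = \<zero>\<^bsub>F\<^esub>"
  shows "card (carrier F) = 2 * card ((\<lambda>b. b \<oplus>\<^bsub>F\<^esub> b \<otimes>\<^bsub>F\<^esub> b) ` carrier F)"
proof -
  interpret F: field F by fact
  interpret cring_char2 F
    by unfold_locales (use assms(3) in auto)
  have "{c \<in> carrier F. c \<oplus>\<^bsub>F\<^esub> c \<otimes>\<^bsub>F\<^esub> c = b \<oplus>\<^bsub>F\<^esub> b \<otimes>\<^bsub>F\<^esub> b} = {b, b \<oplus>\<^bsub>F\<^esub> \<one>\<^bsub>F\<^esub>}"
    if b: "b \<in> carrier F" for b
  proof -
    have "c = b \<or> c = b \<oplus>\<^bsub>F\<^esub> \<one>\<^bsub>F\<^esub>"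
      if c: "c \<in> carrier F" "c \<oplus>\<^bsub>F\<^esub> c \<otimes>\<^bsub>F\<^esub> c = b \<oplus>\<^bsub>F\<^esub> b \<otimes>\<^bsub>F\<^esub> b" for c
    proof -
      \<comment> \<open>The difference of the two values factors into linear terms, and a field has
        no zero divisors.\<close>
      have "(c \<oplus>\<^bsub>F\<^esub> b) \<otimes>\<^bsub>F\<^esub> (c \<oplus>\<^bsub>F\<^esub> (b \<oplus>\<^bsub>F\<^esub> \<one>\<^bsub>F\<^esub>))
          = (c \<oplus>\<^bsub>F\<^esub> c \<otimes>\<^bsub>F\<^esub> c) \<oplus>\<^bsub>F\<^esub> (b \<oplus>\<^bsub>F\<^esub> b \<otimes>\<^bsub>F\<^esub> b)"
        using b c(1) by (simp add: F.l_distr F.r_distr F.a_ac F.m_ac)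
      also have "\<dots> = \<zero>\<^bsub>F\<^esub>"
        using b c by simp
      finally show ?thesis
        using b c(1) F.integral_iff by (simp add: add_eq_zero_iff)
    qed
    moreover have "(b \<oplus>\<^bsub>F\<^esub> \<one>\<^bsub>F\<^esub>) \<oplus>\<^bsub>F\<^esub> (b \<oplus>\<^bsub>F\<^esub> \<one>\<^bsub>F\<^esub>) \<otimes>\<^bsub>F\<^esub> (b \<oplus>\<^bsub>F\<^esub> \<one>\<^bsub>F\<^esub>) = b \<oplus>\<^bsub>F\<^esub> b \<otimes>\<^bsub>F\<^esub> b"
      using b by (simp add: F.l_distr F.r_distr F.a_ac F.m_ac)
    ultimately show ?thesis using b by auto
  qed
  moreover have "b \<noteq> b \<oplus>\<^bsub>F\<^esub> \<one>\<^bsub>F\<^esub>" if "b \<in> carrier F" for b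
    using that by (metis F.one_closed F.one_not_zero add_self add_self_left)
  ultimately have "card {c \<in> carrier F. c \<oplus>\<^bsub>F\<^esub> c \<otimes>\<^bsub>F\<^esub> c = b \<oplus>\<^bsub>F\<^esub> b \<otimes>\<^bsub>F\<^esub> b} = 2"
    if "b \<in> carrier F" for b
    using that by simp
  from card_eq_card_image_times_fibre[OF assms(2) this] show ?thesis by simp
qed

text \<open>
  Abstracts the group algebra of an abelian 2-group with a distinguished element \<open>a\<close>: \<open>aug\<close> is
  the augmentation, \<open>\<iota>\<close> embeds the scalars, \<open>t = 1 + a\<close>, and the derivation \<open>\<mu>\<close> sums the
  coefficients of the group elements which involve an odd power of \<open>a\<close>.
\<close>

locale norm_setting = star_cring_char2 R star + F: field F
  for R (structure) and star and F +
  fixes aug and \<iota> and \<mu> and t and e :: nat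
  assumes finite_R: "finite (carrier R)" and finite_F: "finite (carrier F)"
    and char2_F: "\<one>\<^bsub>F\<^esub> \<oplus>\<^bsub>F\<^esub> \<one>\<^bsub>F\<^esub> = \<zero>\<^bsub>F\<^esub>"
    and aug_closed [simp]: "x \<in> carrier R \<Longrightarrow> aug x \<in> carrier F"
    and aug_add [simp]: "x \<in> carrier R \<Longrightarrow> y \<in> carrier R \<Longrightarrow> aug (x \<oplus> y) = aug x \<oplus>\<^bsub>F\<^esub> aug y"
    and aug_mult [simp]: "x \<in> carrier R \<Longrightarrow> y \<in> carrier R \<Longrightarrow> aug (x \<otimes> y) = aug x \<otimes>\<^bsub>F\<^esub> aug y"
    and aug_star [simp]: "x \<in> carrier R \<Longrightarrow> aug (star x) = aug x"
    and iota_closed [simp]: "c \<in> carrier F \<Longrightarrow> \<iota> c \<in> carrier R"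
    and iota_add: "c \<in> carrier F \<Longrightarrow> d \<in> carrier F \<Longrightarrow> \<iota> (c \<oplus>\<^bsub>F\<^esub> d) = \<iota> c \<oplus> \<iota> d"
    and iota_mult: "c \<in> carrier F \<Longrightarrow> d \<in> carrier F \<Longrightarrow> \<iota> (c \<otimes>\<^bsub>F\<^esub> d) = \<iota> c \<otimes> \<iota> d"
    and iota_one [simp]: "\<iota> \<one>\<^bsub>F\<^esub> = \<one>"
    and star_iota [simp]: "c \<in> carrier F \<Longrightarrow> star (\<iota> c) = \<iota> c"
    and aug_iota [simp]: "c \<in> carrier F \<Longrightarrow> aug (\<iota> c) = c"
    and mu_closed [simp]: "x \<in> carrier R \<Longrightarrow> \<mu> x \<in> carrier F"
    and mu_add [simp]: "x \<in> carrier R \<Longrightarrow> y \<in> carrier R \<Longrightarrow> \<mu> (x \<oplus> y) = \<mu> x \<oplus>\<^bsub>F\<^esub> \<mu> y"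
    and mu_mult [simp]: "x \<in> carrier R \<Longrightarrow> y \<in> carrier R
      \<Longrightarrow> \<mu> (x \<otimes> y) = \<mu> x \<otimes>\<^bsub>F\<^esub> aug y \<oplus>\<^bsub>F\<^esub> aug x \<otimes>\<^bsub>F\<^esub> \<mu> y"
    and mu_symmetric: "x \<in> carrier R \<Longrightarrow> star x = x \<Longrightarrow> \<mu> x = \<zero>\<^bsub>F\<^esub>"
    and t_closed [simp]: "t \<in> carrier R"
    and aug_t [simp]: "aug t = \<zero>\<^bsub>F\<^esub>"
    and mu_t [simp]: "\<mu> t = \<one>\<^bsub>F\<^esub>"
    and norm_t: "t \<otimes> star t = t \<oplus> star t"
    and t_nilpotent: "t [^] (2 ^ e :: nat) = \<zero>"
    and expansion: "x \<in> carrier R \<Longrightarrow> \<exists>r h y. r \<in> carrier R \<and> h \<in> carrier R \<and> y \<in> carrier R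
      \<and> star r = r \<and> r \<otimes> r = \<iota> (aug r \<otimes>\<^bsub>F\<^esub> aug r)
      \<and> star h = h \<and> h \<otimes> h = \<iota> (aug h \<otimes>\<^bsub>F\<^esub> aug h)
      \<and> x = r \<oplus> h \<otimes> t \<oplus> t \<otimes> t \<otimes> y"
begin

sublocale F: cring_char2 F
  by unfold_locales (rule char2_F)

definition artin_schreier :: "'c set" where
  "artin_schreier = (\<lambda>b. b \<oplus>\<^bsub>F\<^esub> b \<otimes>\<^bsub>F\<^esub> b) ` carrier F"

definition unitary :: "'a set" where
  "unitary = {x \<in> carrier R. x \<otimes> star x = \<one>}"

definition normalized :: "'a set" where
  "normalized = {x \<in> carrier R. aug x = \<one>\<^bsub>F\<^esub>}"

definition symmetric :: "'a set" where
  "symmetric = {x \<in> carrier R. star x = x}"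

lemma aug_one [simp]: "aug \<one> = \<one>\<^bsub>F\<^esub>"
  using aug_iota[of "\<one>\<^bsub>F\<^esub>"] by simp

lemma F_square_eq_oneD:
  assumes "c \<in> carrier F" "c \<otimes>\<^bsub>F\<^esub> c = \<one>\<^bsub>F\<^esub>"
  shows "c = \<one>\<^bsub>F\<^esub>"
proof -
  have "(c \<oplus>\<^bsub>F\<^esub> \<one>\<^bsub>F\<^esub>) \<otimes>\<^bsub>F\<^esub> (c \<oplus>\<^bsub>F\<^esub> \<one>\<^bsub>F\<^esub>) = \<zero>\<^bsub>F\<^esub>"
    using assms by (simp add: F.l_distr F.r_distr F.a_ac)
  then show ?thesis
    using assms(1) F.integral_iff by (simp add: F.add_eq_zero_iff)
qed

lemma aug_norm: "x \<in> carrier R \<Longrightarrow> aug (x \<otimes> star x) = aug x \<otimes>\<^bsub>F\<^esub> aug x"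
  by simp

lemma aug_eq_one_if_unitary:
  assumes "x \<in> unitary"
  shows "aug x = \<one>\<^bsub>F\<^esub>"
proof -
  have x: "x \<in> carrier R" "x \<otimes> star x = \<one>"
    using assms by (auto simp: unitary_def)
  then show ?thesis
    using aug_norm[OF x(1)] F_square_eq_oneD[of "aug x"] by (simp only: aug_one aug_closed)
qed

text \<open>In the expansion of x the leading term has square one, and every other summand of the
  norm comes together with its conjugate once t s is replaced by t + s. Choosing one summand from
  each pair gives w.\<close>

lemma norm_of_normalized:
  assumes "x \<in> carrier R" "aug x = \<one>\<^bsub>F\<^esub>"
  obtains w where "w \<in> carrier R" "\<mu> w \<in> artin_schreier" "x \<otimes> star x = \<one> \<oplus> (w \<oplus> star w)"
proof -
  obtain r \<beta> y where c [simp]: "r \<in> carrier R" "\<beta> \<in> carrier R" "y \<in> carrier R"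
    and r: "star r = r" "r \<otimes> r = \<iota> (aug r \<otimes>\<^bsub>F\<^esub> aug r)"
    and b: "star \<beta> = \<beta>"
    and x: "x = r \<oplus> \<beta> \<otimes> t \<oplus> t \<otimes> t \<otimes> y"
    using expansion[OF assms(1)] by blast
  have [simp]: "aug r = \<one>\<^bsub>F\<^esub>"
    using assms(2) by (simp add: x)
  have rr: "r \<otimes> r = \<one>"
    using r by simp
  define s where "s = star t"
  define z where "z = star y"
  have [simp]: "s \<in> carrier R" "z \<in> carrier R" "star s = t" "star t = s" "star y = z" "star z = y"
    by (auto simp: s_def z_def)
  have ts: "t \<otimes> s = t \<oplus> s"
    using norm_t by simp
  \<comment> \<open>The first summand collects the linear terms and has \<open>\<mu>\<close> equal
    to c + c^2 for c = \<open>aug \<beta>\<close>, as r has augmentation one. The remaining part is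
    divisible by t^2, so \<open>\<mu>\<close> does not see it.\<close>
  define w where "w = (r \<otimes> \<beta> \<oplus> \<beta> \<otimes> \<beta>) \<otimes> t \<oplus> t \<otimes> (t \<otimes> (r \<otimes> y \<oplus> \<beta> \<otimes> s \<otimes> y \<oplus> s \<otimes> (y \<otimes> z)))"
  have "x \<otimes> star x = r \<otimes> r \<oplus> r \<otimes> \<beta> \<otimes> (t \<oplus> s) \<oplus> \<beta> \<otimes> \<beta> \<otimes> (t \<otimes> s)
      \<oplus> (r \<otimes> t \<otimes> t \<otimes> y \<oplus> r \<otimes> s \<otimes> s \<otimes> z)
      \<oplus> (\<beta> \<otimes> t \<otimes> t \<otimes> s \<otimes> y \<oplus> \<beta> \<otimes> t \<otimes> s \<otimes> s \<otimes> z)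
      \<oplus> y \<otimes> z \<otimes> (t \<otimes> s) \<otimes> (t \<otimes> s)"
    by (simp add: x r b char2_simps)
  also have "\<dots> = \<one> \<oplus> r \<otimes> \<beta> \<otimes> (t \<oplus> s) \<oplus> \<beta> \<otimes> \<beta> \<otimes> (t \<oplus> s)
      \<oplus> (r \<otimes> t \<otimes> t \<otimes> y \<oplus> r \<otimes> s \<otimes> s \<otimes> z)
      \<oplus> (\<beta> \<otimes> t \<otimes> t \<otimes> s \<otimes> y \<oplus> \<beta> \<otimes> t \<otimes> s \<otimes> s \<otimes> z)
      \<oplus> y \<otimes> z \<otimes> (t \<otimes> s) \<otimes> (t \<oplus> s)"
    by (simp only: rr ts)
  also have "\<dots> = \<one> \<oplus> (w \<oplus> star w)"
    by (simp add: w_def r b char2_simps)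
  finally have "x \<otimes> star x = \<one> \<oplus> (w \<oplus> star w)" .
  moreover have "\<mu> w \<in> artin_schreier"
    by (auto simp: w_def artin_schreier_def)
  ultimately show thesis
    using that[of w] by (simp add: w_def)
qed

text \<open>The norm of 1 + \<beta> t is 1 + (\<beta> + \<beta>^2)(t + star t) for symmetric
  \<beta>. Hence the linear part of w is matched by solving \<beta> + \<beta>^2 = h in the group
  algebra, and the part divisible by t^2 is left to \<open>trace_in_norms\<close>. The symmetric
  part r of w has trace zero.\<close>

lemma norm_exists:
  assumes "w \<in> carrier R" "\<mu> w \<in> artin_schreier"
  obtains x where "x \<in> carrier R" "x \<otimes> star x = \<one> \<oplus> (w \<oplus> star w)"
proof -
  obtain r h y where c [simp]: "r \<in> carrier R" "h \<in> carrier R" "y \<in> carrier R"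
    and r: "star r = r"
    and h: "star h = h" "h \<otimes> h = \<iota> (aug h \<otimes>\<^bsub>F\<^esub> aug h)"
    and w: "w = r \<oplus> h \<otimes> t \<oplus> t \<otimes> t \<otimes> y"
    using expansion[OF assms(1)] by blast
  have "\<mu> w = aug h"
    using mu_symmetric[OF _ r] mu_symmetric[OF _ h(1)] by (simp add: w)
  then obtain b where b [simp]: "b \<in> carrier F" and hb: "aug h = b \<oplus>\<^bsub>F\<^esub> b \<otimes>\<^bsub>F\<^esub> b"
    using assms(2) by (auto simp: artin_schreier_def)
  \<comment> \<open>Lifts the solution b of the Artin-Schreier equation from F: the element h +
    \<open>\<iota> (aug h)\<close> has square zero because h^2 is the scalar (aug h)^2. So \<beta>^2
    = \<open>\<iota> (b^2)\<close>, and adding \<beta> leaves h, since aug h = b + b^2.\<close>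
  define \<beta> where "\<beta> = \<iota> b \<oplus> h \<oplus> \<iota> (aug h)"
  have [simp]: "\<beta> \<in> carrier R" "star \<beta> = \<beta>"
    by (simp_all add: \<beta>_def h)
  have "\<beta> \<otimes> \<beta> = \<iota> b \<otimes> \<iota> b \<oplus> h \<otimes> h \<oplus> \<iota> (aug h) \<otimes> \<iota> (aug h)"
    by (simp add: \<beta>_def char2_simps)
  also have "\<dots> = \<iota> (b \<otimes>\<^bsub>F\<^esub> b)"
    by (simp add: h(2) iota_mult a_assoc)
  finally have bb: "\<beta> \<oplus> \<beta> \<otimes> \<beta> = h"
    by (simp add: \<beta>_def hb iota_add a_ac)
  define s where "s = star t"
  have [simp]: "s \<in> carrier R" "star s = t" "star t = s"
    by (auto simp: s_def)
  have ts: "t \<otimes> s = t \<oplus> s"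
    using norm_t by simp
  have "(\<beta> \<otimes> t) [^] (2 ^ e :: nat) = \<zero>"
    using t_nilpotent by (simp add: nat_pow_distrib)
  then obtain i where i: "i \<in> carrier R" "(\<one> \<oplus> \<beta> \<otimes> t) \<otimes> i = \<one>"
    using one_plus_nilpotent_unit[of "\<beta> \<otimes> t" e] by auto
  define I where "I = i \<otimes> star i"
  define P where "P = (\<one> \<oplus> \<beta> \<otimes> t) \<otimes> star (\<one> \<oplus> \<beta> \<otimes> t)"
  have [simp]: "I \<in> carrier R" "P \<in> carrier R" "star I = I"
    using i by (auto simp: I_def P_def m_comm)
  have PI: "P \<otimes> I = \<one>"
    using norm_mult[of "\<one> \<oplus> \<beta> \<otimes> t" i] i by (simp add: I_def P_def)
  have "P = \<one> \<oplus> \<beta> \<otimes> (t \<oplus> s) \<oplus> \<beta> \<otimes> \<beta> \<otimes> (t \<otimes> s)"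
    by (simp add: P_def char2_simps)
  also have "\<dots> = \<one> \<oplus> (\<beta> \<oplus> \<beta> \<otimes> \<beta>) \<otimes> (t \<oplus> s)"
    by (simp add: ts a_assoc l_distr)
  finally have P: "P = \<one> \<oplus> h \<otimes> (t \<oplus> s)"
    by (simp add: bb)
  \<comment> \<open>The factor \<open>I\<close>, inverse to the norm \<open>P\<close> of 1 + \<beta>
    t, is inserted so that multiplication by \<open>P\<close> afterwards restores the trace of t^2
    y; being symmetric, it passes through the trace.\<close>
  obtain x where x: "x \<in> carrier R"
    "x \<otimes> star x = \<one> \<oplus> (t \<otimes> t \<otimes> (y \<otimes> I) \<oplus> star (t \<otimes> t \<otimes> (y \<otimes> I)))"
    using trace_in_norms[OF t_closed norm_t t_nilpotent, of "y \<otimes> I" 0 "2 ^ e"] by auto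
  have "((\<one> \<oplus> \<beta> \<otimes> t) \<otimes> x) \<otimes> star ((\<one> \<oplus> \<beta> \<otimes> t) \<otimes> x) = P \<otimes> (x \<otimes> star x)"
    unfolding P_def using x(1) by (intro norm_mult) auto
  also have "\<dots> = P \<oplus> (P \<otimes> I) \<otimes> (t \<otimes> t \<otimes> y \<oplus> s \<otimes> s \<otimes> star y)"
    by (simp add: x(2) char2_simps)
  also have "\<dots> = \<one> \<oplus> (w \<oplus> star w)"
    by (simp add: PI) (simp add: P w r h char2_simps)
  finally show thesis
    using that[of "(\<one> \<oplus> \<beta> \<otimes> t) \<otimes> x"] x(1) by simp
qed

text \<open>Squaring removes the mixed terms of the expansion, so x^2 is one plus a multiple of t,
  hence a unit; x times its inverse is then the inverse of x.\<close>

lemma unit_if_aug_one: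
  assumes "x \<in> carrier R" "aug x = \<one>\<^bsub>F\<^esub>"
  obtains i where "i \<in> carrier R" "x \<otimes> i = \<one>"
proof -
  obtain r \<beta> y where c [simp]: "r \<in> carrier R" "\<beta> \<in> carrier R" "y \<in> carrier R"
    and r: "r \<otimes> r = \<iota> (aug r \<otimes>\<^bsub>F\<^esub> aug r)"
    and x: "x = r \<oplus> \<beta> \<otimes> t \<oplus> t \<otimes> t \<otimes> y"
    using expansion[OF assms(1)] by blast
  have "aug r = \<one>\<^bsub>F\<^esub>"
    using assms(2) by (simp add: x)
  then have rr: "r \<otimes> r = \<one>"
    using r by simp
  define z where "z = t \<otimes> (\<beta> \<otimes> \<beta> \<oplus> t \<otimes> t \<otimes> (y \<otimes> y))"
  have [simp]: "z \<in> carrier R" by (simp add: z_def)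
  have "x \<otimes> x = r \<otimes> r \<oplus> t \<otimes> z"
    by (simp add: x z_def char2_simps)
  then have xx: "x \<otimes> x = \<one> \<oplus> t \<otimes> z"
    by (simp only: rr)
  have "(t \<otimes> z) [^] (2 ^ e :: nat) = \<zero>"
    using t_nilpotent by (simp add: nat_pow_distrib)
  then obtain i where i: "i \<in> carrier R" "(\<one> \<oplus> t \<otimes> z) \<otimes> i = \<one>"
    using one_plus_nilpotent_unit[of "t \<otimes> z" e] by auto
  then have "x \<otimes> (x \<otimes> i) = \<one>"
    using assms(1) by (simp only: m_assoc[symmetric] xx)
  then show thesis
    using that[of "x \<otimes> i"] assms(1) i(1) by simp
qed

section \<open>Counting unitary elements of the abelian group algebra\<close>

lemma card_F: "card (carrier F) = 2 * card artin_schreier"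
  unfolding artin_schreier_def
  using F.field_axioms finite_F char2_F by (rule card_artin_schreier_image)

lemma card_normalized: "card (carrier R) = card (carrier F) * card normalized"
proof -
  have "card (carrier R) = card (aug ` carrier R) * card normalized"
  proof (rule card_eq_card_image_times_fibre[OF finite_R])
    fix x assume x: "x \<in> carrier R"
    show "card {y \<in> carrier R. aug y = aug x} = card normalized"
      unfolding normalized_def
    \<comment> \<open>Adding x + 1 changes the augmentation by aug x + 1, and so exchanges the
      values one and aug x.\<close>
    proof (rule card_translate[of "x \<oplus> \<one>"])
      fix y assume y: "y \<in> carrier R"
      have "aug (y \<oplus> (x \<oplus> \<one>)) = aug x \<oplus>\<^bsub>F\<^esub> (aug y \<oplus>\<^bsub>F\<^esub> \<one>\<^bsub>F\<^esub>)"
        using x y by (simp add: F.a_ac)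
      then show "aug (y \<oplus> (x \<oplus> \<one>)) = aug x \<longleftrightarrow> aug y = \<one>\<^bsub>F\<^esub>"
        using x y by (simp only: F.add.l_cancel_one aug_closed F.a_closed F.one_closed F.add_eq_zero_iff)
    qed (use x in simp)
  qed
  moreover have "aug ` carrier R = carrier F"
    by (auto intro: rev_image_eqI[OF iota_closed])
  ultimately show ?thesis by simp
qed

text \<open>\<open>\<mu>\<close> is additive and onto, since it takes \<open>\<iota> c\<close> times
  t to c; the preimage of half of F is half of the ring.\<close>

lemma card_mu_artin_schreier:
  "card (carrier R) = 2 * card {w \<in> carrier R. \<mu> w \<in> artin_schreier}"
proof -
  let ?k = "card {w \<in> carrier R. \<mu> w = \<zero>\<^bsub>F\<^esub>}"
  have fibre: "card {y \<in> carrier R. \<mu> y = \<mu> x} = ?k" if x: "x \<in> carrier R" for x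
  proof (rule card_translate[of x])
    fix y assume y: "y \<in> carrier R"
    show "\<mu> (y \<oplus> x) = \<mu> x \<longleftrightarrow> \<mu> y = \<zero>\<^bsub>F\<^esub>"
      using x y F.add.r_cancel_one[of "\<mu> x" "\<mu> y"] by simp
  qed (use x in simp)
  have surj: "\<exists>x\<in>carrier R. \<mu> x = c" if "c \<in> carrier F" for c
    using that mu_symmetric[of "\<iota> c"] by (intro bexI[of _ "\<iota> c \<otimes> t"]) auto
  have "card (carrier R) = card (\<mu> ` carrier R) * ?k"
    using finite_R fibre by (intro card_eq_card_image_times_fibre) auto
  moreover have "\<mu> ` carrier R = carrier F"
    using surj by (auto simp: image_iff)
  ultimately have 1: "card (carrier R) = card (carrier F) * ?k" by simp
  let ?W = "{w \<in> carrier R. \<mu> w \<in> artin_schreier}"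
  have "card ?W = card (\<mu> ` ?W) * ?k"
  proof (rule card_eq_card_image_times_fibre)
    fix x assume x: "x \<in> ?W"
    then have "{y \<in> ?W. \<mu> y = \<mu> x} = {y \<in> carrier R. \<mu> y = \<mu> x}" by auto
    then show "card {y \<in> ?W. \<mu> y = \<mu> x} = ?k" using x fibre by simp
  qed (use finite_R in simp)
  moreover have "\<mu> ` ?W = artin_schreier"
  proof
    show "artin_schreier \<subseteq> \<mu> ` ?W"
    proof
      fix c assume c: "c \<in> artin_schreier"
      then have "c \<in> carrier F" by (auto simp: artin_schreier_def)
      then show "c \<in> \<mu> ` ?W" using surj c by blast
    qed
  qed auto
  ultimately show ?thesis using 1 card_F by simp
qed

text \<open>v is a particular solution, and the kernel of the trace consists of the symmetric
  elements.\<close>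

lemma card_trace_solutions:
  assumes "v \<in> carrier R"
  shows "card {w \<in> carrier R. w \<oplus> star w = v \<oplus> star v} = card symmetric"
  unfolding symmetric_def
proof (rule card_translate[OF assms])
  fix y assume y: "y \<in> carrier R"
  have "y \<oplus> v \<oplus> star (y \<oplus> v) = v \<oplus> star v \<longleftrightarrow> (y \<oplus> star y) \<oplus> (v \<oplus> star v) = v \<oplus> star v"
    using y assms by (simp add: a_ac)
  also have "\<dots> \<longleftrightarrow> y \<oplus> star y = \<zero>"
    using y assms add.r_cancel_one[of "v \<oplus> star v" "y \<oplus> star y"] by simp
  finally show "y \<oplus> v \<oplus> star (y \<oplus> v) = v \<oplus> star v \<longleftrightarrow> star y = y"
    using y by (auto simp: add_eq_zero_iff)
qed

text \<open>Two ways of counting the image of the norm on \<open>normalized\<close>: its fibres have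
  the size of \<open>unitary\<close>, while as a set of shifted traces of \<open>?W\<close> it has
  fibres of the size of \<open>symmetric\<close>. The ring is |F| times as large as
  \<open>normalized\<close> and twice as large as \<open>?W\<close>, so eliminating the image gives
  the equation.\<close>

lemma card_unitary: "card (carrier F) * card unitary = 2 * card symmetric"
proof -
  let ?W = "{w \<in> carrier R. \<mu> w \<in> artin_schreier}"
  let ?N = "\<lambda>x. x \<otimes> star x"
  have "?N ` normalized = (\<lambda>w. \<one> \<oplus> w) ` ((\<lambda>w. w \<oplus> star w) ` ?W)"
  proof
    show "?N ` normalized \<subseteq> (\<lambda>w. \<one> \<oplus> w) ` ((\<lambda>w. w \<oplus> star w) ` ?W)"
    proof
      fix v assume "v \<in> ?N ` normalized"
      then obtain x where "x \<in> carrier R" "aug x = \<one>\<^bsub>F\<^esub>" "v = ?N x"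
        by (auto simp: normalized_def)
      moreover from this obtain w where "w \<in> carrier R" "\<mu> w \<in> artin_schreier"
        "?N x = \<one> \<oplus> (w \<oplus> star w)"
        using norm_of_normalized by blast
      ultimately show "v \<in> (\<lambda>w. \<one> \<oplus> w) ` ((\<lambda>w. w \<oplus> star w) ` ?W)"
        by blast
    qed
    show "(\<lambda>w. \<one> \<oplus> w) ` ((\<lambda>w. w \<oplus> star w) ` ?W) \<subseteq> ?N ` normalized"
    proof
      fix v assume "v \<in> (\<lambda>w. \<one> \<oplus> w) ` ((\<lambda>w. w \<oplus> star w) ` ?W)"
      then obtain w where w: "w \<in> carrier R" "\<mu> w \<in> artin_schreier" "v = \<one> \<oplus> (w \<oplus> star w)"
        by blast
      then obtain x where x: "x \<in> carrier R" "?N x = \<one> \<oplus> (w \<oplus> star w)"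
        using norm_exists by blast
      have "aug x \<otimes>\<^bsub>F\<^esub> aug x = aug (\<one> \<oplus> (w \<oplus> star w))"
        by (simp only: x(2)[symmetric] aug_norm[OF x(1)])
      also have "\<dots> = \<one>\<^bsub>F\<^esub>" using w by simp
      finally have "x \<in> normalized"
        using x(1) F_square_eq_oneD[of "aug x"] by (simp add: normalized_def)
      moreover have "v = ?N x" using x w by simp
      ultimately show "v \<in> ?N ` normalized" by blast
    qed
  qed
  moreover have "inj_on (\<lambda>w. \<one> \<oplus> w) ((\<lambda>w. w \<oplus> star w) ` ?W)"
    by (rule inj_on_subset[of _ "carrier R"]) (auto intro!: inj_onI)
  ultimately have img: "card (?N ` normalized) = card ((\<lambda>w. w \<oplus> star w) ` ?W)"
    by (simp only: card_image)
  have "card ?W = card ((\<lambda>w. w \<oplus> star w) ` ?W) * card symmetric"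
  proof (rule card_eq_card_image_times_fibre)
    fix x assume x: "x \<in> ?W"
    \<comment> \<open>Elements with equal traces differ by a symmetric element, where
      \<open>\<mu>\<close> vanishes. Hence \<open>?W\<close> is a union of full fibres of the
      trace.\<close>
    have "\<mu> y \<in> artin_schreier" if y: "y \<in> carrier R" "y \<oplus> star y = x \<oplus> star x" for y
    proof -
      have xR: "x \<in> carrier R" using x by blast
      have c: "y \<oplus> x \<in> carrier R" "star (y \<oplus> x) \<in> carrier R" using xR y(1) by auto
      have "star (y \<oplus> x) \<oplus> (y \<oplus> x) = (y \<oplus> star y) \<oplus> (x \<oplus> star x)"
        using xR y(1) by (simp add: a_ac)
      also have "\<dots> = \<zero>" unfolding y(2) using xR by (intro add_self) auto
      finally have "star (y \<oplus> x) = y \<oplus> x"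
        using add_eq_zero_iff[OF c(2,1)] by (rule iffD1[rotated])
      then have "\<mu> y \<oplus>\<^bsub>F\<^esub> \<mu> x = \<zero>\<^bsub>F\<^esub>"
        using mu_symmetric[OF c(1)] mu_add[OF y(1) xR] by (simp only:)
      then have "\<mu> y = \<mu> x"
        using xR y(1) by (simp only: F.add_eq_zero_iff mu_closed)
      then show ?thesis using x by simp
    qed
    then have "{y \<in> ?W. y \<oplus> star y = x \<oplus> star x} = {y \<in> carrier R. y \<oplus> star y = x \<oplus> star x}"
      by blast
    then show "card {y \<in> ?W. y \<oplus> star y = x \<oplus> star x} = card symmetric"
      using x card_trace_solutions[of x] by simp
  qed (use finite_R in simp)
  moreover have "card normalized = card (?N ` normalized) * card unitary"
  proof (rule card_eq_card_image_times_fibre)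
    fix x assume "x \<in> normalized"
    then have x: "x \<in> carrier R" "aug x = \<one>\<^bsub>F\<^esub>" by (auto simp: normalized_def)
    then obtain i where i: "i \<in> carrier R" "x \<otimes> i = \<one>" by (rule unit_if_aug_one)
    have Ni: "?N x \<otimes> ?N i = \<one>"
      by (simp only: norm_mult[OF x(1) i(1), symmetric] i(2) star_one l_one one_closed)
    \<comment> \<open>The norm determines the square of the augmentation, and only one squares to
      one in F. So the fibre of the norm in \<open>normalized\<close> is the one in the whole ring,
      a translate of \<open>unitary\<close> by the unit x.\<close>
    have "aug y = \<one>\<^bsub>F\<^esub>" if y: "y \<in> carrier R" "?N y = ?N x" for y
    proof (rule F_square_eq_oneD)
      have "aug y \<otimes>\<^bsub>F\<^esub> aug y = aug (?N x)"
        by (simp only: y(2)[symmetric] aug_norm[OF y(1)])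
      then show "aug y \<otimes>\<^bsub>F\<^esub> aug y = \<one>\<^bsub>F\<^esub>"
        by (simp only: aug_norm[OF x(1)] x(2) F.l_one F.one_closed)
    qed (rule aug_closed[OF y(1)])
    then have "{y \<in> normalized. ?N y = ?N x} = {y \<in> carrier R. ?N y = ?N x}"
      by (intro Collect_cong) (auto simp only: normalized_def mem_Collect_eq)
    moreover have "card {y \<in> carrier R. ?N y = ?N x} = card unitary"
      unfolding unitary_def
    proof (rule card_scale[OF x(1) i])
      fix y assume y: "y \<in> carrier R"
      have "?N (y \<otimes> x) = ?N x \<longleftrightarrow> ?N y \<otimes> ?N x = \<one> \<otimes> ?N x"
        using x(1) by (simp only: norm_mult[OF y x(1)] l_one m_closed star_closed)
      also have "\<dots> \<longleftrightarrow> ?N y = \<one>"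
      proof
        assume a: "?N y \<otimes> ?N x = \<one> \<otimes> ?N x"
        have "?N y = ?N y \<otimes> (?N x \<otimes> ?N i)"
          using y by (simp only: Ni r_one m_closed star_closed)
        also have "\<dots> = (?N y \<otimes> ?N x) \<otimes> ?N i"
          using y x i by (simp only: m_assoc m_closed star_closed)
        also have "\<dots> = \<one>"
          unfolding a using x(1) i(1) by (simp only: Ni l_one m_closed star_closed)
        finally show "?N y = \<one>" .
      qed simp
      finally show "?N (y \<otimes> x) = ?N x \<longleftrightarrow> ?N y = \<one>" .
    qed
    ultimately show "card {y \<in> normalized. ?N y = ?N x} = card unitary" by (simp only:)
  qed (use finite_R in \<open>simp add: normalized_def\<close>)
  ultimately have "card (carrier F) * (card (?N ` normalized) * card unitary)
      = 2 * (card (?N ` normalized) * card symmetric)"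
    using card_normalized card_mu_artin_schreier by (simp only: img)
  then have eq: "card (?N ` normalized) * (card (carrier F) * card unitary)
      = card (?N ` normalized) * (2 * card symmetric)"
    by (simp only: mult.left_commute)
  \<comment> \<open>The image of the norm is nonempty, so its cardinality can be cancelled.\<close>
  have "\<one> \<in> normalized" by (simp add: normalized_def)
  moreover have "finite normalized"
    using finite_R by (simp add: normalized_def)
  ultimately have "card (?N ` normalized) \<noteq> 0"
    by (metis card_0_eq empty_iff finite_imageI image_is_empty)
  with eq show ?thesis by (simp only: mult_cancel1) blast
qed

section \<open>Counting pairs whose norms add up to one\<close>

text \<open>The pairs are grouped by their sum s. For each s of augmentation one,
  \<open>norm_of_normalized\<close> writes 1 + s (star s) as a trace, so the condition on x is
  solvable and every s contributes equally many pairs.\<close>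

lemma card_norm_sum_eq_one:
  "card {p \<in> carrier R \<times> carrier R. fst p \<otimes> star (fst p) \<oplus> snd p \<otimes> star (snd p) = \<one>}
    = card normalized * card symmetric"
proof -
  let ?N = "\<lambda>x. x \<otimes> star x"
  let ?P = "{p \<in> carrier R \<times> carrier R. ?N (fst p) \<oplus> ?N (snd p) = \<one>}"
  let ?X = "\<lambda>s. {x \<in> carrier R. ?N x \<oplus> ?N (x \<oplus> s) = \<one>}"
  have "bij_betw (\<lambda>(x, y). (x \<oplus> y, x)) ?P (SIGMA s:normalized. ?X s)"
  proof (rule bij_betw_byWitness[where f' = "\<lambda>(s, x). (x, x \<oplus> s)"])
    \<comment> \<open>Squaring is additive on F, so the square of aug (x + y) is the augmentation of
      the sum of the two norms, which is one.\<close>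
    have "x \<oplus> y \<in> normalized" if "x \<in> carrier R" "y \<in> carrier R" "?N x \<oplus> ?N y = \<one>" for x y
    proof -
      have "aug (x \<oplus> y) \<otimes>\<^bsub>F\<^esub> aug (x \<oplus> y) = aug (?N x \<oplus> ?N y)"
        using that(1,2) by (simp add: F.char2_simps)
      then show ?thesis
        using that F_square_eq_oneD[of "aug (x \<oplus> y)"] by (simp add: normalized_def)
    qed
    then show "(\<lambda>(x, y). (x \<oplus> y, x)) ` ?P \<subseteq> (SIGMA s:normalized. ?X s)"
      by auto
  qed (auto simp: normalized_def a_ac)
  then have "card ?P = card (SIGMA s:normalized. ?X s)"
    by (rule bij_betw_same_card)
  also have "\<dots> = (\<Sum>s\<in>normalized. card (?X s))"
    using finite_R by (intro card_SigmaI) (auto simp: normalized_def)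
  also have "\<dots> = (\<Sum>s\<in>normalized. card symmetric)"
  proof (rule sum.cong)
    fix s assume "s \<in> normalized"
    then have s [simp]: "s \<in> carrier R" "aug s = \<one>\<^bsub>F\<^esub>" by (auto simp: normalized_def)
    obtain v where v [simp]: "v \<in> carrier R" and sv: "?N s = \<one> \<oplus> (v \<oplus> star v)"
      using norm_of_normalized[of s] s by blast
    obtain i where i: "i \<in> carrier R" "star s \<otimes> i = \<one>"
      using unit_if_aug_one[of "star s"] s by auto
    \<comment> \<open>Expanding the norm of x + s cancels the norm of x and leaves the trace of x
      (star s) plus the norm of s.\<close>
    have "card (?X s) = card {x \<in> carrier R. x \<otimes> star s \<oplus> star (x \<otimes> star s) = v \<oplus> star v}"
    proof (intro arg_cong[of _ _ card] Collect_cong conj_cong refl)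
      fix x assume x: "x \<in> carrier R"
      have "?N x \<oplus> ?N (x \<oplus> s) = (x \<otimes> star s \<oplus> star (x \<otimes> star s)) \<oplus> ?N s"
        using x by (simp add: char2_simps)
      also have "\<dots> = \<one> \<oplus> ((x \<otimes> star s \<oplus> star (x \<otimes> star s)) \<oplus> (v \<oplus> star v))"
        unfolding sv using x by (simp add: a_ac)
      finally have "?N x \<oplus> ?N (x \<oplus> s) = \<one>
          \<longleftrightarrow> (x \<otimes> star s \<oplus> star (x \<otimes> star s)) \<oplus> (v \<oplus> star v) = \<zero>"
        using x add.l_cancel_one[of \<one> "(x \<otimes> star s \<oplus> star (x \<otimes> star s)) \<oplus> (v \<oplus> star v)"]
        by simp
      also have "\<dots> \<longleftrightarrow> x \<otimes> star s \<oplus> star (x \<otimes> star s) = v \<oplus> star v"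
        using x by (intro add_eq_zero_iff) auto
      finally show "?N x \<oplus> ?N (x \<oplus> s) = \<one>
          \<longleftrightarrow> x \<otimes> star s \<oplus> star (x \<otimes> star s) = v \<oplus> star v" .
    qed
    \<comment> \<open>\<open>star s\<close> also has augmentation one, hence is a unit, and
      multiplication by it permutes the ring.\<close>
    also have "\<dots> = card {w \<in> carrier R. w \<oplus> star w = v \<oplus> star v}"
      by (rule card_scale[OF _ i, symmetric]) simp_all
    also have "\<dots> = card symmetric"
      by (rule card_trace_solutions) simp
    finally show "card (?X s) = card symmetric" .
  qed simp
  finally show ?thesis by simp
qed

text \<open>Here \<open>z\<close> is any nonzero ring element, later 1 + z for the central
  involution. If both augmentations were nonzero, x y would be a unit killing \<open>z\<close>.
  Hence one of them vanishes, the other is one, and its unit can be cancelled from x y z = 0.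
  Annihilators of \<open>z\<close> have augmentation zero, so the two cases are disjoint.\<close>

lemma card_norm_sum_eq_one_annihilated:
  assumes z: "z \<in> carrier R" "z \<noteq> \<zero>"
    and ann: "\<And>y. y \<in> carrier R \<Longrightarrow> y \<otimes> z = \<zero> \<Longrightarrow> y \<otimes> star y = \<zero>"
  shows "card {p \<in> carrier R \<times> carrier R.
      fst p \<otimes> star (fst p) \<oplus> snd p \<otimes> star (snd p) = \<one> \<and> fst p \<otimes> snd p \<otimes> z = \<zero>}
    = 2 * (card unitary * card {y \<in> carrier R. y \<otimes> z = \<zero>})"
proof -
  let ?N = "\<lambda>x. x \<otimes> star x"
  let ?A = "{y \<in> carrier R. y \<otimes> z = \<zero>}"
  let ?P = "{p \<in> carrier R \<times> carrier R.
      ?N (fst p) \<oplus> ?N (snd p) = \<one> \<and> fst p \<otimes> snd p \<otimes> z = \<zero>}"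
  have aug_zero: "aug \<zero> = \<zero>\<^bsub>F\<^esub>"
    using aug_add[of \<one> \<one>] by simp
  have A_aug: "aug y = \<zero>\<^bsub>F\<^esub>" if y: "y \<in> ?A" for y
  proof -
    have yR: "y \<in> carrier R" using y by blast
    have "?N y = \<zero>" using ann y by blast
    then have "aug y \<otimes>\<^bsub>F\<^esub> aug y = \<zero>\<^bsub>F\<^esub>"
      by (simp only: aug_norm[OF yR, symmetric] aug_zero)
    then show ?thesis
      using F.integral[of "aug y" "aug y"] aug_closed[OF yR] by blast
  qed
  have cancel: "y \<otimes> z = \<zero>" if h: "x \<in> carrier R" "aug x = \<one>\<^bsub>F\<^esub>" "y \<in> carrier R" "x \<otimes> y \<otimes> z = \<zero>" for x y
  proof -
    obtain i where i: "i \<in> carrier R" "x \<otimes> i = \<one>"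
      by (rule unit_if_aug_one[OF h(1,2)])
    have "y \<otimes> z = (x \<otimes> i) \<otimes> (y \<otimes> z)" unfolding i(2) using h(3) z(1) by simp
    also have "\<dots> = i \<otimes> (x \<otimes> y \<otimes> z)" using h(1,3) i(1) z(1) by (simp add: m_ac)
    also have "\<dots> = \<zero>" unfolding h(4) using i(1) by simp
    finally show ?thesis .
  qed
  have main: "(x \<in> unitary \<and> y \<in> ?A) \<or> (y \<in> unitary \<and> x \<in> ?A)"
    if c: "x \<in> carrier R" "y \<in> carrier R" and N: "?N x \<oplus> ?N y = \<one>" and xyz: "x \<otimes> y \<otimes> z = \<zero>" for x y
  proof -
    have "aug x \<otimes>\<^bsub>F\<^esub> aug y = \<zero>\<^bsub>F\<^esub>"
    proof (rule ccontr)
      assume n: "aug x \<otimes>\<^bsub>F\<^esub> aug y \<noteq> \<zero>\<^bsub>F\<^esub>"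
      \<comment> \<open>Rescales x y to augmentation one, so that \<open>cancel\<close> applies to
        it with the cofactor one and yields z = 0.\<close>
      define d where "d = inv\<^bsub>F\<^esub> (aug x \<otimes>\<^bsub>F\<^esub> aug y)"
      have d: "d \<in> carrier F" "d \<otimes>\<^bsub>F\<^esub> (aug x \<otimes>\<^bsub>F\<^esub> aug y) = \<one>\<^bsub>F\<^esub>"
        using n c by (auto simp: d_def F.field_Units)
      have "\<one> \<otimes> z = \<zero>"
      proof (rule cancel)
        show "aug (\<iota> d \<otimes> (x \<otimes> y)) = \<one>\<^bsub>F\<^esub>" using c d by simp
        have "\<iota> d \<otimes> (x \<otimes> y) \<otimes> \<one> \<otimes> z = \<iota> d \<otimes> (x \<otimes> y \<otimes> z)"
          using c d z by (simp add: m_assoc)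
        then show "\<iota> d \<otimes> (x \<otimes> y) \<otimes> \<one> \<otimes> z = \<zero>" using d xyz by simp
      qed (use c d in auto)
      then show False using z by simp
    qed
    then consider "aug x = \<zero>\<^bsub>F\<^esub>" | "aug y = \<zero>\<^bsub>F\<^esub>"
      using c F.integral_iff by auto
    moreover have aug1: "aug x \<otimes>\<^bsub>F\<^esub> aug x \<oplus>\<^bsub>F\<^esub> aug y \<otimes>\<^bsub>F\<^esub> aug y = \<one>\<^bsub>F\<^esub>"
      using arg_cong[OF N, of aug] c by simp
    ultimately show ?thesis
    proof cases
      case 1
      then have "aug y = \<one>\<^bsub>F\<^esub>"
        using aug1 c F_square_eq_oneD[of "aug y"] by simp
      then have "x \<otimes> z = \<zero>"
        using cancel[of y x] c xyz by (simp add: m_comm)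
      then show ?thesis
        using N ann[of x] c by (auto simp: unitary_def)
    next
      case 2
      then have "aug x = \<one>\<^bsub>F\<^esub>"
        using aug1 c F_square_eq_oneD[of "aug x"] by simp
      then have "y \<otimes> z = \<zero>"
        using cancel[of x y] c xyz by simp
      then show ?thesis
        using N ann[of y] c by (auto simp: unitary_def)
    qed
  qed
  have disj: "x \<notin> ?A" if "x \<in> unitary" for x
  proof
    assume "x \<in> ?A"
    then have "\<zero>\<^bsub>F\<^esub> = \<one>\<^bsub>F\<^esub>"
      by (simp only: A_aug[symmetric] aug_eq_one_if_unitary[OF that])
    then show False using F.one_not_zero by simp
  qed
  have P: "?P = unitary \<times> ?A \<union> ?A \<times> unitary"
  proof (intro equalityI subsetI)
    fix p assume p: "p \<in> ?P"
    obtain x y where xy: "p = (x, y)" by (cases p)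
    have "x \<in> carrier R" "y \<in> carrier R" "?N x \<oplus> ?N y = \<one>" "x \<otimes> y \<otimes> z = \<zero>"
      using p by (simp_all add: xy)
    from main[OF this] show "p \<in> unitary \<times> ?A \<union> ?A \<times> unitary"
      unfolding xy by blast
  next
    have *: "(x, y) \<in> ?P \<and> (y, x) \<in> ?P" if x: "x \<in> unitary" and y: "y \<in> ?A" for x y
    proof -
      have c: "x \<in> carrier R" "?N x = \<one>" "y \<in> carrier R" "y \<otimes> z = \<zero>"
        using x y by (simp_all add: unitary_def)
      have Ny: "?N y = \<zero>" by (rule ann[OF c(3,4)])
      have "x \<otimes> y \<otimes> z = \<zero>" using c z(1) by (simp only: m_assoc r_null)
      moreover have "y \<otimes> x \<otimes> z = \<zero>" using c z(1) by (simp only: m_comm[of y x] m_assoc r_null)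
      ultimately show ?thesis using c(1,3) by (simp add: c(2) Ny)
    qed
    fix p assume "p \<in> unitary \<times> ?A \<union> ?A \<times> unitary"
    then show "p \<in> ?P"
    proof
      assume "p \<in> unitary \<times> ?A"
      then show ?thesis using * by (cases p) blast
    next
      assume "p \<in> ?A \<times> unitary"
      then show ?thesis using * by (cases p) blast
    qed
  qed
  have fin: "finite unitary" "finite ?A"
    using finite_R by (simp_all add: unitary_def)
  have "card ?P = card (unitary \<times> ?A) + card (?A \<times> unitary)"
    unfolding P using fin disj by (intro card_Un_disjoint finite_cartesian_product) blast+
  then show ?thesis
    by (simp only: card_cartesian_product) simp
qed

end

section \<open>Abelian 2-groups\<close>

text \<open>The assumptions say that \<open>a\<close> has order exactly 2^e; \<open>split\<close>
  replaces the decomposition as a direct product of the cyclic group of \<open>a\<close> with E. In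
  this form they can be carried over along isomorphisms without choosing a complement.\<close>

locale abelian_2_group_algebra = finite_group_algebra F G + G: comm_group G
  for F (structure) and G +
  fixes a and e :: nat
  assumes finite_F: "finite (carrier F)" and char2_F: "\<one> \<oplus> \<one> = \<zero>"
    and a_closed [simp]: "a \<in> carrier G"
    and e: "2 \<le> e"
    and a_pow: "a [^]\<^bsub>G\<^esub> (2 ^ e :: nat) = \<one>\<^bsub>G\<^esub>"
    and a_half_pow: "a [^]\<^bsub>G\<^esub> (2 ^ (e - 1) :: nat) \<noteq> \<one>\<^bsub>G\<^esub>"
    and split: "g \<in> carrier G
      \<Longrightarrow> \<exists>y\<in>carrier G. \<exists>i::nat. y \<otimes>\<^bsub>G\<^esub> y = \<one>\<^bsub>G\<^esub> \<and> g = y \<otimes>\<^bsub>G\<^esub> a [^]\<^bsub>G\<^esub> i"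
begin

sublocale F: cring_char2 F
  by unfold_locales (rule char2_F)

lemma finite_FG: "finite (carrier FG)"
  using finite_F finite_carrier by (auto simp: carrier_FG intro: finite_PiE)

lemma cring_FG: "cring FG"
  by (rule FG_cring) (rule G.comm_group_axioms)

sublocale R: star_cring_char2 FG star
proof -
  interpret R: cring FG by (rule cring_FG)
  show "star_cring_char2 FG star"
  proof unfold_locales
    show "\<one>\<^bsub>FG\<^esub> \<oplus>\<^bsub>FG\<^esub> \<one>\<^bsub>FG\<^esub> = \<zero>\<^bsub>FG\<^esub>"
      by (rule FG_eqI) (simp_all add: one_FG)
    fix x y assume xy: "x \<in> carrier FG" "y \<in> carrier FG"
    show "star (x \<otimes>\<^bsub>FG\<^esub> y) = star x \<otimes>\<^bsub>FG\<^esub> star y"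
      using star_mult[OF xy] R.m_comm[of "star x" "star y"] xy by simp
    show "star (x \<oplus>\<^bsub>FG\<^esub> y) = star x \<oplus>\<^bsub>FG\<^esub> star y"
      by (rule star_add)
  qed (auto simp: star_star)
qed

section \<open>The parity of the exponent of \<open>a\<close> and the derivation it defines\<close>

text \<open>Raising to the power M kills the involutions and takes a^i to z^i, so it detects the
  parity of i. That involutions die requires M to be even, which is where e is at least 2.\<close>

definition M :: nat where "M = 2 ^ (e - 1)"

lemma M_add_M: "M + M = 2 ^ e"
  unfolding M_def using e by (cases e) auto

lemma even_M: "even M"
  using e by (simp add: M_def)

lemma a_pow': "a [^]\<^bsub>G\<^esub> M \<noteq> \<one>\<^bsub>G\<^esub>"
  using a_half_pow by (simp only: M_def not_False_eq_True)

abbreviation z where "z \<equiv> a [^]\<^bsub>G\<^esub> M"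

lemma z_mult_z: "z \<otimes>\<^bsub>G\<^esub> z = \<one>\<^bsub>G\<^esub>"
  by (simp add: G.nat_pow_mult M_add_M a_pow)

lemma pow_of_involution:
  assumes "y \<in> carrier G" "y \<otimes>\<^bsub>G\<^esub> y = \<one>\<^bsub>G\<^esub>"
  shows "y [^]\<^bsub>G\<^esub> M = \<one>\<^bsub>G\<^esub>"
proof -
  have "y [^]\<^bsub>G\<^esub> (2::nat) = \<one>\<^bsub>G\<^esub>"
    using assms by (simp add: numeral_2_eq_2)
  moreover obtain k where "M = 2 * k"
    using even_M by blast
  ultimately show ?thesis
    using G.nat_pow_pow[OF assms(1), of 2 k] by simp
qed

lemma pow_cases:
  assumes "g \<in> carrier G"
  shows "g [^]\<^bsub>G\<^esub> M = \<one>\<^bsub>G\<^esub> \<or> g [^]\<^bsub>G\<^esub> M = z"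
proof -
  obtain y i where y: "y \<in> carrier G" "y \<otimes>\<^bsub>G\<^esub> y = \<one>\<^bsub>G\<^esub>" and g: "g = y \<otimes>\<^bsub>G\<^esub> a [^]\<^bsub>G\<^esub> (i::nat)"
    using split[OF assms] by blast
  have "g [^]\<^bsub>G\<^esub> M = (a [^]\<^bsub>G\<^esub> i) [^]\<^bsub>G\<^esub> M"
    using y by (simp add: g G.nat_pow_distrib pow_of_involution)
  also have "\<dots> = z [^]\<^bsub>G\<^esub> i"
    by (simp add: G.nat_pow_pow mult.commute)
  finally have g: "g [^]\<^bsub>G\<^esub> M = z [^]\<^bsub>G\<^esub> i" .
  have "z [^]\<^bsub>G\<^esub> i = \<one>\<^bsub>G\<^esub> \<or> z [^]\<^bsub>G\<^esub> i = z"
  proof (induction i)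
    case (Suc i)
    then show ?case by (auto simp: z_mult_z)
  qed simp
  then show ?thesis by (simp only: g)
qed

text \<open>A homomorphism to the additive group of F: the exponent of \<open>a\<close> modulo two.
  Expressing it by the power M avoids choosing a decomposition of g.\<close>

definition \<chi> where
  "\<chi> g = (if g [^]\<^bsub>G\<^esub> M = \<one>\<^bsub>G\<^esub> then \<zero> else \<one>)"

lemma chi_closed [simp]: "\<chi> g \<in> carrier F"
  by (simp add: \<chi>_def)

lemma chi_mult:
  assumes "g \<in> carrier G" "h \<in> carrier G"
  shows "\<chi> (g \<otimes>\<^bsub>G\<^esub> h) = \<chi> g \<oplus> \<chi> h"
  using pow_cases[OF assms(1)] pow_cases[OF assms(2)] assms a_pow'
  by (auto simp: \<chi>_def G.nat_pow_distrib z_mult_z)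

lemma chi_involution: "y \<in> carrier G \<Longrightarrow> y \<otimes>\<^bsub>G\<^esub> y = \<one>\<^bsub>G\<^esub> \<Longrightarrow> \<chi> y = \<zero>"
  by (simp add: \<chi>_def pow_of_involution)

lemma chi_inv:
  assumes "g \<in> carrier G"
  shows "\<chi> (inv\<^bsub>G\<^esub> g) = \<chi> g"
proof -
  have "\<chi> g \<oplus> \<chi> (inv\<^bsub>G\<^esub> g) = \<chi> \<one>\<^bsub>G\<^esub>"
    using chi_mult[of g "inv\<^bsub>G\<^esub> g"] assms by simp
  also have "\<dots> = \<zero>" by (rule chi_involution) auto
  finally show ?thesis
    using F.add_eq_zero_iff[of "\<chi> g" "\<chi> (inv\<^bsub>G\<^esub> g)"] by simp
qed

definition \<mu> where
  "\<mu> u = (\<Oplus>x\<in>carrier G. u x \<otimes> \<chi> x)"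

lemma mu_closed [simp]: "u \<in> carrier FG \<Longrightarrow> \<mu> u \<in> carrier F"
  by (auto simp: \<mu>_def intro!: finsum_closed)

lemma mu_add:
  assumes "u \<in> carrier FG" "v \<in> carrier FG"
  shows "\<mu> (u \<oplus>\<^bsub>FG\<^esub> v) = \<mu> u \<oplus> \<mu> v"
  unfolding \<mu>_def
  by (subst finsum_addf[symmetric])
    (use assms in \<open>auto intro!: finsum_cong' simp: F.l_distr simp del: F.add.finprod_multf\<close>)

text \<open>Additivity of \<open>\<chi>\<close> splits the double sum over the product into the two
  terms of the Leibniz rule.\<close>

lemma mu_mult:
  assumes u: "u \<in> carrier FG" and v: "v \<in> carrier FG"
  shows "\<mu> (u \<otimes>\<^bsub>FG\<^esub> v) = \<mu> u \<otimes> aug v \<oplus> aug u \<otimes> \<mu> v"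
proof -
  have "\<mu> (u \<otimes>\<^bsub>FG\<^esub> v) = (\<Oplus>x\<in>carrier G. \<Oplus>y\<in>carrier G. u x \<otimes> v y \<otimes> \<chi> (x \<otimes>\<^bsub>G\<^esub> y))"
    unfolding \<mu>_def by (rule sum_mult_FG) (use u v in auto)
  also have "\<dots> = (\<Oplus>x\<in>carrier G. u x \<otimes> \<chi> x \<otimes> aug v \<oplus> u x \<otimes> \<mu> v)"
  proof (rule finsum_cong'[OF refl])
    fix x assume x: "x \<in> carrier G"
    have "(\<Oplus>y\<in>carrier G. u x \<otimes> v y \<otimes> \<chi> (x \<otimes>\<^bsub>G\<^esub> y))
        = (\<Oplus>y\<in>carrier G. u x \<otimes> \<chi> x \<otimes> v y \<oplus> u x \<otimes> (v y \<otimes> \<chi> y))"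
      using u v x by (intro finsum_cong') (auto simp: chi_mult F.r_distr F.m_ac)
    also have "\<dots> = (\<Oplus>y\<in>carrier G. u x \<otimes> \<chi> x \<otimes> v y) \<oplus> (\<Oplus>y\<in>carrier G. u x \<otimes> (v y \<otimes> \<chi> y))"
      using u v x by (intro finsum_addf) auto
    also have "(\<Oplus>y\<in>carrier G. u x \<otimes> \<chi> x \<otimes> v y) = u x \<otimes> \<chi> x \<otimes> aug v"
      using u v x finite_carrier by (intro finsum_rdistr[symmetric]) auto
    also have "(\<Oplus>y\<in>carrier G. u x \<otimes> (v y \<otimes> \<chi> y)) = u x \<otimes> \<mu> v"
      unfolding \<mu>_def using u v x finite_carrier by (intro finsum_rdistr[symmetric]) auto
    finally show "(\<Oplus>y\<in>carrier G. u x \<otimes> v y \<otimes> \<chi> (x \<otimes>\<^bsub>G\<^esub> y)) = u x \<otimes> \<chi> x \<otimes> aug v \<oplus> u x \<otimes> \<mu> v" .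
  qed (use u v in auto)
  also have "\<dots> = (\<Oplus>x\<in>carrier G. u x \<otimes> \<chi> x \<otimes> aug v) \<oplus> (\<Oplus>x\<in>carrier G. u x \<otimes> \<mu> v)"
    using u v by (intro finsum_addf) auto
  also have "(\<Oplus>x\<in>carrier G. u x \<otimes> \<chi> x \<otimes> aug v) = \<mu> u \<otimes> aug v"
    unfolding \<mu>_def using u v finite_carrier by (intro finsum_ldistr[symmetric]) auto
  also have "(\<Oplus>x\<in>carrier G. u x \<otimes> \<mu> v) = aug u \<otimes> \<mu> v"
    using u v finite_carrier by (intro finsum_ldistr[symmetric]) auto
  finally show ?thesis .
qed

lemma mu_single:
  assumes "c \<in> carrier F" "g \<in> carrier G"
  shows "\<mu> (single c g) = c \<otimes> \<chi> g"
proof -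
  have "\<mu> (single c g) = (\<Oplus>x\<in>carrier G. if x = g then c \<otimes> \<chi> x else \<zero>)"
    unfolding \<mu>_def using assms by (intro finsum_cong') auto
  also have "\<dots> = c \<otimes> \<chi> g"
    using assms by (intro finsum_delta) auto
  finally show ?thesis .
qed

text \<open>Coefficients and \<open>\<chi>\<close> are both unchanged under inversion, so in
  characteristic two only elements with x^2 = 1 contribute, and \<open>\<chi>\<close> vanishes on
  these.\<close>

lemma mu_symmetric:
  assumes u: "u \<in> carrier FG" and sym: "star u = u"
  shows "\<mu> u = \<zero>"
proof -
  have inv: "u (inv\<^bsub>G\<^esub> x) = u x" if "x \<in> carrier G" for x
    using fun_cong[OF sym, of x] star_FG[OF that, of u] by (simp only:)
  have "\<mu> u = (\<Oplus>x\<in>{x \<in> carrier G. inv\<^bsub>G\<^esub> x = x}. u x \<otimes> \<chi> x)"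
    unfolding \<mu>_def
  proof (rule finsum_invariant_char2)
    show "u (inv\<^bsub>G\<^esub> x) \<otimes> \<chi> (inv\<^bsub>G\<^esub> x) = u x \<otimes> \<chi> x" if "x \<in> carrier G" for x
      by (simp only: inv[OF that] chi_inv[OF that])
  qed (use u finite_carrier in auto)
  also have "\<dots> = (\<Oplus>x\<in>{x \<in> carrier G. inv\<^bsub>G\<^esub> x = x}. \<zero>)"
  proof (rule finsum_cong'[OF refl])
    fix x assume "x \<in> {x \<in> carrier G. inv\<^bsub>G\<^esub> x = x}"
    then have x: "x \<in> carrier G" "x \<otimes>\<^bsub>G\<^esub> x = \<one>\<^bsub>G\<^esub>"
      using G.r_inv[of x] by auto
    then show "u x \<otimes> \<chi> x = \<zero>"
      using u chi_involution[OF x] by simp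
  qed simp
  also have "\<dots> = \<zero>" by (rule finsum_zero)
  finally show ?thesis .
qed

section \<open>Expansion in powers of t = 1 + a\<close>

definition \<iota> where "\<iota> c = single c \<one>\<^bsub>G\<^esub>"

definition t where "t = \<one>\<^bsub>FG\<^esub> \<oplus>\<^bsub>FG\<^esub> single \<one> a"

lemma single_pow:
  "g \<in> carrier G \<Longrightarrow> single \<one> g [^]\<^bsub>FG\<^esub> (n::nat) = single \<one> (g [^]\<^bsub>G\<^esub> n)"
  by (induction n) (simp_all add: one_FG_single single_mult)

lemma star_t: "star t = \<one>\<^bsub>FG\<^esub> \<oplus>\<^bsub>FG\<^esub> single \<one> (inv\<^bsub>G\<^esub> a)"
  by (simp add: t_def star_single)

text \<open>Both sides equal a plus its inverse, because the two ones cancel.\<close>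

lemma norm_t: "t \<otimes>\<^bsub>FG\<^esub> star t = t \<oplus>\<^bsub>FG\<^esub> star t"
proof -
  define u where "u = single \<one> a"
  define v where "v = single \<one> (inv\<^bsub>G\<^esub> a)"
  have uv: "u \<in> carrier FG" "v \<in> carrier FG" "u \<otimes>\<^bsub>FG\<^esub> v = \<one>\<^bsub>FG\<^esub>"
    by (simp_all add: u_def v_def single_mult one_FG_single)
  then show ?thesis
    unfolding star_t unfolding t_def u_def[symmetric] v_def[symmetric]
    by (simp add: R.l_distr R.r_distr R.a_ac)
qed

lemma t_nilpotent: "t [^]\<^bsub>FG\<^esub> (2 ^ e :: nat) = \<zero>\<^bsub>FG\<^esub>"
  unfolding t_def
  by (subst R.freshmans_dream) (simp_all add: single_pow a_pow one_FG_single[symmetric])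

lemma single_zero: "single \<zero> g = \<zero>\<^bsub>FG\<^esub>"
  by (rule FG_eqI) auto

lemma iota_add: "c \<in> carrier F \<Longrightarrow> d \<in> carrier F \<Longrightarrow> \<iota> (c \<oplus> d) = \<iota> c \<oplus>\<^bsub>FG\<^esub> \<iota> d"
  by (simp add: \<iota>_def single_add)

lemma iota_closed [simp]: "c \<in> carrier F \<Longrightarrow> \<iota> c \<in> carrier FG"
  by (simp add: \<iota>_def)

lemma iota_mult: "c \<in> carrier F \<Longrightarrow> d \<in> carrier F \<Longrightarrow> \<iota> (c \<otimes> d) = \<iota> c \<otimes>\<^bsub>FG\<^esub> \<iota> d"
  by (simp add: \<iota>_def single_mult)

lemma iota_one: "\<iota> \<one> = \<one>\<^bsub>FG\<^esub>"
  by (simp add: \<iota>_def one_FG_single)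

lemma star_iota: "c \<in> carrier F \<Longrightarrow> star (\<iota> c) = \<iota> c"
  by (simp add: \<iota>_def star_single)

lemma aug_iota: "c \<in> carrier F \<Longrightarrow> aug (\<iota> c) = c"
  by (simp add: \<iota>_def aug_single)

lemma t_closed [simp]: "t \<in> carrier FG"
  by (simp add: t_def)

text \<open>Abstracts the linear combinations of elements y with y^2 = 1: they are symmetric, and by
  additivity of squaring the square is the sum of the squared coefficients, a scalar.\<close>

definition square_scalar where
  "square_scalar r \<longleftrightarrow> r \<in> carrier FG \<and> star r = r \<and> r \<otimes>\<^bsub>FG\<^esub> r = \<iota> (aug r \<otimes> aug r)"

lemma square_scalar_add:
  assumes "square_scalar r" "square_scalar s"
  shows "square_scalar (r \<oplus>\<^bsub>FG\<^esub> s)"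
proof -
  have c: "r \<in> carrier FG" "s \<in> carrier FG" "star r = r" "star s = s"
    and sq: "r \<otimes>\<^bsub>FG\<^esub> r = \<iota> (aug r \<otimes> aug r)" "s \<otimes>\<^bsub>FG\<^esub> s = \<iota> (aug s \<otimes> aug s)"
    using assms by (simp_all add: square_scalar_def)
  have "(r \<oplus>\<^bsub>FG\<^esub> s) \<otimes>\<^bsub>FG\<^esub> (r \<oplus>\<^bsub>FG\<^esub> s) = r \<otimes>\<^bsub>FG\<^esub> r \<oplus>\<^bsub>FG\<^esub> s \<otimes>\<^bsub>FG\<^esub> s"
    using c(1,2) by (simp add: R.char2_simps)
  also have "\<dots> = \<iota> (aug r \<otimes> aug r \<oplus> aug s \<otimes> aug s)"
    unfolding sq using c by (simp add: iota_add)
  also have "aug r \<otimes> aug r \<oplus> aug s \<otimes> aug s = (aug r \<oplus> aug s) \<otimes> (aug r \<oplus> aug s)"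
    using c(1,2) by (simp add: F.char2_simps)
  also have "\<dots> = aug (r \<oplus>\<^bsub>FG\<^esub> s) \<otimes> aug (r \<oplus>\<^bsub>FG\<^esub> s)"
    by (simp only: aug_add c(1,2))
  finally show ?thesis
    using c by (simp add: square_scalar_def)
qed

lemma square_scalar_single:
  assumes "c \<in> carrier F" "y \<in> carrier G" "y \<otimes>\<^bsub>G\<^esub> y = \<one>\<^bsub>G\<^esub>"
  shows "square_scalar (single c y)"
proof -
  have "inv\<^bsub>G\<^esub> y = y"
    using assms G.inv_equality by blast
  then show ?thesis
    using assms by (simp add: square_scalar_def star_single aug_single single_mult \<iota>_def)
qed

text \<open>By linearity it suffices to treat a monomial c y a^i with y^2 = 1, and a = 1 + t.
  Induction on i keeps both coefficients within the class \<open>square_scalar\<close>.\<close>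

lemma expansion:
  assumes "x \<in> carrier FG"
  shows "\<exists>r h y. square_scalar r \<and> square_scalar h \<and> y \<in> carrier FG
    \<and> x = r \<oplus>\<^bsub>FG\<^esub> h \<otimes>\<^bsub>FG\<^esub> t \<oplus>\<^bsub>FG\<^esub> t \<otimes>\<^bsub>FG\<^esub> t \<otimes>\<^bsub>FG\<^esub> y" (is "?P x")
  using assms
proof (induction rule: FG_induct)
  have t: "t \<in> carrier FG" by (rule t_closed)
  case (add u v)
  then obtain r h y r' h' y' where
    s: "square_scalar r" "square_scalar h" "square_scalar r'" "square_scalar h'"
    and y: "y \<in> carrier FG" "y' \<in> carrier FG"
    and u: "u = r \<oplus>\<^bsub>FG\<^esub> h \<otimes>\<^bsub>FG\<^esub> t \<oplus>\<^bsub>FG\<^esub> t \<otimes>\<^bsub>FG\<^esub> t \<otimes>\<^bsub>FG\<^esub> y"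
    and v: "v = r' \<oplus>\<^bsub>FG\<^esub> h' \<otimes>\<^bsub>FG\<^esub> t \<oplus>\<^bsub>FG\<^esub> t \<otimes>\<^bsub>FG\<^esub> t \<otimes>\<^bsub>FG\<^esub> y'"
    by blast
  have c: "r \<in> carrier FG" "h \<in> carrier FG" "r' \<in> carrier FG" "h' \<in> carrier FG"
    using s by (simp_all add: square_scalar_def)
  have "u \<oplus>\<^bsub>FG\<^esub> v = (r \<oplus>\<^bsub>FG\<^esub> r') \<oplus>\<^bsub>FG\<^esub> (h \<oplus>\<^bsub>FG\<^esub> h') \<otimes>\<^bsub>FG\<^esub> t \<oplus>\<^bsub>FG\<^esub> t \<otimes>\<^bsub>FG\<^esub> t \<otimes>\<^bsub>FG\<^esub> (y \<oplus>\<^bsub>FG\<^esub> y')"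
    unfolding u v using c y t by (simp add: R.l_distr R.r_distr R.a_ac)
  then show ?case
    using square_scalar_add[OF s(1,3)] square_scalar_add[OF s(2,4)] R.a_closed[OF y] by blast
next
  have t: "t \<in> carrier FG" by (rule t_closed)
  have a: "single \<one> a = \<one>\<^bsub>FG\<^esub> \<oplus>\<^bsub>FG\<^esub> t"
    by (simp add: t_def)
  case (single c g)
  then obtain y i where y: "y \<in> carrier G" "y \<otimes>\<^bsub>G\<^esub> y = \<one>\<^bsub>G\<^esub>" and g: "g = y \<otimes>\<^bsub>G\<^esub> a [^]\<^bsub>G\<^esub> (i::nat)"
    using split by blast
  have "?P (single c (y \<otimes>\<^bsub>G\<^esub> a [^]\<^bsub>G\<^esub> i))"
  proof (induction i)
    case 0
    have "square_scalar \<zero>\<^bsub>FG\<^esub>"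
      using square_scalar_single[of \<zero> "\<one>\<^bsub>G\<^esub>"] by (simp add: single_zero)
    moreover have "single c y = single c y \<oplus>\<^bsub>FG\<^esub> \<zero>\<^bsub>FG\<^esub> \<otimes>\<^bsub>FG\<^esub> t \<oplus>\<^bsub>FG\<^esub> t \<otimes>\<^bsub>FG\<^esub> t \<otimes>\<^bsub>FG\<^esub> \<zero>\<^bsub>FG\<^esub>"
      using single t by simp
    ultimately have "?P (single c y)"
      using square_scalar_single[OF single(1) y] R.zero_closed by blast
    then show ?case using y by simp
  next
    case (Suc i)
    then obtain r h w where s: "square_scalar r" "square_scalar h" and w: "w \<in> carrier FG"
      and x: "single c (y \<otimes>\<^bsub>G\<^esub> a [^]\<^bsub>G\<^esub> i) = r \<oplus>\<^bsub>FG\<^esub> h \<otimes>\<^bsub>FG\<^esub> t \<oplus>\<^bsub>FG\<^esub> t \<otimes>\<^bsub>FG\<^esub> t \<otimes>\<^bsub>FG\<^esub> w"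
      by blast
    have c: "r \<in> carrier FG" "h \<in> carrier FG"
      using s by (simp_all add: square_scalar_def)
    have "single c (y \<otimes>\<^bsub>G\<^esub> a [^]\<^bsub>G\<^esub> Suc i) = single c (y \<otimes>\<^bsub>G\<^esub> a [^]\<^bsub>G\<^esub> i) \<otimes>\<^bsub>FG\<^esub> single \<one> a"
      using single y by (simp add: single_mult G.m_assoc)
    \<comment> \<open>Multiplication by 1 + t adds the constant coefficient to the linear one and
      pushes the rest into the multiple of t^2.\<close>
    also have "\<dots> = r \<oplus>\<^bsub>FG\<^esub> (r \<oplus>\<^bsub>FG\<^esub> h) \<otimes>\<^bsub>FG\<^esub> t \<oplus>\<^bsub>FG\<^esub> t \<otimes>\<^bsub>FG\<^esub> t \<otimes>\<^bsub>FG\<^esub> (h \<oplus>\<^bsub>FG\<^esub> w \<oplus>\<^bsub>FG\<^esub> t \<otimes>\<^bsub>FG\<^esub> w)"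
      unfolding x a using c w t by (simp add: R.char2_simps)
    finally show ?case
      using s(1) square_scalar_add[OF s] c w t by (meson R.a_closed R.m_closed)
  qed
  then show ?case by (simp only: g)
qed

sublocale N: norm_setting FG star F aug \<iota> \<mu> t e
proof
  show "\<one> \<oplus> \<one> = \<zero>" by (rule char2_F)
  show "\<exists>r h y. r \<in> carrier FG \<and> h \<in> carrier FG \<and> y \<in> carrier FG
      \<and> star r = r \<and> r \<otimes>\<^bsub>FG\<^esub> r = \<iota> (aug r \<otimes> aug r)
      \<and> star h = h \<and> h \<otimes>\<^bsub>FG\<^esub> h = \<iota> (aug h \<otimes> aug h)
      \<and> x = r \<oplus>\<^bsub>FG\<^esub> h \<otimes>\<^bsub>FG\<^esub> t \<oplus>\<^bsub>FG\<^esub> t \<otimes>\<^bsub>FG\<^esub> t \<otimes>\<^bsub>FG\<^esub> y" if "x \<in> carrier FG" for x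
    using expansion[OF that] unfolding square_scalar_def by blast
  show "aug t = \<zero>"
    by (simp add: t_def aug_add one_FG_single aug_single)
  have "\<chi> a = \<one>" using a_pow' by (simp add: \<chi>_def)
  moreover have "\<chi> \<one>\<^bsub>G\<^esub> = \<zero>" by (rule chi_involution) auto
  ultimately show "\<mu> t = \<one>"
    by (simp add: t_def mu_add one_FG_single mu_single)
qed (simp_all add: finite_FG finite_F aug_add aug_mult aug_star iota_add iota_mult iota_one
    star_iota aug_iota mu_add mu_mult norm_t t_nilpotent mu_symmetric)

section \<open>Symmetric elements and the annihilator of 1 + z\<close>

lemma card_FG: "card (carrier FG) = card (carrier F) ^ card (carrier G)"
  using finite_carrier by (simp add: carrier_FG card_PiE)

lemma card_symmetric:
  shows "even (card (carrier G) + card {x \<in> carrier G. inv\<^bsub>G\<^esub> x = x})"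
    and "card N.symmetric
      = card (carrier F) ^ ((card (carrier G) + card {x \<in> carrier G. inv\<^bsub>G\<^esub> x = x}) div 2)"
proof -
  have "N.symmetric = {u \<in> carrier G \<rightarrow>\<^sub>E carrier F. \<forall>x\<in>carrier G. u (inv\<^bsub>G\<^esub> x) = u x}"
    unfolding N.symmetric_def carrier_FG[symmetric]
  proof (intro Collect_cong conj_cong refl iffI ballI)
    fix u x assume "star u = u" "x \<in> carrier G"
    then show "u (inv\<^bsub>G\<^esub> x) = u x" by (metis star_FG)
  next
    fix u assume "u \<in> carrier FG" "\<forall>x\<in>carrier G. u (inv\<^bsub>G\<^esub> x) = u x"
    then show "star u = u" by (intro FG_eqI) auto
  qed
  then show "card N.symmetric
      = card (carrier F) ^ ((card (carrier G) + card {x \<in> carrier G. inv\<^bsub>G\<^esub> x = x}) div 2)"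
    using card_functions_invariant(2)[OF finite_carrier, of "\<lambda>x. inv\<^bsub>G\<^esub> x" "carrier F"] by simp
  show "even (card (carrier G) + card {x \<in> carrier G. inv\<^bsub>G\<^esub> x = x})"
    using card_functions_invariant(1)[OF finite_carrier, of "\<lambda>x. inv\<^bsub>G\<^esub> x"] by simp
qed

lemma mult_single_one:
  assumes "u \<in> carrier FG" "g \<in> carrier G" "x \<in> carrier G"
  shows "(u \<otimes>\<^bsub>FG\<^esub> single \<one> g) x = u (x \<otimes>\<^bsub>G\<^esub> inv\<^bsub>G\<^esub> g)"
proof -
  have "inv\<^bsub>G\<^esub> y \<otimes>\<^bsub>G\<^esub> x = g \<longleftrightarrow> y = x \<otimes>\<^bsub>G\<^esub> inv\<^bsub>G\<^esub> g" if "y \<in> carrier G" for y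
    using assms that by (metis G.inv_solve_left' G.inv_solve_right G.inv_closed)
  then have "(u \<otimes>\<^bsub>FG\<^esub> single \<one> g) x
      = (\<Oplus>y\<in>carrier G. if y = x \<otimes>\<^bsub>G\<^esub> inv\<^bsub>G\<^esub> g then u y else \<zero>)"
    unfolding mult_FG[OF assms(3)] using assms by (intro finsum_cong') auto
  also have "\<dots> = u (x \<otimes>\<^bsub>G\<^esub> inv\<^bsub>G\<^esub> g)"
    using assms by (intro finsum_delta) auto
  finally show ?thesis .
qed

text \<open>The sum of the elements of the subgroup {1, z}; its annihilator consists of the
  functions constant on the cosets of that subgroup.\<close>

definition trace_z where "trace_z = \<one>\<^bsub>FG\<^esub> \<oplus>\<^bsub>FG\<^esub> single \<one> z"

lemma trace_z_closed [simp]: "trace_z \<in> carrier FG"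
  by (simp add: trace_z_def)

lemma inv_z: "inv\<^bsub>G\<^esub> z = z"
  by (rule G.inv_equality) (simp_all add: z_mult_z)

lemma mult_trace_z:
  assumes "u \<in> carrier FG" "x \<in> carrier G"
  shows "(u \<otimes>\<^bsub>FG\<^esub> trace_z) x = u x \<oplus> u (x \<otimes>\<^bsub>G\<^esub> z)"
  using assms by (simp add: trace_z_def R.r_distr mult_single_one inv_z)

lemma trace_z_nonzero: "trace_z \<noteq> \<zero>\<^bsub>FG\<^esub>"
proof
  assume "trace_z = \<zero>\<^bsub>FG\<^esub>"
  then have "trace_z \<one>\<^bsub>G\<^esub> = \<zero>" by simp
  then show False
    using a_pow' by (simp add: trace_z_def one_FG)
qed

lemma annihilator_trace_z:
  assumes "u \<in> carrier FG"
  shows "u \<otimes>\<^bsub>FG\<^esub> trace_z = \<zero>\<^bsub>FG\<^esub> \<longleftrightarrow> (\<forall>x\<in>carrier G. u (x \<otimes>\<^bsub>G\<^esub> z) = u x)"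
proof -
  have "u \<otimes>\<^bsub>FG\<^esub> trace_z = \<zero>\<^bsub>FG\<^esub> \<longleftrightarrow> (\<forall>x\<in>carrier G. (u \<otimes>\<^bsub>FG\<^esub> trace_z) x = \<zero>)"
    using FG_eqI[of "u \<otimes>\<^bsub>FG\<^esub> trace_z" "\<zero>\<^bsub>FG\<^esub>"] assms by auto
  also have "\<dots> \<longleftrightarrow> (\<forall>x\<in>carrier G. u (x \<otimes>\<^bsub>G\<^esub> z) = u x)"
    using assms by (intro ball_cong refl) (auto simp: mult_trace_z F.add_eq_zero_iff)
  finally show ?thesis .
qed

lemma translate_z:
  assumes "x \<in> carrier G"
  shows "x \<otimes>\<^bsub>G\<^esub> z \<otimes>\<^bsub>G\<^esub> z = x" "x \<otimes>\<^bsub>G\<^esub> z \<noteq> x"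
  using assms a_pow' by (simp_all add: G.m_assoc z_mult_z)

text \<open>Translation by z is an involution without fixed points, so an annihilated element has
  one free coefficient for every two group elements.\<close>

lemma card_annihilator:
  shows "even (card (carrier G))"
    and "card {u \<in> carrier FG. u \<otimes>\<^bsub>FG\<^esub> trace_z = \<zero>\<^bsub>FG\<^esub>} = card (carrier F) ^ (card (carrier G) div 2)"
proof -
  have no_fix: "{x \<in> carrier G. x \<otimes>\<^bsub>G\<^esub> z = x} = {}"
    using translate_z by blast
  have "{u \<in> carrier FG. u \<otimes>\<^bsub>FG\<^esub> trace_z = \<zero>\<^bsub>FG\<^esub>}
      = {u \<in> carrier G \<rightarrow>\<^sub>E carrier F. \<forall>x\<in>carrier G. u (x \<otimes>\<^bsub>G\<^esub> z) = u x}"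
    unfolding carrier_FG[symmetric] by (intro Collect_cong conj_cong refl annihilator_trace_z)
  then show "card {u \<in> carrier FG. u \<otimes>\<^bsub>FG\<^esub> trace_z = \<zero>\<^bsub>FG\<^esub>} = card (carrier F) ^ (card (carrier G) div 2)"
    using card_functions_invariant(2)[OF finite_carrier, of "\<lambda>x. x \<otimes>\<^bsub>G\<^esub> z" "carrier F"] no_fix
    by (simp add: translate_z)
  show "even (card (carrier G))"
    using card_functions_invariant(1)[OF finite_carrier, of "\<lambda>x. x \<otimes>\<^bsub>G\<^esub> z"] no_fix
    by (simp add: translate_z)
qed

text \<open>The coefficient at x sums u(y) u(inverse of x times y) over y. Replacing y by y z does
  not change the summand and fixes no y, so the terms cancel in pairs.\<close>

lemma norm_annihilator:
  assumes u: "u \<in> carrier FG" and ann: "u \<otimes>\<^bsub>FG\<^esub> trace_z = \<zero>\<^bsub>FG\<^esub>"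
  shows "u \<otimes>\<^bsub>FG\<^esub> star u = \<zero>\<^bsub>FG\<^esub>"
proof (rule FG_eqI)
  fix x assume x: "x \<in> carrier G"
  have inv: "u (y \<otimes>\<^bsub>G\<^esub> z) = u y" if "y \<in> carrier G" for y
    using annihilator_trace_z[OF u] ann that by blast
  have "(u \<otimes>\<^bsub>FG\<^esub> star u) x = (\<Oplus>y\<in>carrier G. u y \<otimes> u (inv\<^bsub>G\<^esub> x \<otimes>\<^bsub>G\<^esub> y))"
    unfolding mult_FG[OF x] using u x by (intro finsum_cong') (auto simp: G.inv_mult_group)
  also have "\<dots> = (\<Oplus>y\<in>{y \<in> carrier G. y \<otimes>\<^bsub>G\<^esub> z = y}. u y \<otimes> u (inv\<^bsub>G\<^esub> x \<otimes>\<^bsub>G\<^esub> y))"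
  proof (rule finsum_invariant_char2)
    fix y assume y: "y \<in> carrier G"
    have "u (inv\<^bsub>G\<^esub> x \<otimes>\<^bsub>G\<^esub> (y \<otimes>\<^bsub>G\<^esub> z)) = u (inv\<^bsub>G\<^esub> x \<otimes>\<^bsub>G\<^esub> y)"
      using inv[of "inv\<^bsub>G\<^esub> x \<otimes>\<^bsub>G\<^esub> y"] x y by (simp add: G.m_assoc)
    then show "u (y \<otimes>\<^bsub>G\<^esub> z) \<otimes> u (inv\<^bsub>G\<^esub> x \<otimes>\<^bsub>G\<^esub> (y \<otimes>\<^bsub>G\<^esub> z)) = u y \<otimes> u (inv\<^bsub>G\<^esub> x \<otimes>\<^bsub>G\<^esub> y)"
      by (simp only: inv[OF y])
  qed (use u x finite_carrier translate_z in auto)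
  also have "{y \<in> carrier G. y \<otimes>\<^bsub>G\<^esub> z = y} = {}"
    using translate_z by blast
  finally show "(u \<otimes>\<^bsub>FG\<^esub> star u) x = \<zero>\<^bsub>FG\<^esub> x"
    using x by (simp add: finsum_empty)
qed (use u in auto)

end

section \<open>Extensions by an inverting element\<close>

text \<open>A predicate on the group alone, separate from the field, so that it can be established
  for the two presentations, extended by E and transported along an isomorphism. The alternative for
  the square of b lets both families be treated together.\<close>

definition inversion_split :: "('g, 'x) monoid_scheme \<Rightarrow> 'g set \<Rightarrow> 'g \<Rightarrow> 'g \<Rightarrow> nat \<Rightarrow> bool" where
  "inversion_split G A a b e \<longleftrightarrow>
     subgroup A G \<and> a \<in> A \<and> b \<in> carrier G \<and> b \<notin> A \<and>
     (\<forall>g\<in>carrier G. g \<in> A \<or> g \<otimes>\<^bsub>G\<^esub> inv\<^bsub>G\<^esub> b \<in> A) \<and>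
     (\<forall>g\<in>A. inv\<^bsub>G\<^esub> b \<otimes>\<^bsub>G\<^esub> g \<otimes>\<^bsub>G\<^esub> b = inv\<^bsub>G\<^esub> g) \<and>
     b \<otimes>\<^bsub>G\<^esub> b \<in> {\<one>\<^bsub>G\<^esub>, a [^]\<^bsub>G\<^esub> (2 ^ (e - 1) :: nat)} \<and>
     a [^]\<^bsub>G\<^esub> (2 ^ e :: nat) = \<one>\<^bsub>G\<^esub> \<and> a [^]\<^bsub>G\<^esub> (2 ^ (e - 1) :: nat) \<noteq> \<one>\<^bsub>G\<^esub> \<and>
     (\<forall>g\<in>A. \<exists>y\<in>A. \<exists>i::nat. y \<otimes>\<^bsub>G\<^esub> y = \<one>\<^bsub>G\<^esub> \<and> g = y \<otimes>\<^bsub>G\<^esub> a [^]\<^bsub>G\<^esub> i)"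

locale inversion_extension = finite_group_algebra F G
  for F (structure) and G +
  fixes A a b and e :: nat
  assumes finite_F: "finite (carrier F)" and char2_F: "\<one> \<oplus> \<one> = \<zero>"
    and e: "2 \<le> e"
    and inversion_split: "inversion_split G A a b e"
begin

lemma A: "subgroup A G"
  and a_A: "a \<in> A"
  and b_closed [simp]: "b \<in> carrier G"
  and b_notin: "b \<notin> A"
  and coset_cases: "g \<in> carrier G \<Longrightarrow> g \<in> A \<or> g \<otimes>\<^bsub>G\<^esub> inv\<^bsub>G\<^esub> b \<in> A"
  and conj_b: "g \<in> A \<Longrightarrow> inv\<^bsub>G\<^esub> b \<otimes>\<^bsub>G\<^esub> g \<otimes>\<^bsub>G\<^esub> b = inv\<^bsub>G\<^esub> g"
  and b_square: "b \<otimes>\<^bsub>G\<^esub> b = \<one>\<^bsub>G\<^esub> \<or> b \<otimes>\<^bsub>G\<^esub> b = a [^]\<^bsub>G\<^esub> (2 ^ (e - 1) :: nat)"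
  using inversion_split unfolding inversion_split_def by blast+

lemma A_carrier [simp]: "g \<in> A \<Longrightarrow> g \<in> carrier G"
  by (rule subgroup.mem_carrier[OF A])

lemma A_mult [simp]: "g \<in> A \<Longrightarrow> h \<in> A \<Longrightarrow> g \<otimes>\<^bsub>G\<^esub> h \<in> A"
  by (rule subgroup.m_closed[OF A])

lemma A_inv [simp]: "g \<in> A \<Longrightarrow> inv\<^bsub>G\<^esub> g \<in> A"
  by (rule subgroup.m_inv_closed[OF A])

lemma A_one [simp]: "\<one>\<^bsub>G\<^esub> \<in> A"
  by (rule subgroup.one_closed[OF A])

lemma cancel_left [simp]:
  assumes "g \<in> carrier G" "x \<in> carrier G"
  shows "g \<otimes>\<^bsub>G\<^esub> (inv\<^bsub>G\<^esub> g \<otimes>\<^bsub>G\<^esub> x) = x" "inv\<^bsub>G\<^esub> g \<otimes>\<^bsub>G\<^esub> (g \<otimes>\<^bsub>G\<^esub> x) = x"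
  using assms by (simp_all add: G.m_assoc[symmetric])

abbreviation H where "H \<equiv> G\<lparr>carrier := A\<rparr>"

lemma inv_H [simp]: "g \<in> A \<Longrightarrow> inv\<^bsub>H\<^esub> g = inv\<^bsub>G\<^esub> g"
  by (rule G.m_inv_consistent[OF A])

text \<open>Conjugation by b is an endomorphism and acts on A as inversion; a group on which
  inversion is multiplicative is abelian.\<close>

lemma A_comm:
  assumes "g \<in> A" "h \<in> A"
  shows "g \<otimes>\<^bsub>G\<^esub> h = h \<otimes>\<^bsub>G\<^esub> g"
proof -
  have "inv\<^bsub>G\<^esub> (h \<otimes>\<^bsub>G\<^esub> g) = inv\<^bsub>G\<^esub> g \<otimes>\<^bsub>G\<^esub> inv\<^bsub>G\<^esub> h"
    using assms by (simp add: G.inv_mult_group)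
  also have "\<dots> = (inv\<^bsub>G\<^esub> b \<otimes>\<^bsub>G\<^esub> g \<otimes>\<^bsub>G\<^esub> b) \<otimes>\<^bsub>G\<^esub> (inv\<^bsub>G\<^esub> b \<otimes>\<^bsub>G\<^esub> h \<otimes>\<^bsub>G\<^esub> b)"
    by (simp only: conj_b assms)
  also have "\<dots> = inv\<^bsub>G\<^esub> b \<otimes>\<^bsub>G\<^esub> (g \<otimes>\<^bsub>G\<^esub> h) \<otimes>\<^bsub>G\<^esub> b"
    using assms by (simp add: G.m_assoc)
  also have "\<dots> = inv\<^bsub>G\<^esub> (g \<otimes>\<^bsub>G\<^esub> h)"
    using assms by (intro conj_b) simp
  finally show ?thesis
    using assms by (metis A_carrier A_mult G.inv_inv)
qed

sublocale H: abelian_2_group_algebra F H a e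
proof (intro abelian_2_group_algebra.intro finite_group_algebra.intro)
  show "group H" by (rule G.subgroup_imp_group[OF A])
  then show "comm_group H"
    by (rule group.group_comm_groupI) (simp add: A_comm)
  show "finite_group_algebra_axioms H"
    by unfold_locales (use finite_subset[OF subgroup.subset[OF A] finite_carrier] in simp)
  show "abelian_2_group_algebra_axioms F H a e"
  proof
    have s: "a [^]\<^bsub>G\<^esub> (2 ^ e :: nat) = \<one>\<^bsub>G\<^esub>" "a [^]\<^bsub>G\<^esub> (2 ^ (e - 1) :: nat) \<noteq> \<one>\<^bsub>G\<^esub>"
      "\<And>g. g \<in> A \<Longrightarrow> \<exists>y\<in>A. \<exists>i::nat. y \<otimes>\<^bsub>G\<^esub> y = \<one>\<^bsub>G\<^esub> \<and> g = y \<otimes>\<^bsub>G\<^esub> a [^]\<^bsub>G\<^esub> i"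
      using inversion_split unfolding inversion_split_def by blast+
    show "a [^]\<^bsub>H\<^esub> (2 ^ e :: nat) = \<one>\<^bsub>H\<^esub>"
      using s(1) by (simp flip: G.nat_pow_consistent)
    show "a [^]\<^bsub>H\<^esub> (2 ^ (e - 1) :: nat) \<noteq> \<one>\<^bsub>H\<^esub>"
      using s(2) by (simp flip: G.nat_pow_consistent)
    show "\<exists>y\<in>carrier H. \<exists>i::nat. y \<otimes>\<^bsub>H\<^esub> y = \<one>\<^bsub>H\<^esub> \<and> g = y \<otimes>\<^bsub>H\<^esub> a [^]\<^bsub>H\<^esub> i" if "g \<in> carrier H" for g
      using s(3)[of g] that by (simp flip: G.nat_pow_consistent)
  qed (use a_A e finite_F char2_F in simp_all)
qed (rule F.field_axioms)

lemma z_G: "H.z = a [^]\<^bsub>G\<^esub> (2 ^ (e - 1) :: nat)"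
  by (simp add: H.M_def flip: G.nat_pow_consistent)

lemma z_A: "H.z \<in> A"
  using H.G.nat_pow_closed[OF H.a_closed] by simp

lemma b_square_cases: "b \<otimes>\<^bsub>G\<^esub> b = \<one>\<^bsub>G\<^esub> \<or> b \<otimes>\<^bsub>G\<^esub> b = H.z"
  using b_square by (simp only: z_G)

lemma carrier_H: "carrier H = A"
  by simp

lemma b_square_A: "b \<otimes>\<^bsub>G\<^esub> b \<in> A"
  using b_square_cases z_A by auto

lemma b_square_inv: "inv\<^bsub>G\<^esub> (b \<otimes>\<^bsub>G\<^esub> b) = b \<otimes>\<^bsub>G\<^esub> b"
  using b_square_cases H.inv_z z_A by auto

lemma inv_b: "inv\<^bsub>G\<^esub> b = b \<otimes>\<^bsub>G\<^esub> b \<otimes>\<^bsub>G\<^esub> b"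
proof -
  have "inv\<^bsub>G\<^esub> b = inv\<^bsub>G\<^esub> (b \<otimes>\<^bsub>G\<^esub> b) \<otimes>\<^bsub>G\<^esub> b"
    by (simp add: G.inv_mult_group G.m_assoc)
  then show ?thesis by (simp only: b_square_inv)
qed

lemma inv_b_commute:
  assumes "k \<in> A"
  shows "inv\<^bsub>G\<^esub> b \<otimes>\<^bsub>G\<^esub> k = inv\<^bsub>G\<^esub> k \<otimes>\<^bsub>G\<^esub> (b \<otimes>\<^bsub>G\<^esub> b) \<otimes>\<^bsub>G\<^esub> b"
proof -
  have "inv\<^bsub>G\<^esub> b \<otimes>\<^bsub>G\<^esub> k = (inv\<^bsub>G\<^esub> b \<otimes>\<^bsub>G\<^esub> k \<otimes>\<^bsub>G\<^esub> b) \<otimes>\<^bsub>G\<^esub> inv\<^bsub>G\<^esub> b"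
    using assms by (simp add: G.m_assoc)
  also have "\<dots> = inv\<^bsub>G\<^esub> k \<otimes>\<^bsub>G\<^esub> inv\<^bsub>G\<^esub> b"
    by (simp only: conj_b[OF assms])
  also have "\<dots> = inv\<^bsub>G\<^esub> k \<otimes>\<^bsub>G\<^esub> (b \<otimes>\<^bsub>G\<^esub> b \<otimes>\<^bsub>G\<^esub> b)"
    by (simp only: inv_b)
  finally show ?thesis
    using assms by (simp add: G.m_assoc)
qed

lemma coset_notin: "g \<in> A \<Longrightarrow> g \<otimes>\<^bsub>G\<^esub> b \<notin> A"
proof
  assume g: "g \<in> A" "g \<otimes>\<^bsub>G\<^esub> b \<in> A"
  then have "inv\<^bsub>G\<^esub> g \<otimes>\<^bsub>G\<^esub> (g \<otimes>\<^bsub>G\<^esub> b) \<in> A" by (simp only: A_mult A_inv)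
  then show False using g(1) b_notin by simp
qed

lemma carrier_split:
  shows "carrier G = A \<union> (\<lambda>g. g \<otimes>\<^bsub>G\<^esub> b) ` A" and "A \<inter> (\<lambda>g. g \<otimes>\<^bsub>G\<^esub> b) ` A = {}"
proof -
  have "g \<in> (\<lambda>g. g \<otimes>\<^bsub>G\<^esub> b) ` A" if "g \<in> carrier G" "g \<notin> A" for g
    using coset_cases[OF that(1)] that
    by (intro image_eqI[of _ _ "g \<otimes>\<^bsub>G\<^esub> inv\<^bsub>G\<^esub> b"]) (auto simp: G.m_assoc)
  then show "carrier G = A \<union> (\<lambda>g. g \<otimes>\<^bsub>G\<^esub> b) ` A" by auto
  show "A \<inter> (\<lambda>g. g \<otimes>\<^bsub>G\<^esub> b) ` A = {}" using coset_notin by blast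
qed

lemma inj_b: "inj_on (\<lambda>g. g \<otimes>\<^bsub>G\<^esub> b) A"
  by (rule inj_onI) simp

lemma finite_A: "finite A"
  using H.finite_carrier by simp

lemma order_G: "order G = 2 * card A"
proof -
  have "card (carrier G) = card (A \<union> (\<lambda>g. g \<otimes>\<^bsub>G\<^esub> b) ` A)"
    by (rule arg_cong[OF carrier_split(1)])
  also have "\<dots> = card A + card A"
    using finite_A carrier_split(2) by (simp add: card_Un_disjoint card_image[OF inj_b])
  finally show ?thesis by (simp add: order_def)
qed

text \<open>As b inverts g, the product g b equals b times the inverse of g, and the two copies of g
  cancel. So either all elements of the coset A b are involutions or none is.\<close>

lemma coset_square:
  assumes "g \<in> A"
  shows "(g \<otimes>\<^bsub>G\<^esub> b) \<otimes>\<^bsub>G\<^esub> (g \<otimes>\<^bsub>G\<^esub> b) = b \<otimes>\<^bsub>G\<^esub> b"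
proof -
  have "b \<otimes>\<^bsub>G\<^esub> (inv\<^bsub>G\<^esub> b \<otimes>\<^bsub>G\<^esub> g \<otimes>\<^bsub>G\<^esub> b) = b \<otimes>\<^bsub>G\<^esub> inv\<^bsub>G\<^esub> g"
    by (simp only: conj_b[OF assms])
  then have gb: "g \<otimes>\<^bsub>G\<^esub> b = b \<otimes>\<^bsub>G\<^esub> inv\<^bsub>G\<^esub> g"
    using assms by (simp add: G.m_assoc[symmetric])
  have "(g \<otimes>\<^bsub>G\<^esub> b) \<otimes>\<^bsub>G\<^esub> (g \<otimes>\<^bsub>G\<^esub> b) = (b \<otimes>\<^bsub>G\<^esub> inv\<^bsub>G\<^esub> g) \<otimes>\<^bsub>G\<^esub> (g \<otimes>\<^bsub>G\<^esub> b)"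
    by (simp only: gb)
  also have "\<dots> = b \<otimes>\<^bsub>G\<^esub> (inv\<^bsub>G\<^esub> g \<otimes>\<^bsub>G\<^esub> g \<otimes>\<^bsub>G\<^esub> b)"
    using assms by (simp only: G.m_assoc A_carrier A_inv b_closed G.m_closed)
  finally show ?thesis
    using assms by simp
qed

abbreviation involutions_A where
  "involutions_A \<equiv> {x \<in> carrier H. inv\<^bsub>H\<^esub> x = x}"

lemma involutions_A: "involutions_A = {x \<in> A. x \<otimes>\<^bsub>G\<^esub> x = \<one>\<^bsub>G\<^esub>}"
proof (intro Collect_cong)
  fix x
  show "x \<in> carrier H \<and> inv\<^bsub>H\<^esub> x = x \<longleftrightarrow> x \<in> A \<and> x \<otimes>\<^bsub>G\<^esub> x = \<one>\<^bsub>G\<^esub>"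
  proof (cases "x \<in> A")
    case True
    then have x: "x \<in> carrier G" by simp
    have "inv\<^bsub>G\<^esub> x = x \<longleftrightarrow> x \<otimes>\<^bsub>G\<^esub> x = \<one>\<^bsub>G\<^esub>"
      using G.inv_equality[OF _ x x] G.r_inv[OF x] by metis
    then show ?thesis using True by simp
  qed simp
qed

lemma involutions_with_one_square:
  "involutions_with_one G = {x \<in> carrier G. x \<otimes>\<^bsub>G\<^esub> x = \<one>\<^bsub>G\<^esub>}"
  unfolding involutions_with_one_def
  by (intro Collect_cong conj_cong refl) (simp add: numeral_2_eq_2)

lemma card_involutions:
  "card (involutions_with_one G) = card involutions_A + (if b \<otimes>\<^bsub>G\<^esub> b = \<one>\<^bsub>G\<^esub> then card A else 0)"
proof -
  have "x \<in> involutions_with_one G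
      \<longleftrightarrow> x \<in> involutions_A \<or> (b \<otimes>\<^bsub>G\<^esub> b = \<one>\<^bsub>G\<^esub> \<and> x \<in> (\<lambda>g. g \<otimes>\<^bsub>G\<^esub> b) ` A)" for x
  proof (cases "x \<in> A")
    case True
    then have "x \<notin> (\<lambda>g. g \<otimes>\<^bsub>G\<^esub> b) ` A" using carrier_split(2) by blast
    then show ?thesis
      using True unfolding involutions_A involutions_with_one_square by simp
  next
    case F: False
    show ?thesis
    proof (cases "x \<in> carrier G")
      case True
      then have "x \<in> (\<lambda>g. g \<otimes>\<^bsub>G\<^esub> b) ` A" using F carrier_split(1) by blast
      moreover from this have "x \<otimes>\<^bsub>G\<^esub> x = b \<otimes>\<^bsub>G\<^esub> b" using coset_square by blast
      ultimately show ?thesis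
        using F True unfolding involutions_A involutions_with_one_square by simp
    next
      case False
      then have "x \<notin> (\<lambda>g. g \<otimes>\<^bsub>G\<^esub> b) ` A" using carrier_split(1) by blast
      then show ?thesis
        using F False unfolding involutions_A involutions_with_one_square by simp
    qed
  qed
  then have eq: "involutions_with_one G
      = involutions_A \<union> (if b \<otimes>\<^bsub>G\<^esub> b = \<one>\<^bsub>G\<^esub> then (\<lambda>g. g \<otimes>\<^bsub>G\<^esub> b) ` A else {})"
    by auto
  have "involutions_A \<inter> (\<lambda>g. g \<otimes>\<^bsub>G\<^esub> b) ` A = {}"
    using carrier_split(2) unfolding involutions_A by blast
  moreover have "finite involutions_A"
    unfolding involutions_A using finite_A by simp
  ultimately show ?thesis
    unfolding eq using finite_A
    by (simp add: card_Un_disjoint card_image[OF inj_b] del: partial_object.select_convs partial_object.update_convs)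
qed

section \<open>The norm in terms of the two cosets of A\<close>

lemma finsum_split:
  assumes "f \<in> carrier G \<rightarrow> carrier F"
  shows "(\<Oplus>g\<in>carrier G. f g) = (\<Oplus>g\<in>A. f g) \<oplus> (\<Oplus>g\<in>A. f (g \<otimes>\<^bsub>G\<^esub> b))"
proof -
  have "(\<Oplus>g\<in>carrier G. f g) = (\<Oplus>g\<in>A \<union> (\<lambda>g. g \<otimes>\<^bsub>G\<^esub> b) ` A. f g)"
    by (rule arg_cong[OF carrier_split(1)])
  also have "\<dots> = (\<Oplus>g\<in>A. f g) \<oplus> (\<Oplus>g\<in>(\<lambda>g. g \<otimes>\<^bsub>G\<^esub> b) ` A. f g)"
    using assms finite_A carrier_split(2) by (intro finsum_Un_disjoint) auto
  also have "(\<Oplus>g\<in>(\<lambda>g. g \<otimes>\<^bsub>G\<^esub> b) ` A. f g) = (\<Oplus>g\<in>A. f (g \<otimes>\<^bsub>G\<^esub> b))"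
    using assms by (intro finsum_reindex inj_b) auto
  finally show ?thesis .
qed

abbreviation FH where "FH \<equiv> group_algebra F H"

text \<open>The components x and y of u = x + y b; the coefficient of y at g is the one of u at g
  b.\<close>

definition even_part where "even_part u = restrict u A"

definition odd_part where "odd_part u = (\<lambda>g\<in>A. u (g \<otimes>\<^bsub>G\<^esub> b))"

lemma parts_closed [simp]:
  assumes "u \<in> carrier FG"
  shows "even_part u \<in> carrier FH" "odd_part u \<in> carrier FH"
  unfolding even_part_def odd_part_def H.carrier_FG carrier_H restrict_PiE_iff
  using FG_coeff[OF assms] by simp_all

lemma bij_betw_parts:
  "bij_betw (\<lambda>u. (even_part u, odd_part u)) (carrier FG) (carrier FH \<times> carrier FH)"
proof (rule bij_betw_byWitness[where
      f' = "\<lambda>(x, y). \<lambda>g\<in>carrier G. if g \<in> A then x g else y (g \<otimes>\<^bsub>G\<^esub> inv\<^bsub>G\<^esub> b)"])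
  let ?J = "\<lambda>(x, y). \<lambda>g\<in>carrier G. if g \<in> A then x g else y (g \<otimes>\<^bsub>G\<^esub> inv\<^bsub>G\<^esub> b)"
  have J: "?J (x, y) \<in> carrier FG" if "x \<in> carrier FH" "y \<in> carrier FH" for x y
    unfolding carrier_FG prod.case restrict_PiE_iff
    using H.FG_coeff[OF that(1)] H.FG_coeff[OF that(2)] coset_cases by auto
  show "?J ` (carrier FH \<times> carrier FH) \<subseteq> carrier FG"
    using J by blast
  show "(\<lambda>u. (even_part u, odd_part u)) ` carrier FG \<subseteq> carrier FH \<times> carrier FH"
    by auto
  show "\<forall>u\<in>carrier FG. ?J (even_part u, odd_part u) = u"
  proof
    fix u assume u: "u \<in> carrier FG"
    show "?J (even_part u, odd_part u) = u"
    proof (rule FG_eqI)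
      fix g assume g: "g \<in> carrier G"
      then show "?J (even_part u, odd_part u) g = u g"
        using coset_cases[OF g] by (auto simp: even_part_def odd_part_def G.m_assoc)
    qed (use u J in auto)
  qed
  show "\<forall>p\<in>carrier FH \<times> carrier FH. (even_part (?J p), odd_part (?J p)) = p"
  proof
    fix p assume "p \<in> carrier FH \<times> carrier FH"
    then obtain x y where p: "p = (x, y)" and xy: "x \<in> carrier FH" "y \<in> carrier FH" by blast
    have "even_part (?J (x, y)) = x"
      by (rule H.FG_eqI) (use parts_closed(1)[OF J[OF xy]] xy in \<open>auto simp: even_part_def\<close>)
    moreover have "odd_part (?J (x, y)) = y"
      by (rule H.FG_eqI) (use parts_closed(2)[OF J[OF xy]] xy in \<open>auto simp: odd_part_def coset_notin G.m_assoc\<close>)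
    ultimately show "(even_part (?J p), odd_part (?J p)) = p" by (simp add: p)
  qed
qed

lemma mult_FH:
  assumes "u \<in> carrier FH" "v \<in> carrier FH" "x \<in> A"
  shows "(u \<otimes>\<^bsub>FH\<^esub> v) x = (\<Oplus>y\<in>A. u y \<otimes> v (inv\<^bsub>G\<^esub> y \<otimes>\<^bsub>G\<^esub> x))"
proof -
  have "(u \<otimes>\<^bsub>FH\<^esub> v) x = (\<Oplus>y\<in>carrier H. u y \<otimes> v (inv\<^bsub>H\<^esub> y \<otimes>\<^bsub>H\<^esub> x))"
    using assms(3) by (intro H.mult_FG) simp
  also have "\<dots> = (\<Oplus>y\<in>A. u y \<otimes> v (inv\<^bsub>G\<^esub> y \<otimes>\<^bsub>G\<^esub> x))"
    using H.FG_coeff[OF assms(1)] H.FG_coeff[OF assms(2)] assms(3)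
    by (intro finsum_cong') (simp_all add: Pi_def)
  finally show ?thesis .
qed

lemma norm_FH:
  assumes "u \<in> carrier FH" "x \<in> A"
  shows "(u \<otimes>\<^bsub>FH\<^esub> H.star u) x = (\<Oplus>y\<in>A. u y \<otimes> u (inv\<^bsub>G\<^esub> x \<otimes>\<^bsub>G\<^esub> y))"
proof -
  have "(u \<otimes>\<^bsub>FH\<^esub> H.star u) x = (\<Oplus>y\<in>A. u y \<otimes> H.star u (inv\<^bsub>G\<^esub> y \<otimes>\<^bsub>G\<^esub> x))"
    using assms by (intro mult_FH) auto
  also have "\<dots> = (\<Oplus>y\<in>A. u y \<otimes> u (inv\<^bsub>G\<^esub> x \<otimes>\<^bsub>G\<^esub> y))"
    using H.FG_coeff[OF assms(1)] assms(2)
    by (intro finsum_cong') (simp_all add: Pi_def classical_involution_def G.inv_mult_group)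
  finally show ?thesis .
qed

lemma norm_FG:
  assumes u: "u \<in> carrier FG" and h: "h \<in> carrier G"
  shows "(u \<otimes>\<^bsub>FG\<^esub> star u) h
    = (\<Oplus>g\<in>A. u g \<otimes> u (inv\<^bsub>G\<^esub> h \<otimes>\<^bsub>G\<^esub> g))
      \<oplus> (\<Oplus>g\<in>A. u (g \<otimes>\<^bsub>G\<^esub> b) \<otimes> u (inv\<^bsub>G\<^esub> h \<otimes>\<^bsub>G\<^esub> (g \<otimes>\<^bsub>G\<^esub> b)))"
proof -
  have "(u \<otimes>\<^bsub>FG\<^esub> star u) h = (\<Oplus>g\<in>carrier G. u g \<otimes> u (inv\<^bsub>G\<^esub> h \<otimes>\<^bsub>G\<^esub> g))"
    unfolding mult_FG[OF h] using u h by (intro finsum_cong') (auto simp: G.inv_mult_group)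
  also have "\<dots> = (\<Oplus>g\<in>A. u g \<otimes> u (inv\<^bsub>G\<^esub> h \<otimes>\<^bsub>G\<^esub> g))
      \<oplus> (\<Oplus>g\<in>A. u (g \<otimes>\<^bsub>G\<^esub> b) \<otimes> u (inv\<^bsub>G\<^esub> h \<otimes>\<^bsub>G\<^esub> (g \<otimes>\<^bsub>G\<^esub> b)))"
    using u h by (intro finsum_split) auto
  finally show ?thesis .
qed

lemma norm_even:
  assumes u: "u \<in> carrier FG" and h: "h \<in> A"
  shows "(u \<otimes>\<^bsub>FG\<^esub> star u) h
    = (even_part u \<otimes>\<^bsub>FH\<^esub> H.star (even_part u) \<oplus>\<^bsub>FH\<^esub> odd_part u \<otimes>\<^bsub>FH\<^esub> H.star (odd_part u)) h"
proof -
  have "(\<Oplus>g\<in>A. u g \<otimes> u (inv\<^bsub>G\<^esub> h \<otimes>\<^bsub>G\<^esub> g)) = (even_part u \<otimes>\<^bsub>FH\<^esub> H.star (even_part u)) h"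
    unfolding norm_FH[OF parts_closed(1)[OF u] h]
    using u h by (intro finsum_cong') (auto simp: even_part_def)
  moreover have "(\<Oplus>g\<in>A. u (g \<otimes>\<^bsub>G\<^esub> b) \<otimes> u (inv\<^bsub>G\<^esub> h \<otimes>\<^bsub>G\<^esub> (g \<otimes>\<^bsub>G\<^esub> b)))
      = (odd_part u \<otimes>\<^bsub>FH\<^esub> H.star (odd_part u)) h"
    unfolding norm_FH[OF parts_closed(2)[OF u] h]
    using u h by (intro finsum_cong') (auto simp: odd_part_def G.m_assoc)
  ultimately show ?thesis
    using norm_FG[OF u A_carrier[OF h]] h by simp
qed

text \<open>Moving b past an element of FA applies \<open>star\<close>. Hence x times the conjugate
  of y b is x y times the inverse of b, and y b times \<open>star x\<close> is y x b. As the inverse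
  of b is b^3, the odd component of the norm is x y (1 + b^2).\<close>

lemma norm_odd:
  assumes u: "u \<in> carrier FG" and h: "h \<in> A"
  shows "(u \<otimes>\<^bsub>FG\<^esub> star u) (h \<otimes>\<^bsub>G\<^esub> b)
    = (even_part u \<otimes>\<^bsub>FH\<^esub> odd_part u) (h \<otimes>\<^bsub>G\<^esub> (b \<otimes>\<^bsub>G\<^esub> b))
      \<oplus> (even_part u \<otimes>\<^bsub>FH\<^esub> odd_part u) h"
proof -
  let ?c = "b \<otimes>\<^bsub>G\<^esub> b"
  have inv_hb: "inv\<^bsub>G\<^esub> (h \<otimes>\<^bsub>G\<^esub> b) \<otimes>\<^bsub>G\<^esub> k = inv\<^bsub>G\<^esub> b \<otimes>\<^bsub>G\<^esub> (inv\<^bsub>G\<^esub> h \<otimes>\<^bsub>G\<^esub> k)" if "k \<in> carrier G" for k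
    using h that by (simp add: G.inv_mult_group G.m_assoc)
  have inv_hg: "inv\<^bsub>G\<^esub> (inv\<^bsub>G\<^esub> h \<otimes>\<^bsub>G\<^esub> g) = inv\<^bsub>G\<^esub> g \<otimes>\<^bsub>G\<^esub> h" if "g \<in> A" for g
    using h that by (simp add: G.inv_mult_group)
  have 1: "inv\<^bsub>G\<^esub> (h \<otimes>\<^bsub>G\<^esub> b) \<otimes>\<^bsub>G\<^esub> g = inv\<^bsub>G\<^esub> g \<otimes>\<^bsub>G\<^esub> (h \<otimes>\<^bsub>G\<^esub> ?c) \<otimes>\<^bsub>G\<^esub> b" if g: "g \<in> A" for g
  proof -
    have "inv\<^bsub>G\<^esub> (h \<otimes>\<^bsub>G\<^esub> b) \<otimes>\<^bsub>G\<^esub> g = inv\<^bsub>G\<^esub> (inv\<^bsub>G\<^esub> h \<otimes>\<^bsub>G\<^esub> g) \<otimes>\<^bsub>G\<^esub> ?c \<otimes>\<^bsub>G\<^esub> b"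
      unfolding inv_hb[OF A_carrier[OF g]] using g h by (intro inv_b_commute) simp
    also have "\<dots> = inv\<^bsub>G\<^esub> g \<otimes>\<^bsub>G\<^esub> h \<otimes>\<^bsub>G\<^esub> ?c \<otimes>\<^bsub>G\<^esub> b"
      by (simp only: inv_hg[OF g])
    finally show ?thesis
      using g h by (simp add: G.m_assoc)
  qed
  have 2: "inv\<^bsub>G\<^esub> (h \<otimes>\<^bsub>G\<^esub> b) \<otimes>\<^bsub>G\<^esub> (g \<otimes>\<^bsub>G\<^esub> b) = inv\<^bsub>G\<^esub> g \<otimes>\<^bsub>G\<^esub> h" if g: "g \<in> A" for g
  proof -
    have "inv\<^bsub>G\<^esub> (h \<otimes>\<^bsub>G\<^esub> b) \<otimes>\<^bsub>G\<^esub> (g \<otimes>\<^bsub>G\<^esub> b) = inv\<^bsub>G\<^esub> b \<otimes>\<^bsub>G\<^esub> (inv\<^bsub>G\<^esub> h \<otimes>\<^bsub>G\<^esub> g) \<otimes>\<^bsub>G\<^esub> b"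
      using g h by (simp add: G.inv_mult_group G.m_assoc)
    also have "\<dots> = inv\<^bsub>G\<^esub> (inv\<^bsub>G\<^esub> h \<otimes>\<^bsub>G\<^esub> g)"
      using g h by (intro conj_b) simp
    finally show ?thesis by (simp only: inv_hg[OF g])
  qed
  have "(\<Oplus>g\<in>A. u g \<otimes> u (inv\<^bsub>G\<^esub> (h \<otimes>\<^bsub>G\<^esub> b) \<otimes>\<^bsub>G\<^esub> g)) = (even_part u \<otimes>\<^bsub>FH\<^esub> odd_part u) (h \<otimes>\<^bsub>G\<^esub> ?c)"
    unfolding mult_FH[OF parts_closed[OF u] A_mult[OF h b_square_A]]
    using u h b_square_A by (intro finsum_cong') (auto simp: even_part_def odd_part_def 1)
  moreover have "(\<Oplus>g\<in>A. u (g \<otimes>\<^bsub>G\<^esub> b) \<otimes> u (inv\<^bsub>G\<^esub> (h \<otimes>\<^bsub>G\<^esub> b) \<otimes>\<^bsub>G\<^esub> (g \<otimes>\<^bsub>G\<^esub> b)))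
      = (odd_part u \<otimes>\<^bsub>FH\<^esub> even_part u) h"
    unfolding mult_FH[OF parts_closed(2,1)[OF u] h]
    using u h by (intro finsum_cong') (auto simp: even_part_def odd_part_def 2)
  moreover have "odd_part u \<otimes>\<^bsub>FH\<^esub> even_part u = even_part u \<otimes>\<^bsub>FH\<^esub> odd_part u"
    using u by (intro H.R.m_comm) auto
  ultimately show ?thesis
    using norm_FG[OF u, of "h \<otimes>\<^bsub>G\<^esub> b"] h by simp
qed

text \<open>The pointwise second condition serves both families: it is vacuous for b^2 = 1, and for
  b^2 = z it says that x y is annihilated by 1 + z.\<close>

lemma unitary_iff:
  assumes u: "u \<in> carrier FG"
  shows "u \<otimes>\<^bsub>FG\<^esub> star u = \<one>\<^bsub>FG\<^esub> \<longleftrightarrow>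
    even_part u \<otimes>\<^bsub>FH\<^esub> H.star (even_part u) \<oplus>\<^bsub>FH\<^esub> odd_part u \<otimes>\<^bsub>FH\<^esub> H.star (odd_part u) = \<one>\<^bsub>FH\<^esub> \<and>
    (\<forall>h\<in>A. (even_part u \<otimes>\<^bsub>FH\<^esub> odd_part u) h
      = (even_part u \<otimes>\<^bsub>FH\<^esub> odd_part u) (h \<otimes>\<^bsub>G\<^esub> (b \<otimes>\<^bsub>G\<^esub> b)))"
proof -
  let ?u = "u \<otimes>\<^bsub>FG\<^esub> star u"
  let ?v = "even_part u \<otimes>\<^bsub>FH\<^esub> H.star (even_part u) \<oplus>\<^bsub>FH\<^esub> odd_part u \<otimes>\<^bsub>FH\<^esub> H.star (odd_part u)"
  let ?w = "even_part u \<otimes>\<^bsub>FH\<^esub> odd_part u"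
  have v: "?v \<in> carrier FH" and w: "?w \<in> carrier FH"
    using u by simp_all
  have one: "\<one>\<^bsub>FG\<^esub> h = \<one>\<^bsub>FH\<^esub> h" if "h \<in> A" for h
    using that by (simp add: group_algebra_def)
  have "?u = \<one>\<^bsub>FG\<^esub> \<longleftrightarrow> (\<forall>h\<in>carrier G. ?u h = \<one>\<^bsub>FG\<^esub> h)"
    using FG_eqI[of ?u "\<one>\<^bsub>FG\<^esub>"] u by auto
  also have "\<dots> \<longleftrightarrow> (\<forall>h\<in>A. ?u h = \<one>\<^bsub>FG\<^esub> h) \<and> (\<forall>h\<in>A. ?u (h \<otimes>\<^bsub>G\<^esub> b) = \<one>\<^bsub>FG\<^esub> (h \<otimes>\<^bsub>G\<^esub> b))"
    by (subst carrier_split(1)) blast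
  also have "(\<forall>h\<in>A. ?u h = \<one>\<^bsub>FG\<^esub> h) \<longleftrightarrow> (\<forall>h\<in>A. ?v h = \<one>\<^bsub>FH\<^esub> h)"
    by (intro ball_cong refl) (simp only: norm_even[OF u] one)
  also have "\<dots> \<longleftrightarrow> ?v = \<one>\<^bsub>FH\<^esub>"
    by (metis H.FG_eqI[OF v H.one_closed_FG] carrier_H)
  also have "(\<forall>h\<in>A. ?u (h \<otimes>\<^bsub>G\<^esub> b) = \<one>\<^bsub>FG\<^esub> (h \<otimes>\<^bsub>G\<^esub> b))
      \<longleftrightarrow> (\<forall>h\<in>A. ?w h = ?w (h \<otimes>\<^bsub>G\<^esub> (b \<otimes>\<^bsub>G\<^esub> b)))"
  proof (intro ball_cong refl)
    fix h assume h: "h \<in> A"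
    have "h \<otimes>\<^bsub>G\<^esub> b \<noteq> \<one>\<^bsub>G\<^esub>"
      using coset_notin[OF h] A_one by metis
    then have "\<one>\<^bsub>FG\<^esub> (h \<otimes>\<^bsub>G\<^esub> b) = \<zero>"
      using h by (simp add: one_FG)
    moreover have c: "?w h \<in> carrier F" "?w (h \<otimes>\<^bsub>G\<^esub> (b \<otimes>\<^bsub>G\<^esub> b)) \<in> carrier F"
      using h b_square_A H.FG_coeff[OF w] by simp_all
    ultimately show "?u (h \<otimes>\<^bsub>G\<^esub> b) = \<one>\<^bsub>FG\<^esub> (h \<otimes>\<^bsub>G\<^esub> b) \<longleftrightarrow> ?w h = ?w (h \<otimes>\<^bsub>G\<^esub> (b \<otimes>\<^bsub>G\<^esub> b))"
      using H.F.add_eq_zero_iff[OF c(2,1)] by (simp only: norm_odd[OF u h]) metis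
  qed
  finally show ?thesis .
qed

section \<open>The order of the unitary group of FG\<close>

lemma card_unitary_pairs:
  "card (unitary_normalized_units F G)
    = card {p \<in> carrier FH \<times> carrier FH.
        fst p \<otimes>\<^bsub>FH\<^esub> H.star (fst p) \<oplus>\<^bsub>FH\<^esub> snd p \<otimes>\<^bsub>FH\<^esub> H.star (snd p) = \<one>\<^bsub>FH\<^esub> \<and>
        (\<forall>h\<in>A. (fst p \<otimes>\<^bsub>FH\<^esub> snd p) h = (fst p \<otimes>\<^bsub>FH\<^esub> snd p) (h \<otimes>\<^bsub>G\<^esub> (b \<otimes>\<^bsub>G\<^esub> b)))}"
    (is "_ = card ?P")
proof -
  have "bij_betw (\<lambda>u. (even_part u, odd_part u)) {u \<in> carrier FG. u \<otimes>\<^bsub>FG\<^esub> star u = \<one>\<^bsub>FG\<^esub>} ?P"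
    unfolding bij_betw_def
  proof
    show "inj_on (\<lambda>u. (even_part u, odd_part u)) {u \<in> carrier FG. u \<otimes>\<^bsub>FG\<^esub> star u = \<one>\<^bsub>FG\<^esub>}"
      using bij_betw_imp_inj_on[OF bij_betw_parts] by (rule inj_on_subset) blast
    have "carrier FH \<times> carrier FH = (\<lambda>u. (even_part u, odd_part u)) ` carrier FG"
      using bij_betw_imp_surj_on[OF bij_betw_parts] by (rule sym)
    then show "(\<lambda>u. (even_part u, odd_part u)) ` {u \<in> carrier FG. u \<otimes>\<^bsub>FG\<^esub> star u = \<one>\<^bsub>FG\<^esub>} = ?P"
      by (simp only:) (auto simp only: unitary_iff fst_conv snd_conv image_iff mem_Collect_eq)
  qed
  then show ?thesis
    unfolding unitary_normalized_units_eq[OF finite_F char2_F] by (rule bij_betw_same_card)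
qed

lemma card_F_ge_2: "2 \<le> card (carrier F)"
proof -
  have "{\<zero>, \<one>} \<subseteq> carrier F" by simp
  then have "card {\<zero>, \<one>} \<le> card (carrier F)"
    using finite_F by (intro card_mono)
  then show ?thesis by simp
qed

lemma card_unitary_dihedral:
  assumes "b \<otimes>\<^bsub>G\<^esub> b = \<one>\<^bsub>G\<^esub>"
  shows "card (unitary_normalized_units F G)
    = card (carrier F) ^ ((order G + card (involutions_with_one G)) div 2 - 1)"
proof -
  let ?q = "card (carrier F)" and ?n = "card A" and ?i = "card involutions_A"
  have n: "0 < ?n" using finite_A A_one card_gt_0_iff[of A] by blast
  have "card (unitary_normalized_units F G)
    = card {p \<in> carrier FH \<times> carrier FH.
        fst p \<otimes>\<^bsub>FH\<^esub> H.star (fst p) \<oplus>\<^bsub>FH\<^esub> snd p \<otimes>\<^bsub>FH\<^esub> H.star (snd p) = \<one>\<^bsub>FH\<^esub>}"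
    unfolding card_unitary_pairs assms
    by (intro arg_cong[of _ _ card] Collect_cong) auto
  also have "\<dots> = card H.N.normalized * card H.N.symmetric"
    by (rule H.N.card_norm_sum_eq_one)
  also have "card H.N.normalized = ?q ^ (?n - 1)"
  proof -
    have "?q ^ ?n = ?q * card H.N.normalized"
      using H.N.card_normalized unfolding H.card_FG carrier_H .
    moreover have "?q ^ ?n = ?q * ?q ^ (?n - 1)"
      using n by (cases ?n) auto
    ultimately show ?thesis using card_F_ge_2 by simp
  qed
  also have "card H.N.symmetric = ?q ^ ((?n + ?i) div 2)"
    using H.card_symmetric(2) unfolding carrier_H .
  also have "?q ^ (?n - 1) * ?q ^ ((?n + ?i) div 2) = ?q ^ (?n - 1 + (?n + ?i) div 2)"
    by (simp only: power_add)
  \<comment> \<open>With n the order of A and i the number of its elements of square one, |G| = 2n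
    and G_T has n + i elements, as the coset A b consists of involutions.\<close>
  also have "?n - 1 + (?n + ?i) div 2 = (order G + card (involutions_with_one G)) div 2 - 1"
    using n unfolding order_G card_involutions if_P[OF assms] by arith
  finally show ?thesis .
qed

lemma card_unitary_quaternion:
  assumes "b \<otimes>\<^bsub>G\<^esub> b \<noteq> \<one>\<^bsub>G\<^esub>"
  shows "card (unitary_normalized_units F G)
    = 4 * card (carrier F) ^ ((order G + card (involutions_with_one G)) div 2 - 1)"
proof -
  let ?q = "card (carrier F)" and ?n = "card A" and ?i = "card involutions_A"
  have n: "0 < ?n" using finite_A A_one card_gt_0_iff[of A] by blast
  have ev: "even ?n" "even (?n + ?i)"
    using H.card_annihilator(1) H.card_symmetric(1) unfolding carrier_H .
  have z: "b \<otimes>\<^bsub>G\<^esub> b = H.z"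
    using b_square_cases assms by blast
  have "card (unitary_normalized_units F G)
    = card {p \<in> carrier FH \<times> carrier FH.
        fst p \<otimes>\<^bsub>FH\<^esub> H.star (fst p) \<oplus>\<^bsub>FH\<^esub> snd p \<otimes>\<^bsub>FH\<^esub> H.star (snd p) = \<one>\<^bsub>FH\<^esub>
        \<and> fst p \<otimes>\<^bsub>FH\<^esub> snd p \<otimes>\<^bsub>FH\<^esub> H.trace_z = \<zero>\<^bsub>FH\<^esub>}"
    unfolding card_unitary_pairs z
  proof (intro arg_cong[of _ _ card] Collect_cong conj_cong refl)
    fix p assume "p \<in> carrier FH \<times> carrier FH"
    then have "fst p \<otimes>\<^bsub>FH\<^esub> snd p \<in> carrier FH" by auto
    from H.annihilator_trace_z[OF this]
    show "(\<forall>h\<in>A. (fst p \<otimes>\<^bsub>FH\<^esub> snd p) h = (fst p \<otimes>\<^bsub>FH\<^esub> snd p) (h \<otimes>\<^bsub>G\<^esub> H.z))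
        \<longleftrightarrow> fst p \<otimes>\<^bsub>FH\<^esub> snd p \<otimes>\<^bsub>FH\<^esub> H.trace_z = \<zero>\<^bsub>FH\<^esub>"
      by (auto simp: eq_commute)
  qed
  also have "\<dots> = 2 * (card H.N.unitary * card {y \<in> carrier FH. y \<otimes>\<^bsub>FH\<^esub> H.trace_z = \<zero>\<^bsub>FH\<^esub>})"
    by (rule H.N.card_norm_sum_eq_one_annihilated[OF H.trace_z_closed H.trace_z_nonzero H.norm_annihilator])
  also have "card {y \<in> carrier FH. y \<otimes>\<^bsub>FH\<^esub> H.trace_z = \<zero>\<^bsub>FH\<^esub>} = ?q ^ (?n div 2)"
    using H.card_annihilator(2) unfolding carrier_H .
  also have "card H.N.unitary = 2 * ?q ^ ((?n + ?i) div 2 - 1)"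
  proof -
    have "0 < (?n + ?i) div 2" using n ev(1) by (auto elim!: evenE)
    then have q: "?q ^ ((?n + ?i) div 2) = ?q * ?q ^ ((?n + ?i) div 2 - 1)"
      by (cases "(?n + ?i) div 2") auto
    have "?q * card H.N.unitary = 2 * ?q ^ ((?n + ?i) div 2)"
      using H.N.card_unitary unfolding H.card_symmetric(2) carrier_H .
    also have "\<dots> = ?q * (2 * ?q ^ ((?n + ?i) div 2 - 1))"
      unfolding q by (rule mult.left_commute)
    finally have eq: "?q * card H.N.unitary = ?q * (2 * ?q ^ ((?n + ?i) div 2 - 1))" .
    have "?q \<noteq> 0" using card_F_ge_2 by linarith
    from iffD1[OF mult_left_cancel[OF this] eq] show ?thesis .
  qed
  also have "2 * (2 * ?q ^ ((?n + ?i) div 2 - 1) * ?q ^ (?n div 2))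
      = 4 * ?q ^ ((?n + ?i) div 2 - 1 + ?n div 2)"
    by (simp add: power_add)
  \<comment> \<open>No element of A b has square one, so G_T has i elements. Both n and i are even,
    so the two halves add up without rounding.\<close>
  also have "(?n + ?i) div 2 - 1 + ?n div 2 = (order G + card (involutions_with_one G)) div 2 - 1"
  proof -
    obtain j k where "?n = 2 * j" "?i = 2 * k" using ev by (auto elim!: evenE)
    with n show ?thesis
      unfolding order_G card_involutions if_not_P[OF assms] by simp
  qed
  finally show ?thesis .
qed

end

lemma inversion_split_iso:
  assumes G: "group G" and K: "group K" and f: "f \<in> iso G K" and split: "inversion_split G A a b e"
  shows "inversion_split K (f ` A) (f a) (f b) e"
proof -
  interpret group_hom G K f
    using G K f by (intro group_hom.intro group_hom_axioms.intro) (auto simp: iso_def)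
  have inj: "inj_on f (carrier G)" and surj: "f ` carrier G = carrier K"
    using f by (auto simp: iso_def bij_betw_def)
  have A: "subgroup A G" and a: "a \<in> A" and b: "b \<in> carrier G" "b \<notin> A"
    and cosets: "\<And>g. g \<in> carrier G \<Longrightarrow> g \<in> A \<or> g \<otimes>\<^bsub>G\<^esub> inv\<^bsub>G\<^esub> b \<in> A"
    and conj: "\<And>g. g \<in> A \<Longrightarrow> inv\<^bsub>G\<^esub> b \<otimes>\<^bsub>G\<^esub> g \<otimes>\<^bsub>G\<^esub> b = inv\<^bsub>G\<^esub> g"
    and sq: "b \<otimes>\<^bsub>G\<^esub> b = \<one>\<^bsub>G\<^esub> \<or> b \<otimes>\<^bsub>G\<^esub> b = a [^]\<^bsub>G\<^esub> (2 ^ (e - 1) :: nat)"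
    and pow: "a [^]\<^bsub>G\<^esub> (2 ^ e :: nat) = \<one>\<^bsub>G\<^esub>" "a [^]\<^bsub>G\<^esub> (2 ^ (e - 1) :: nat) \<noteq> \<one>\<^bsub>G\<^esub>"
    and gen: "\<And>g. g \<in> A \<Longrightarrow> \<exists>y\<in>A. \<exists>i::nat. y \<otimes>\<^bsub>G\<^esub> y = \<one>\<^bsub>G\<^esub> \<and> g = y \<otimes>\<^bsub>G\<^esub> a [^]\<^bsub>G\<^esub> i"
    using split unfolding inversion_split_def by blast+
  have sub: "g \<in> carrier G" if "g \<in> A" for g
    using subgroup.mem_carrier[OF A that] .
  show ?thesis
    unfolding inversion_split_def
  proof (intro conjI ballI)
    show "subgroup (f ` A) K" by (rule subgroup_img_is_subgroup[OF A])
    show "f a \<in> f ` A" using a by blast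
    show "f b \<in> carrier K" using b by simp
    show "f b \<notin> f ` A"
      using inj_on_image_mem_iff[OF inj b(1) subgroup.subset[OF A]] b(2) by blast
    show "f b \<otimes>\<^bsub>K\<^esub> f b \<in> {\<one>\<^bsub>K\<^esub>, f a [^]\<^bsub>K\<^esub> (2 ^ (e - 1) :: nat)}"
      using sq hom_mult[OF b(1) b(1)] hom_one hom_nat_pow[OF sub[OF a]] by (metis insertCI)
    show "f a [^]\<^bsub>K\<^esub> (2 ^ e :: nat) = \<one>\<^bsub>K\<^esub>"
      using hom_nat_pow[OF sub[OF a], of "2 ^ e"] pow(1) hom_one by metis
    have "f (a [^]\<^bsub>G\<^esub> (2 ^ (e - 1) :: nat)) \<noteq> f \<one>\<^bsub>G\<^esub>"
      using pow(2) inj_onD[OF inj] sub[OF a] by blast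
    then show "f a [^]\<^bsub>K\<^esub> (2 ^ (e - 1) :: nat) \<noteq> \<one>\<^bsub>K\<^esub>"
      by (simp only: hom_nat_pow[OF sub[OF a]] hom_one not_False_eq_True)
  next
    fix k assume "k \<in> carrier K"
    then obtain g where g: "g \<in> carrier G" "k = f g" using surj by blast
    have "k \<otimes>\<^bsub>K\<^esub> inv\<^bsub>K\<^esub> f b = f (g \<otimes>\<^bsub>G\<^esub> inv\<^bsub>G\<^esub> b)"
      using g b by simp
    then show "k \<in> f ` A \<or> k \<otimes>\<^bsub>K\<^esub> inv\<^bsub>K\<^esub> f b \<in> f ` A"
      using cosets[OF g(1)] g(2) by auto
  next
    fix k assume "k \<in> f ` A"
    then obtain g where g: "g \<in> A" "k = f g" by blast
    have "inv\<^bsub>K\<^esub> f b \<otimes>\<^bsub>K\<^esub> k \<otimes>\<^bsub>K\<^esub> f b = f (inv\<^bsub>G\<^esub> b \<otimes>\<^bsub>G\<^esub> g \<otimes>\<^bsub>G\<^esub> b)"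
      using g b sub by simp
    also have "\<dots> = inv\<^bsub>K\<^esub> k"
      unfolding conj[OF g(1)] using g sub by simp
    finally show "inv\<^bsub>K\<^esub> f b \<otimes>\<^bsub>K\<^esub> k \<otimes>\<^bsub>K\<^esub> f b = inv\<^bsub>K\<^esub> k" .
  next
    fix k assume "k \<in> f ` A"
    then obtain g where g: "g \<in> A" "k = f g" by blast
    then obtain y i where y: "y \<in> A" "y \<otimes>\<^bsub>G\<^esub> y = \<one>\<^bsub>G\<^esub>" "g = y \<otimes>\<^bsub>G\<^esub> a [^]\<^bsub>G\<^esub> (i::nat)"
      using gen by blast
    have "f y \<otimes>\<^bsub>K\<^esub> f y = \<one>\<^bsub>K\<^esub>"
      using hom_mult[of y y] y sub by simp
    moreover have "k = f y \<otimes>\<^bsub>K\<^esub> f a [^]\<^bsub>K\<^esub> i"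
      using y sub a hom_nat_pow[of a i] by (simp add: g)
    ultimately show "\<exists>y\<in>f ` A. \<exists>i::nat. y \<otimes>\<^bsub>K\<^esub> y = \<one>\<^bsub>K\<^esub> \<and> k = y \<otimes>\<^bsub>K\<^esub> f a [^]\<^bsub>K\<^esub> i"
      using y(1) by blast
  qed
qed

section \<open>Dihedral and quaternion groups\<close>

text \<open>The union of A and A b is closed under the operations and contains the generators, so
  the group has at most 2 |A| elements. Its prescribed order then forces \<open>a\<close> to have
  order exactly 2^(m - 1), not a proper divisor, and keeps b out of A.\<close>

lemma inversion_split_of_presentation:
  assumes D: "group D" "order D = 2 ^ m" and m: "m > 2"
    and a: "a \<in> carrier D" and b: "b \<in> carrier D"
    and gen: "generate D {a, b} = carrier D"
    and a_pow: "a [^]\<^bsub>D\<^esub> ((2::nat) ^ (m - 1)) = \<one>\<^bsub>D\<^esub>"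
    and b_pow: "b [^]\<^bsub>D\<^esub> (2::nat) \<in> {\<one>\<^bsub>D\<^esub>, a [^]\<^bsub>D\<^esub> ((2::nat) ^ (m - 2))}"
    and conj: "inv\<^bsub>D\<^esub> b \<otimes>\<^bsub>D\<^esub> a \<otimes>\<^bsub>D\<^esub> b = inv\<^bsub>D\<^esub> a"
  shows "inversion_split D (generate D {a}) a b (m - 1)"
proof -
  interpret group D by fact
  define A where "A = generate D {a}"
  have fin: "finite (carrier D)"
    using D(2) by (intro card_ge_0_finite) (simp add: order_def)
  have A_eq: "A = {a [^]\<^bsub>D\<^esub> k |k. k \<in> (UNIV :: nat set)}"
    unfolding A_def by (rule generate_pow_on_finite_carrier[OF fin a])
  have A: "subgroup A D"
    unfolding A_def using a by (intro generate_is_subgroup) simp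
  have sub: "g \<in> carrier D" if "g \<in> A" for g
    by (rule subgroup.mem_carrier[OF A that])
  note A_mult = subgroup.m_closed[OF A] and A_inv = subgroup.m_inv_closed[OF A]
  have cancel: "g \<otimes>\<^bsub>D\<^esub> (inv\<^bsub>D\<^esub> g \<otimes>\<^bsub>D\<^esub> x) = x" "inv\<^bsub>D\<^esub> g \<otimes>\<^bsub>D\<^esub> (g \<otimes>\<^bsub>D\<^esub> x) = x"
    if "g \<in> carrier D" "x \<in> carrier D" for g x
    using that by (simp_all add: m_assoc[symmetric])
  have "inv\<^bsub>D\<^esub> b \<otimes>\<^bsub>D\<^esub> a [^]\<^bsub>D\<^esub> (k::nat) \<otimes>\<^bsub>D\<^esub> b = inv\<^bsub>D\<^esub> (a [^]\<^bsub>D\<^esub> k)" for k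
  proof (induction k)
    case 0
    then show ?case using b by simp
  next
    case (Suc k)
    have "inv\<^bsub>D\<^esub> b \<otimes>\<^bsub>D\<^esub> a [^]\<^bsub>D\<^esub> Suc k \<otimes>\<^bsub>D\<^esub> b
        = (inv\<^bsub>D\<^esub> b \<otimes>\<^bsub>D\<^esub> a [^]\<^bsub>D\<^esub> k \<otimes>\<^bsub>D\<^esub> b) \<otimes>\<^bsub>D\<^esub> (inv\<^bsub>D\<^esub> b \<otimes>\<^bsub>D\<^esub> a \<otimes>\<^bsub>D\<^esub> b)"
      using a b by (simp add: m_assoc cancel)
    also have "\<dots> = inv\<^bsub>D\<^esub> (a [^]\<^bsub>D\<^esub> k) \<otimes>\<^bsub>D\<^esub> inv\<^bsub>D\<^esub> a"
      by (simp only: Suc.IH conj)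
    also have "\<dots> = inv\<^bsub>D\<^esub> (a \<otimes>\<^bsub>D\<^esub> a [^]\<^bsub>D\<^esub> k)"
      using a by (simp add: inv_mult_group)
    also have "a \<otimes>\<^bsub>D\<^esub> a [^]\<^bsub>D\<^esub> k = a [^]\<^bsub>D\<^esub> Suc k"
      using nat_pow_Suc2[OF a] by (rule sym)
    finally show ?case .
  qed
  then have conj_A: "inv\<^bsub>D\<^esub> b \<otimes>\<^bsub>D\<^esub> g \<otimes>\<^bsub>D\<^esub> b = inv\<^bsub>D\<^esub> g" if "g \<in> A" for g
    using that unfolding A_eq by blast
  have bb: "b \<otimes>\<^bsub>D\<^esub> b \<in> {\<one>\<^bsub>D\<^esub>, a [^]\<^bsub>D\<^esub> (2 ^ (m - 2) :: nat)}"
    using b_pow b by (simp add: numeral_2_eq_2)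
  then have bb_A: "b \<otimes>\<^bsub>D\<^esub> b \<in> A"
    unfolding A_eq by (metis (mono_tags, lifting) UNIV_I insertE mem_Collect_eq nat_pow_0 singletonD)
  have comm: "b \<otimes>\<^bsub>D\<^esub> h = inv\<^bsub>D\<^esub> h \<otimes>\<^bsub>D\<^esub> b" if h: "h \<in> A" for h
  proof -
    have "inv\<^bsub>D\<^esub> b \<otimes>\<^bsub>D\<^esub> inv\<^bsub>D\<^esub> h \<otimes>\<^bsub>D\<^esub> b = h"
      using conj_A[OF A_inv[OF h]] sub[OF h] by simp
    then have "b \<otimes>\<^bsub>D\<^esub> (inv\<^bsub>D\<^esub> b \<otimes>\<^bsub>D\<^esub> inv\<^bsub>D\<^esub> h \<otimes>\<^bsub>D\<^esub> b) = b \<otimes>\<^bsub>D\<^esub> h" by (simp only:)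
    then show ?thesis
      using b sub[OF h] by (simp add: m_assoc cancel)
  qed
  let ?S = "A \<union> (\<lambda>g. g \<otimes>\<^bsub>D\<^esub> b) ` A"
  have "subgroup ?S D"
  proof (rule subgroupI)
    show "?S \<subseteq> carrier D" using sub b by auto
    show "?S \<noteq> {}" using subgroup.one_closed[OF A] by blast
  next
    fix x assume "x \<in> ?S"
    then show "inv\<^bsub>D\<^esub> x \<in> ?S"
    proof
      assume "x \<in> (\<lambda>g. g \<otimes>\<^bsub>D\<^esub> b) ` A"
      then obtain g where g: "g \<in> A" "x = g \<otimes>\<^bsub>D\<^esub> b" by blast
      have h: "inv\<^bsub>D\<^esub> (b \<otimes>\<^bsub>D\<^esub> b) \<otimes>\<^bsub>D\<^esub> g \<in> A"
        using A_mult[OF A_inv[OF bb_A] g(1)] .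
      have "inv\<^bsub>D\<^esub> x = inv\<^bsub>D\<^esub> (b \<otimes>\<^bsub>D\<^esub> b) \<otimes>\<^bsub>D\<^esub> (b \<otimes>\<^bsub>D\<^esub> inv\<^bsub>D\<^esub> g)"
        using g b sub[OF g(1)] by (simp add: inv_mult_group m_assoc cancel)
      also have "\<dots> = inv\<^bsub>D\<^esub> (b \<otimes>\<^bsub>D\<^esub> b) \<otimes>\<^bsub>D\<^esub> g \<otimes>\<^bsub>D\<^esub> b"
        unfolding comm[OF A_inv[OF g(1)]] using b sub[OF g(1)] by (simp add: m_assoc)
      finally show ?thesis using h by blast
    qed (use A_inv in blast)
  next
    fix x y assume x: "x \<in> ?S" and y: "y \<in> ?S"
    obtain g where g: "g \<in> A" "x = g \<or> x = g \<otimes>\<^bsub>D\<^esub> b" using x by blast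
    obtain h where h: "h \<in> A" "y = h \<or> y = h \<otimes>\<^bsub>D\<^esub> b" using y by blast
    note c = sub[OF g(1)] sub[OF h(1)] b
    have 1: "g \<otimes>\<^bsub>D\<^esub> (h \<otimes>\<^bsub>D\<^esub> b) = g \<otimes>\<^bsub>D\<^esub> h \<otimes>\<^bsub>D\<^esub> b"
      using c by (simp add: m_assoc)
    have 2: "g \<otimes>\<^bsub>D\<^esub> b \<otimes>\<^bsub>D\<^esub> h = g \<otimes>\<^bsub>D\<^esub> inv\<^bsub>D\<^esub> h \<otimes>\<^bsub>D\<^esub> b"
      using c comm[OF h(1)] by (simp add: m_assoc)
    have "g \<otimes>\<^bsub>D\<^esub> b \<otimes>\<^bsub>D\<^esub> (h \<otimes>\<^bsub>D\<^esub> b) = (g \<otimes>\<^bsub>D\<^esub> b \<otimes>\<^bsub>D\<^esub> h) \<otimes>\<^bsub>D\<^esub> b"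
      using c by (simp add: m_assoc)
    also have "\<dots> = g \<otimes>\<^bsub>D\<^esub> inv\<^bsub>D\<^esub> h \<otimes>\<^bsub>D\<^esub> (b \<otimes>\<^bsub>D\<^esub> b)"
      unfolding 2 using c by (simp add: m_assoc)
    finally have 3: "g \<otimes>\<^bsub>D\<^esub> b \<otimes>\<^bsub>D\<^esub> (h \<otimes>\<^bsub>D\<^esub> b) = g \<otimes>\<^bsub>D\<^esub> inv\<^bsub>D\<^esub> h \<otimes>\<^bsub>D\<^esub> (b \<otimes>\<^bsub>D\<^esub> b)" .
    have "g \<otimes>\<^bsub>D\<^esub> h \<in> A" "g \<otimes>\<^bsub>D\<^esub> inv\<^bsub>D\<^esub> h \<in> A" "g \<otimes>\<^bsub>D\<^esub> inv\<^bsub>D\<^esub> h \<otimes>\<^bsub>D\<^esub> (b \<otimes>\<^bsub>D\<^esub> b) \<in> A"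
      using g(1) h(1) bb_A by (simp_all only: A_mult A_inv)
    then show "x \<otimes>\<^bsub>D\<^esub> y \<in> ?S"
      using g(2) h(2) 1 2 3 by (elim disjE) (simp_all only: image_eqI Un_iff simp_thms)
  qed
  moreover have "a \<in> A"
    unfolding A_def by (rule generate.incl) simp
  moreover have "b \<in> ?S"
    using subgroup.one_closed[OF A] b by (metis UnI2 image_eqI l_one)
  ultimately have "generate D {a, b} \<subseteq> ?S"
    by (intro generate_subgroup_incl) simp_all
  then have carrier: "carrier D = ?S"
    unfolding gen using sub b by auto
  have finA: "finite A" using fin sub by (meson finite_subset subsetI)
  have "card (carrier D) \<le> card A + card ((\<lambda>g. g \<otimes>\<^bsub>D\<^esub> b) ` A)"
    by (subst carrier) (rule card_Un_le)
  also have "\<dots> \<le> 2 * card A"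
    using card_image_le[OF finA] by (simp add: mult_2)
  finally have le: "2 ^ m \<le> 2 * card A"
    using D(2) by (simp only: order_def)
  have ord: "card A = ord a"
    unfolding A_def by (rule generate_pow_card[OF a, symmetric])
  have dvd: "ord a dvd 2 ^ (m - 1)"
    using a_pow pow_eq_id[OF a] by blast
  have m': "(2::nat) ^ m = 2 * 2 ^ (m - 1)" "(2::nat) ^ (m - 1) = 2 * 2 ^ (m - 2)"
    using m by (simp_all flip: power_Suc)
  \<comment> \<open>The order of the group bounds \<open>ord a\<close> from below, the relation for
    \<open>a\<close> from above.\<close>
  have ord_a: "ord a = 2 ^ (m - 1)"
    using le dvd_imp_le[OF dvd] unfolding ord m' by simp
  have "b \<notin> A"
  proof
    assume "b \<in> A"
    then have "?S \<subseteq> A" using A_mult by blast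
    then have "carrier D \<subseteq> A" unfolding carrier[symmetric] .
    from card_mono[OF finA this] have "2 ^ m \<le> card A"
      using D(2) by (simp only: order_def)
    then show False unfolding ord ord_a m' by simp
  qed
  have "a [^]\<^bsub>D\<^esub> (2 ^ (m - 2) :: nat) \<noteq> \<one>\<^bsub>D\<^esub>"
  proof
    assume "a [^]\<^bsub>D\<^esub> (2 ^ (m - 2) :: nat) = \<one>\<^bsub>D\<^esub>"
    then have "ord a dvd 2 ^ (m - 2)" using pow_eq_id[OF a] by blast
    then have "ord a \<le> 2 ^ (m - 2)" by (rule dvd_imp_le) simp
    then show False unfolding ord_a m' by simp
  qed
  moreover have "g \<in> A \<or> g \<otimes>\<^bsub>D\<^esub> inv\<^bsub>D\<^esub> b \<in> A" if "g \<in> carrier D" for g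
  proof -
    have "g \<in> ?S" using that carrier by blast
    then show ?thesis
      using b sub by (auto simp: m_assoc)
  qed
  moreover have "\<exists>y\<in>A. \<exists>i::nat. y \<otimes>\<^bsub>D\<^esub> y = \<one>\<^bsub>D\<^esub> \<and> g = y \<otimes>\<^bsub>D\<^esub> a [^]\<^bsub>D\<^esub> i" if g: "g \<in> A" for g
  proof -
    obtain k :: nat where "g = a [^]\<^bsub>D\<^esub> k" using g A_eq by blast
    then have "\<one>\<^bsub>D\<^esub> \<otimes>\<^bsub>D\<^esub> \<one>\<^bsub>D\<^esub> = \<one>\<^bsub>D\<^esub> \<and> g = \<one>\<^bsub>D\<^esub> \<otimes>\<^bsub>D\<^esub> a [^]\<^bsub>D\<^esub> k"
      using a by simp
    then show ?thesis using subgroup.one_closed[OF A] by blast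
  qed
  moreover have "m - 1 - 1 = m - 2" by simp
  ultimately show ?thesis
    unfolding inversion_split_def A_def[symmetric]
    using A \<open>a \<in> A\<close> b \<open>b \<notin> A\<close> conj_A bb a_pow by (simp only:) blast
qed

section \<open>The direct factor E and the passage to G\<close>

lemma nat_pow_DirProd: "(x, y) [^]\<^bsub>D \<times>\<times> E\<^esub> (n::nat) = (x [^]\<^bsub>D\<^esub> n, y [^]\<^bsub>E\<^esub> n)"
  by (induction n) (simp_all add: nat_pow_def)

text \<open>Elements of E are their own inverses and commute with b, so b inverts them as well. In
  the splitting of an element of A x E its E-component joins the factor of square one.\<close>

lemma inversion_split_DirProd:
  assumes D: "group D" and E: "elementary_abelian_2_group E" and split: "inversion_split D A a b e"
  shows "inversion_split (D \<times>\<times> E) (A \<times> carrier E) (a, \<one>\<^bsub>E\<^esub>) (b, \<one>\<^bsub>E\<^esub>) e"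
proof -
  interpret D: group D by fact
  interpret E: comm_group E
    using E by (simp add: elementary_abelian_2_group_def)
  have sq: "y \<otimes>\<^bsub>E\<^esub> y = \<one>\<^bsub>E\<^esub>" if "y \<in> carrier E" for y
    using E that by (simp add: elementary_abelian_2_group_def numeral_2_eq_2)
  have E_inv: "inv\<^bsub>E\<^esub> y = y" if "y \<in> carrier E" for y
    using E.inv_equality[OF sq] that by blast
  have A: "subgroup A D" and a: "a \<in> A" and b: "b \<in> carrier D" "b \<notin> A"
    and cosets: "\<And>g. g \<in> carrier D \<Longrightarrow> g \<in> A \<or> g \<otimes>\<^bsub>D\<^esub> inv\<^bsub>D\<^esub> b \<in> A"
    and conj: "\<And>g. g \<in> A \<Longrightarrow> inv\<^bsub>D\<^esub> b \<otimes>\<^bsub>D\<^esub> g \<otimes>\<^bsub>D\<^esub> b = inv\<^bsub>D\<^esub> g"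
    and bb: "b \<otimes>\<^bsub>D\<^esub> b \<in> {\<one>\<^bsub>D\<^esub>, a [^]\<^bsub>D\<^esub> (2 ^ (e - 1) :: nat)}"
    and pow: "a [^]\<^bsub>D\<^esub> (2 ^ e :: nat) = \<one>\<^bsub>D\<^esub>" "a [^]\<^bsub>D\<^esub> (2 ^ (e - 1) :: nat) \<noteq> \<one>\<^bsub>D\<^esub>"
    and gen: "\<And>g. g \<in> A \<Longrightarrow> \<exists>y\<in>A. \<exists>i::nat. y \<otimes>\<^bsub>D\<^esub> y = \<one>\<^bsub>D\<^esub> \<and> g = y \<otimes>\<^bsub>D\<^esub> a [^]\<^bsub>D\<^esub> i"
    using split unfolding inversion_split_def by blast+
  have inv: "inv\<^bsub>D \<times>\<times> E\<^esub> (x, y) = (inv\<^bsub>D\<^esub> x, y)" if "x \<in> carrier D" "y \<in> carrier E" for x y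
    using inv_DirProd[OF D E.group_axioms that] E_inv[OF that(2)] by simp
  show ?thesis
    unfolding inversion_split_def
  proof (intro conjI ballI)
    show "subgroup (A \<times> carrier E) (D \<times>\<times> E)"
      by (rule DirProd_subgroups[OF D A E.group_axioms E.subgroup_self])
    show "(b, \<one>\<^bsub>E\<^esub>) \<otimes>\<^bsub>D \<times>\<times> E\<^esub> (b, \<one>\<^bsub>E\<^esub>)
        \<in> {\<one>\<^bsub>D \<times>\<times> E\<^esub>, (a, \<one>\<^bsub>E\<^esub>) [^]\<^bsub>D \<times>\<times> E\<^esub> (2 ^ (e - 1) :: nat)}"
      using bb by (simp add: nat_pow_DirProd)
  next
    fix g assume "g \<in> carrier (D \<times>\<times> E)"
    then obtain x y where g: "g = (x, y)" "x \<in> carrier D" "y \<in> carrier E" by auto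
    then show "g \<in> A \<times> carrier E \<or> g \<otimes>\<^bsub>D \<times>\<times> E\<^esub> inv\<^bsub>D \<times>\<times> E\<^esub> (b, \<one>\<^bsub>E\<^esub>) \<in> A \<times> carrier E"
      using cosets[OF g(2)] b by (simp add: inv)
  next
    fix g assume "g \<in> A \<times> carrier E"
    then obtain x y where g: "g = (x, y)" "x \<in> A" "y \<in> carrier E" by auto
    then show "inv\<^bsub>D \<times>\<times> E\<^esub> (b, \<one>\<^bsub>E\<^esub>) \<otimes>\<^bsub>D \<times>\<times> E\<^esub> g \<otimes>\<^bsub>D \<times>\<times> E\<^esub> (b, \<one>\<^bsub>E\<^esub>) = inv\<^bsub>D \<times>\<times> E\<^esub> g"
      using conj[OF g(2)] b subgroup.mem_carrier[OF A g(2)] by (simp add: inv E_inv)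
  next
    fix g assume "g \<in> A \<times> carrier E"
    then obtain x y where g: "g = (x, y)" "x \<in> A" "y \<in> carrier E" by auto
    then obtain w i where w: "w \<in> A" "w \<otimes>\<^bsub>D\<^esub> w = \<one>\<^bsub>D\<^esub>" "x = w \<otimes>\<^bsub>D\<^esub> a [^]\<^bsub>D\<^esub> (i::nat)"
      using gen by blast
    show "\<exists>y\<in>A \<times> carrier E. \<exists>i::nat. y \<otimes>\<^bsub>D \<times>\<times> E\<^esub> y = \<one>\<^bsub>D \<times>\<times> E\<^esub>
        \<and> g = y \<otimes>\<^bsub>D \<times>\<times> E\<^esub> (a, \<one>\<^bsub>E\<^esub>) [^]\<^bsub>D \<times>\<times> E\<^esub> i"
      by (rule bexI[of _ "(w, y)"], rule exI[of _ i]) (use w g sq in \<open>simp_all add: nat_pow_DirProd\<close>)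
  qed (use a b pow in \<open>simp_all add: nat_pow_DirProd\<close>)
qed

text \<open>The data in G are images under an isomorphism. The equivalence about the squares is kept
  because it decides which of the two counts applies.\<close>

lemma inversion_extension_of_product:
  fixes F :: "('f, 'u) ring_scheme" and G :: "('g, 'v) monoid_scheme"
  assumes split: "inversion_split D A a b e" and D: "group D" "finite (carrier D)" and e: "2 \<le> e"
    and E: "elementary_abelian_2_group E" "finite (carrier E)"
    and F: "field F" "finite (carrier F)" "has_characteristic F 2"
    and G: "group G" "G \<cong> D \<times>\<times> E"
  obtains A' a' b' where "inversion_extension F G A' a' b' e"
    and "b' \<otimes>\<^bsub>G\<^esub> b' = \<one>\<^bsub>G\<^esub> \<longleftrightarrow> b \<otimes>\<^bsub>D\<^esub> b = \<one>\<^bsub>D\<^esub>"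
proof -
  interpret F: field F by fact
  interpret E: comm_group E
    using E(1) by (simp add: elementary_abelian_2_group_def)
  have DE: "group (D \<times>\<times> E)" by (rule DirProd_group[OF D(1) E.group_axioms])
  obtain f where f: "f \<in> iso (D \<times>\<times> E) G"
    using group.iso_sym[OF G] by (auto simp: is_iso_def)
  interpret f: group_hom "D \<times>\<times> E" G f
    using DE G(1) f by (intro group_hom.intro group_hom_axioms.intro) (auto simp: iso_def)
  have inj: "inj_on f (carrier (D \<times>\<times> E))" and surj: "f ` carrier (D \<times>\<times> E) = carrier G"
    using f by (auto simp: iso_def bij_betw_def)
  have fin: "finite (carrier G)"
    unfolding surj[symmetric] using D(2) E(2) by simp
  have "add_pow F (2::nat) \<one>\<^bsub>F\<^esub> = \<zero>\<^bsub>F\<^esub>"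
    using F(3) by (simp add: has_characteristic_def)
  then have char2: "\<one>\<^bsub>F\<^esub> \<oplus>\<^bsub>F\<^esub> \<one>\<^bsub>F\<^esub> = \<zero>\<^bsub>F\<^esub>"
    by (simp add: numeral_2_eq_2)
  have "inversion_split G (f ` (A \<times> carrier E)) (f (a, \<one>\<^bsub>E\<^esub>)) (f (b, \<one>\<^bsub>E\<^esub>)) e"
    by (intro inversion_split_iso[OF DE G(1) f] inversion_split_DirProd D(1) E(1) split)
  then have ext: "inversion_extension F G (f ` (A \<times> carrier E)) (f (a, \<one>\<^bsub>E\<^esub>)) (f (b, \<one>\<^bsub>E\<^esub>)) e"
    using F(1,2) G(1) fin char2 e
    by (intro inversion_extension.intro finite_group_algebra.intro finite_group_algebra_axioms.intro
        inversion_extension_axioms.intro)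
  have b: "b \<in> carrier D" using split by (simp add: inversion_split_def)
  then have bE: "(b, \<one>\<^bsub>E\<^esub>) \<in> carrier (D \<times>\<times> E)" by simp
  have "f (b, \<one>\<^bsub>E\<^esub>) \<otimes>\<^bsub>G\<^esub> f (b, \<one>\<^bsub>E\<^esub>) = f (b \<otimes>\<^bsub>D\<^esub> b, \<one>\<^bsub>E\<^esub>)"
    using f.hom_mult[OF bE bE] by simp
  moreover have "f (b \<otimes>\<^bsub>D\<^esub> b, \<one>\<^bsub>E\<^esub>) = f \<one>\<^bsub>D \<times>\<times> E\<^esub> \<longleftrightarrow> (b \<otimes>\<^bsub>D\<^esub> b, \<one>\<^bsub>E\<^esub>) = \<one>\<^bsub>D \<times>\<times> E\<^esub>"
    using b group.is_monoid[OF D(1)] f.G.one_closed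
    by (intro inj_on_eq_iff[OF inj]) (simp_all add: monoid.m_closed)
  ultimately have "f (b, \<one>\<^bsub>E\<^esub>) \<otimes>\<^bsub>G\<^esub> f (b, \<one>\<^bsub>E\<^esub>) = \<one>\<^bsub>G\<^esub> \<longleftrightarrow> b \<otimes>\<^bsub>D\<^esub> b = \<one>\<^bsub>D\<^esub>"
    by (simp add: f.hom_one del: one_DirProd) (simp add: one_DirProd)
  with ext that show thesis by blast
qed

theorem corollary3:
  fixes F :: "('f, 'u) ring_scheme"
    and G :: "('g, 'v) monoid_scheme"
    and D :: "('d, 'w) monoid_scheme"
    and Q :: "('q, 'x) monoid_scheme"
    and E :: "('e, 'y) monoid_scheme"
    and m :: nat
  assumes "m > 2"
    and "dihedral_2_group m D"
    and "generalized_quaternion_group m Q"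
    and "elementary_abelian_2_group E" and "finite (carrier E)"
    and "field F" and "finite (carrier F)" and "has_characteristic F 2"
    and "group G"
  shows "(G \<cong> D \<times>\<times> E \<longrightarrow>
            card (unitary_normalized_units F G) =
              1 * card (carrier F) ^ ((order G + card (involutions_with_one G)) div 2 - 1)) \<and>
         (G \<cong> Q \<times>\<times> E \<longrightarrow>
            card (unitary_normalized_units F G) =
              4 * card (carrier F) ^ ((order G + card (involutions_with_one G)) div 2 - 1))"
proof (intro conjI impI)
  \<comment> \<open>The parameter e is m - 1, since \<open>a\<close> has order 2^(m - 1).\<close>
  have e: "2 \<le> m - 1" using assms(1) by simp
  have fin: "finite (carrier K)" if "order K = 2 ^ m" for K :: "('k, 'l) monoid_scheme"
    using that by (intro card_ge_0_finite) (simp add: order_def)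
  have square: "x [^]\<^bsub>K\<^esub> (2::nat) = x \<otimes>\<^bsub>K\<^esub> x" if "group K" "x \<in> carrier K" for K :: "('k, 'l) monoid_scheme" and x
    using that by (simp add: numeral_2_eq_2 group.is_monoid monoid.l_one)
  {
    assume iso: "G \<cong> D \<times>\<times> E"
    obtain a b where D: "group D" "order D = 2 ^ m" "a \<in> carrier D" "b \<in> carrier D"
      "generate D {a, b} = carrier D" "a [^]\<^bsub>D\<^esub> ((2::nat) ^ (m - 1)) = \<one>\<^bsub>D\<^esub>"
      "b [^]\<^bsub>D\<^esub> (2::nat) = \<one>\<^bsub>D\<^esub>" "inv\<^bsub>D\<^esub> b \<otimes>\<^bsub>D\<^esub> a \<otimes>\<^bsub>D\<^esub> b = inv\<^bsub>D\<^esub> a"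
      using assms(2) unfolding dihedral_2_group_def by blast
    have "inversion_split D (generate D {a}) a b (m - 1)"
      using D assms(1) by (intro inversion_split_of_presentation) simp_all
    then obtain A' a' b' where ext: "inversion_extension F G A' a' b' (m - 1)"
      and b': "b' \<otimes>\<^bsub>G\<^esub> b' = \<one>\<^bsub>G\<^esub> \<longleftrightarrow> b \<otimes>\<^bsub>D\<^esub> b = \<one>\<^bsub>D\<^esub>"
      by (rule inversion_extension_of_product[OF _ D(1) fin[OF D(2)] e assms(4-9) iso])
    have "b' \<otimes>\<^bsub>G\<^esub> b' = \<one>\<^bsub>G\<^esub>"
      using b' D(7) square[OF D(1,4)] by simp
    then show "card (unitary_normalized_units F G) =
        1 * card (carrier F) ^ ((order G + card (involutions_with_one G)) div 2 - 1)"
      using inversion_extension.card_unitary_dihedral[OF ext] by simp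
  next
    assume iso: "G \<cong> Q \<times>\<times> E"
    obtain a b where Q: "group Q" "order Q = 2 ^ m" "a \<in> carrier Q" "b \<in> carrier Q"
      "generate Q {a, b} = carrier Q" "a [^]\<^bsub>Q\<^esub> ((2::nat) ^ (m - 1)) = \<one>\<^bsub>Q\<^esub>"
      "b [^]\<^bsub>Q\<^esub> (2::nat) = a [^]\<^bsub>Q\<^esub> ((2::nat) ^ (m - 2))" "inv\<^bsub>Q\<^esub> b \<otimes>\<^bsub>Q\<^esub> a \<otimes>\<^bsub>Q\<^esub> b = inv\<^bsub>Q\<^esub> a"
      using assms(3) unfolding generalized_quaternion_group_def by blast
    have split: "inversion_split Q (generate Q {a}) a b (m - 1)"
      using Q assms(1) by (intro inversion_split_of_presentation) simp_all
    then obtain A' a' b' where ext: "inversion_extension F G A' a' b' (m - 1)"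
      and b': "b' \<otimes>\<^bsub>G\<^esub> b' = \<one>\<^bsub>G\<^esub> \<longleftrightarrow> b \<otimes>\<^bsub>Q\<^esub> b = \<one>\<^bsub>Q\<^esub>"
      by (rule inversion_extension_of_product[OF _ Q(1) fin[OF Q(2)] e assms(4-9) iso])
    \<comment> \<open>With e = m - 1, the element a^(2^(e - 1)), nontrivial by \<open>split\<close>,
      is the square of b. This places Q in the case b^2 = z.\<close>
    have "m - 1 - 1 = m - 2" by simp
    then have "a [^]\<^bsub>Q\<^esub> ((2::nat) ^ (m - 2)) \<noteq> \<one>\<^bsub>Q\<^esub>"
      using split unfolding inversion_split_def by (simp only:) blast
    then have "b' \<otimes>\<^bsub>G\<^esub> b' \<noteq> \<one>\<^bsub>G\<^esub>"
      using b' Q(7) square[OF Q(1,4)] by simp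
    then show "card (unitary_normalized_units F G) =
        4 * card (carrier F) ^ ((order G + card (involutions_with_one G)) div 2 - 1)"
      by (rule inversion_extension.card_unitary_quaternion[OF ext])
  }
qed

end
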